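(* For any uniform traced category $\mathcal{U}$, the monoidal double category $\mathbb{I}\mathsf{nt}(\mathcal{U})$ is compact.
   Context: A traced category is a symmetric monoidal category $(\mathcal{T},I,\otimes)$ (associators and unitors suppressed, braiding $\sigma$) with functions $\mathrm{Tr}^U_{A,B}\colon\mathcal{T}(A\otimes U,B\otimes U)\to\mathcal{T}(A,B)$ for all objects $A,B,U$ such that: (naturality) $\mathrm{Tr}^U_{A',B'}((g\otimes U)\circ k\circ(f\otimes U))=g\circ\mathrm{Tr}^U_{A,B}(k)\circ f$ for $f\colon A'\to A$, $g\colon B\to B'$, $k\colon A\otimes U\to B\otimes U$; (dinaturality) $\mathrm{Tr}^V_{A,B}((B\otimes h)\circ k)=\mathrm{Tr}^U_{A,B}(k\circ(A\otimes h))$ for $h\colon U\to V$, $k\colon A\otimes V\to B\otimes U$; (monoidality) $\mathrm{Tr}^I_{A,B}$ is the canonical identification and $\mathrm{Tr}^{U\otimes V}_{A,B}=\mathrm{Tr}^U_{A,B}\circ\mathrm{Tr}^V_{A\otimes U,B\otimes U}$; (superposing) $\mathrm{Tr}^U_{A'\otimes A,B'\otimes B}(h\otimes k)=h\otimes\mathrm{Tr}^U_{A,B}(k)$ for $h\colon A'\to B'$; (yanking) $\mathrm{Tr}^U_{U,U}(\sigma_{U,U})=\mathrm{id}_U$. A morphism $s\colon U\to V$ is strict if for all $A,B$, $f\colon A\otimes U\to B\otimes U$, $g\colon A\otimes V\to B\otimes V$ with $(B\otimes s)\circ f=g\circ(A\otimes s)$ one has $\mathrm{Tr}^U_{A,B}(f)=\mathrm{Tr}^V_{A,B}(g)$.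 A traced category is uniform if every morphism is strict. For a uniform traced category $\mathcal{U}$, $\mathbb{I}\mathsf{nt}(\mathcal{U})$ is the following thin (at most one cell per boundary) symmetric monoidal double category. Objects are pairs $A=(A^-,A^+)$ of objects of $\mathcal{U}$. Tight maps $s\colon A_1\to A_2$ are pairs $(s^-\colon A_1^-\to A_2^-,\ s^+\colon A_1^+\to A_2^+)$, composed componentwise. Loose maps $A\to B$ are maps $f\colon B^-\otimes A^+\to B^+\otimes A^-$ in $\mathcal{U}$; the loose identity on $A$ is the braiding $A^-\otimes A^+\to A^+\otimes A^-$, and the composite of $f\colon A\to B$ and $g\colon B\to C$ is $$\mathrm{Tr}^{B^-}_{C^-\otimes A^+,\,C^+\otimes A^-}\big(C^-\otimes B^-\otimes A^+\xrightarrow{C^-\otimes f}C^-\otimes B^+\otimes A^-\xrightarrow{g\otimes A^-}C^+\otimes B^-\otimes A^-\big)$$ (middle factor traced out after inserting braidings). There is a cell with loose source $f_1\colon A_1\to B_1$, loose target $f_2\colon A_2\to B_2$, left tight map $s\colon A_1\to A_2$ and right tight map $t\colon B_1\to B_2$ iff $(t^+\otimes s^-)\circ f_1=f_2\circ(t^-\otimes s^+)$. The monoidal unit is $(I,I)$ and $A\otimes B=(A^-\otimes B^-,A^+\otimes B^+)$, with tensor of maps induced from $\mathcal{U}$. Compactness (after Patterson), for a thin symmetric monoidal double category $\mathbb{D}$: there is a dual, i.e. a double functor $(-)^*\colon\mathbb{D}^{\mathrm{co}}\to\mathbb{D}$, where $\mathbb{D}^{\mathrm{co}}$ is the loose-opposite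 of $\mathbb{D}$ (loose maps reversed, tight maps not), together with bijections, for all objects $A,B,C$, between loose maps $f^\sharp\colon A\otimes B\to C$ and loose maps $f^\flat\colon A\to B^*\otimes C$, such that: (1) for tight maps $s\colon A_1\to A_2$, $t\colon B_1\to B_2$, $u\colon C_1\to C_2$ and loose maps $f_i^\sharp\colon A_i\otimes B_i\to C_i$, there is a cell from $f_1^\sharp$ to $f_2^\sharp$ with left side $s\otimes t$ and right side $u$ iff there is a cell from $f_1^\flat$ to $f_2^\flat$ with left side $s$ and right side $t^*\otimes u$; (2) for loose maps $a\colon A'\to A$, $b\colon B'\to B$, $c\colon C\to C'$ and $f^\sharp\colon A\otimes B\to C$, there is an isomorphism (an invertible cell with identity tight sides) between $f^\flat$ precomposed with $a$ and postcomposed with $b^*\otimes c$, and the loose map corresponding under the bijection to $f^\sharp$ precomposed with $a\otimes b$ and postcomposed with $c$; subject to coherence conditions on these cells, which hold automatically when $\mathbb{D}$ is thin. *)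

theory Defs
  imports Main
begin

section \<open>Categories\<close>

record ('o, 'm) cat_data =
  Obj :: "'o set"
  Arr :: "'m set"
  Dom :: "'m \<Rightarrow> 'o"
  Cod :: "'m \<Rightarrow> 'o"
  ident :: "'o \<Rightarrow> 'm" ("\<one>\<index>")
  comp :: "'m \<Rightarrow> 'm \<Rightarrow> 'm" (infixr "\<cdot>\<index>" 55)

definition Hom :: "('o, 'm, 'x) cat_data_scheme \<Rightarrow> 'o \<Rightarrow> 'o \<Rightarrow> 'm set" where
  "Hom C A B = {f \<in> Arr C. Dom C f = A \<and> Cod C f = B}"

locale category =
  fixes C :: "('o, 'm, 'x) cat_data_scheme" (structure)
  assumes Dom_Obj: "f \<in> Arr C \<Longrightarrow> Dom C f \<in> Obj C"
    and Cod_Obj: "f \<in> Arr C \<Longrightarrow> Cod C f \<in> Obj C"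
    and ident_Hom: "A \<in> Obj C \<Longrightarrow> \<one> A \<in> Hom C A A"
    and comp_Hom: "f \<in> Hom C A B \<Longrightarrow> g \<in> Hom C B E \<Longrightarrow> g \<cdot> f \<in> Hom C A E"
    and ident_left: "f \<in> Hom C A B \<Longrightarrow> \<one> B \<cdot> f = f"
    and ident_right: "f \<in> Hom C A B \<Longrightarrow> f \<cdot> \<one> A = f"
    and comp_assoc:
      "f \<in> Hom C A B \<Longrightarrow> g \<in> Hom C B E \<Longrightarrow> h \<in> Hom C E F \<Longrightarrow> (h \<cdot> g) \<cdot> f = h \<cdot> (g \<cdot> f)"

definition inverse_arrows :: "('o, 'm, 'x) cat_data_scheme \<Rightarrow> 'm \<Rightarrow> 'm \<Rightarrow> bool" where
  "inverse_arrows C f g \<longleftrightarrow> f \<in> Arr C \<and> g \<in> Hom C (Cod C f) (Dom C f)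
     \<and> g \<cdot>\<^bsub>C\<^esub> f = \<one>\<^bsub>C\<^esub> (Dom C f) \<and> f \<cdot>\<^bsub>C\<^esub> g = \<one>\<^bsub>C\<^esub> (Cod C f)"

definition iso_arrow :: "('o, 'm, 'x) cat_data_scheme \<Rightarrow> 'm \<Rightarrow> bool" where
  "iso_arrow C f \<longleftrightarrow> (\<exists>g. inverse_arrows C f g)"

definition inv_arrow :: "('o, 'm, 'x) cat_data_scheme \<Rightarrow> 'm \<Rightarrow> 'm" ("inv\<index> _" [81] 80) where
  "inv_arrow C f = (THE g. inverse_arrows C f g)"


section \<open>Symmetric monoidal categories\<close>

text \<open>
  Monoidal categories are not assumed to be strict.  Wherever informal notation suppresses
  associators and unitors, they are written out below.  \<open>\<otimes>\<close> is the tensor of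
  objects and \<open>\<odot>\<close> the tensor of arrows.
\<close>

record ('o, 'm) sm_data = "('o, 'm) cat_data" +
  unit_obj :: 'o ("\<I>\<index>")
  tensor_obj :: "'o \<Rightarrow> 'o \<Rightarrow> 'o" (infixr "\<otimes>\<index>" 70)
  tensor_arr :: "'m \<Rightarrow> 'm \<Rightarrow> 'm" (infixr "\<odot>\<index>" 70)
  assoc :: "'o \<Rightarrow> 'o \<Rightarrow> 'o \<Rightarrow> 'm" ("\<alpha>\<index>")
  lunit :: "'o \<Rightarrow> 'm"
  runit :: "'o \<Rightarrow> 'm" ("\<rho>\<index>")
  braid :: "'o \<Rightarrow> 'o \<Rightarrow> 'm" ("\<sigma>\<index>")

locale symmetric_monoidal_category = category C
  for C :: "('o, 'm, 'x) sm_data_scheme" (structure) +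
  assumes unit_Obj: "\<I> \<in> Obj C"
    and tensor_Obj: "A \<in> Obj C \<Longrightarrow> B \<in> Obj C \<Longrightarrow> A \<otimes> B \<in> Obj C"
    and tensor_Hom:
      "f \<in> Hom C A B \<Longrightarrow> g \<in> Hom C A' B' \<Longrightarrow> f \<odot> g \<in> Hom C (A \<otimes> A') (B \<otimes> B')"
    and tensor_ident: "A \<in> Obj C \<Longrightarrow> B \<in> Obj C \<Longrightarrow> \<one> A \<odot> \<one> B = \<one> (A \<otimes> B)"
    and tensor_comp:
      "f \<in> Hom C A B \<Longrightarrow> g \<in> Hom C B E \<Longrightarrow> f' \<in> Hom C A' B' \<Longrightarrow> g' \<in> Hom C B' E'
       \<Longrightarrow> (g \<cdot> f) \<odot> (g' \<cdot> f') = (g \<odot> g') \<cdot> (f \<odot> f')"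
    and assoc_Hom:
      "A \<in> Obj C \<Longrightarrow> B \<in> Obj C \<Longrightarrow> E \<in> Obj C
       \<Longrightarrow> \<alpha> A B E \<in> Hom C ((A \<otimes> B) \<otimes> E) (A \<otimes> (B \<otimes> E))"
    and assoc_iso:
      "A \<in> Obj C \<Longrightarrow> B \<in> Obj C \<Longrightarrow> E \<in> Obj C \<Longrightarrow> iso_arrow C (\<alpha> A B E)"
    and assoc_natural:
      "f \<in> Hom C A A' \<Longrightarrow> g \<in> Hom C B B' \<Longrightarrow> h \<in> Hom C E E'
       \<Longrightarrow> \<alpha> A' B' E' \<cdot> ((f \<odot> g) \<odot> h) = (f \<odot> (g \<odot> h)) \<cdot> \<alpha> A B E"
    and lunit_Hom: "A \<in> Obj C \<Longrightarrow> lunit C A \<in> Hom C (\<I> \<otimes> A) A"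
    and lunit_iso: "A \<in> Obj C \<Longrightarrow> iso_arrow C (lunit C A)"
    and lunit_natural:
      "f \<in> Hom C A A' \<Longrightarrow> lunit C A' \<cdot> (\<one> \<I> \<odot> f) = f \<cdot> lunit C A"
    and runit_Hom: "A \<in> Obj C \<Longrightarrow> \<rho> A \<in> Hom C (A \<otimes> \<I>) A"
    and runit_iso: "A \<in> Obj C \<Longrightarrow> iso_arrow C (\<rho> A)"
    and runit_natural:
      "f \<in> Hom C A A' \<Longrightarrow> \<rho> A' \<cdot> (f \<odot> \<one> \<I>) = f \<cdot> \<rho> A"
    and pentagon:
      "A \<in> Obj C \<Longrightarrow> B \<in> Obj C \<Longrightarrow> E \<in> Obj C \<Longrightarrow> F \<in> Obj C
       \<Longrightarrow> (\<one> A \<odot> \<alpha> B E F) \<cdot> \<alpha> A (B \<otimes> E) F \<cdot> (\<alpha> A B E \<odot> \<one> F)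
         = \<alpha> A B (E \<otimes> F) \<cdot> \<alpha> (A \<otimes> B) E F"
    and triangle:
      "A \<in> Obj C \<Longrightarrow> B \<in> Obj C
       \<Longrightarrow> (\<one> A \<odot> lunit C B) \<cdot> \<alpha> A \<I> B = \<rho> A \<odot> \<one> B"
    and braid_Hom: "A \<in> Obj C \<Longrightarrow> B \<in> Obj C \<Longrightarrow> \<sigma> A B \<in> Hom C (A \<otimes> B) (B \<otimes> A)"
    and braid_natural:
      "f \<in> Hom C A A' \<Longrightarrow> g \<in> Hom C B B' \<Longrightarrow> \<sigma> A' B' \<cdot> (f \<odot> g) = (g \<odot> f) \<cdot> \<sigma> A B"
    and braid_symmetric:
      "A \<in> Obj C \<Longrightarrow> B \<in> Obj C \<Longrightarrow> \<sigma> B A \<cdot> \<sigma> A B = \<one> (A \<otimes> B)"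
    and hexagon:
      "A \<in> Obj C \<Longrightarrow> B \<in> Obj C \<Longrightarrow> E \<in> Obj C
       \<Longrightarrow> \<alpha> B E A \<cdot> \<sigma> A (B \<otimes> E) \<cdot> \<alpha> A B E
         = (\<one> B \<odot> \<sigma> A E) \<cdot> \<alpha> B A E \<cdot> (\<sigma> A B \<odot> \<one> E)"

definition prod_sm :: "('o, 'm, 'x) sm_data_scheme \<Rightarrow> ('p, 'n, 'y) sm_data_scheme
    \<Rightarrow> ('o \<times> 'p, 'm \<times> 'n) sm_data" where
  "prod_sm C D =
    \<lparr>Obj = Obj C \<times> Obj D,
     Arr = Arr C \<times> Arr D,
     Dom = map_prod (Dom C) (Dom D),
     Cod = map_prod (Cod C) (Cod D),
     ident = map_prod (ident C) (ident D),
     comp = (\<lambda>g f. (fst g \<cdot>\<^bsub>C\<^esub> fst f, snd g \<cdot>\<^bsub>D\<^esub> snd f)),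
     unit_obj = (\<I>\<^bsub>C\<^esub>, \<I>\<^bsub>D\<^esub>),
     tensor_obj = (\<lambda>A B. (fst A \<otimes>\<^bsub>C\<^esub> fst B, snd A \<otimes>\<^bsub>D\<^esub> snd B)),
     tensor_arr = (\<lambda>f g. (fst f \<odot>\<^bsub>C\<^esub> fst g, snd f \<odot>\<^bsub>D\<^esub> snd g)),
     assoc = (\<lambda>A B E. (\<alpha>\<^bsub>C\<^esub> (fst A) (fst B) (fst E), \<alpha>\<^bsub>D\<^esub> (snd A) (snd B) (snd E))),
     lunit = map_prod (lunit C) (lunit D),
     runit = map_prod (runit C) (runit D),
     braid = (\<lambda>A B. (\<sigma>\<^bsub>C\<^esub> (fst A) (fst B), \<sigma>\<^bsub>D\<^esub> (snd A) (snd B)))\<rparr>"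


section \<open>Traced categories and uniformity\<close>

text \<open>\<open>tr C U A B f\<close> is the trace \<open>A \<rightarrow> B\<close> of \<open>f : A \<otimes> U \<rightarrow> B \<otimes> U\<close>.\<close>

record ('o, 'm) traced_data = "('o, 'm) sm_data" +
  tr :: "'o \<Rightarrow> 'o \<Rightarrow> 'o \<Rightarrow> 'm \<Rightarrow> 'm" ("Tr\<index>")

locale traced_category = symmetric_monoidal_category C
  for C :: "('o, 'm, 'x) traced_data_scheme" (structure) +
  assumes tr_Hom:
      "A \<in> Obj C \<Longrightarrow> B \<in> Obj C \<Longrightarrow> U \<in> Obj C \<Longrightarrow> f \<in> Hom C (A \<otimes> U) (B \<otimes> U)
       \<Longrightarrow> Tr U A B f \<in> Hom C A B"
    and tr_natural:
      "A \<in> Obj C \<Longrightarrow> B \<in> Obj C \<Longrightarrow> U \<in> Obj C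
       \<Longrightarrow> f \<in> Hom C A' A \<Longrightarrow> g \<in> Hom C B B' \<Longrightarrow> k \<in> Hom C (A \<otimes> U) (B \<otimes> U)
       \<Longrightarrow> Tr U A' B' ((g \<odot> \<one> U) \<cdot> k \<cdot> (f \<odot> \<one> U)) = g \<cdot> Tr U A B k \<cdot> f"
    and tr_dinatural:
      "A \<in> Obj C \<Longrightarrow> B \<in> Obj C \<Longrightarrow> h \<in> Hom C U V \<Longrightarrow> k \<in> Hom C (A \<otimes> V) (B \<otimes> U)
       \<Longrightarrow> Tr V A B ((\<one> B \<odot> h) \<cdot> k) = Tr U A B (k \<cdot> (\<one> A \<odot> h))"
    and tr_unit:
      "A \<in> Obj C \<Longrightarrow> B \<in> Obj C \<Longrightarrow> f \<in> Hom C (A \<otimes> \<I>) (B \<otimes> \<I>)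
       \<Longrightarrow> Tr \<I> A B f = \<rho> B \<cdot> f \<cdot> inv (\<rho> A)"
    and tr_tensor:
      "A \<in> Obj C \<Longrightarrow> B \<in> Obj C \<Longrightarrow> U \<in> Obj C \<Longrightarrow> V \<in> Obj C
       \<Longrightarrow> f \<in> Hom C (A \<otimes> (U \<otimes> V)) (B \<otimes> (U \<otimes> V))
       \<Longrightarrow> Tr (U \<otimes> V) A B f
         = Tr U A B (Tr V (A \<otimes> U) (B \<otimes> U) (inv (\<alpha> B U V) \<cdot> f \<cdot> \<alpha> A U V))"
    and tr_superpose:
      "A \<in> Obj C \<Longrightarrow> B \<in> Obj C \<Longrightarrow> U \<in> Obj C
       \<Longrightarrow> h \<in> Hom C A' B' \<Longrightarrow> k \<in> Hom C (A \<otimes> U) (B \<otimes> U)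
       \<Longrightarrow> Tr U (A' \<otimes> A) (B' \<otimes> B) (inv (\<alpha> B' B U) \<cdot> (h \<odot> k) \<cdot> \<alpha> A' A U)
         = h \<odot> Tr U A B k"
    and tr_yank: "U \<in> Obj C \<Longrightarrow> Tr U U U (\<sigma> U U) = \<one> U"

definition strict_arrow :: "('o, 'm, 'x) traced_data_scheme \<Rightarrow> 'm \<Rightarrow> bool" where
  "strict_arrow C s \<longleftrightarrow>
    (\<forall>A \<in> Obj C. \<forall>B \<in> Obj C.
      \<forall>f \<in> Hom C (A \<otimes>\<^bsub>C\<^esub> Dom C s) (B \<otimes>\<^bsub>C\<^esub> Dom C s).
      \<forall>g \<in> Hom C (A \<otimes>\<^bsub>C\<^esub> Cod C s) (B \<otimes>\<^bsub>C\<^esub> Cod C s).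
        (\<one>\<^bsub>C\<^esub> B \<odot>\<^bsub>C\<^esub> s) \<cdot>\<^bsub>C\<^esub> f = g \<cdot>\<^bsub>C\<^esub> (\<one>\<^bsub>C\<^esub> A \<odot>\<^bsub>C\<^esub> s)
        \<longrightarrow> Tr\<^bsub>C\<^esub> (Dom C s) A B f = Tr\<^bsub>C\<^esub> (Cod C s) A B g)"

locale uniform_traced_category = traced_category C
  for C :: "('o, 'm, 'x) traced_data_scheme" (structure) +
  assumes uniform: "s \<in> Arr C \<Longrightarrow> strict_arrow C s"


section \<open>Thin symmetric monoidal double categories\<close>

text \<open>
  There is at most one cell per boundary, so cells are given by a relation:
  \<open>Cell D f g s t\<close> says that there is a cell with loose source \<open>f\<close>, loose target \<open>g\<close>,
  left tight side \<open>s\<close> and right tight side \<open>t\<close>.  Every equation between cells,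
  hence every coherence condition, then holds automatically.  Tight composition is strict; loose
  composition is unital and associative up to invertible globular cells.
  The composite of \<open>f : A \<rightarrow> B\<close> and \<open>g : B \<rightarrow> E\<close> is
  \<open>lcomp D g f\<close>.
\<close>

record ('o, 't, 'l) dbl_data =
  Tight :: "('o, 't) sm_data"
  Loose :: "'l set"
  lsrc :: "'l \<Rightarrow> 'o"
  ltgt :: "'l \<Rightarrow> 'o"
  lident :: "'o \<Rightarrow> 'l"
  lcomp :: "'l \<Rightarrow> 'l \<Rightarrow> 'l" (infixr "\<bullet>\<index>" 55)
  ltensor :: "'l \<Rightarrow> 'l \<Rightarrow> 'l" (infixr "\<otimes>\<^sub>l\<index>" 70)
  Cell :: "'l \<Rightarrow> 'l \<Rightarrow> 't \<Rightarrow> 't \<Rightarrow> bool"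

definition LHom :: "('o, 't, 'l, 'x) dbl_data_scheme \<Rightarrow> 'o \<Rightarrow> 'o \<Rightarrow> 'l set" where
  "LHom D A B = {f \<in> Loose D. lsrc D f = A \<and> ltgt D f = B}"

text \<open>
  Existence of an invertible cell with identity tight sides; by thinness, cells in the two
  directions are mutually inverse.
\<close>

definition globular_iso :: "('o, 't, 'l, 'x) dbl_data_scheme \<Rightarrow> 'l \<Rightarrow> 'l \<Rightarrow> bool" where
  "globular_iso D f g \<longleftrightarrow>
     Cell D f g (\<one>\<^bsub>Tight D\<^esub> (lsrc D f)) (\<one>\<^bsub>Tight D\<^esub> (ltgt D f)) \<and>
     Cell D g f (\<one>\<^bsub>Tight D\<^esub> (lsrc D g)) (\<one>\<^bsub>Tight D\<^esub> (ltgt D g))"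

locale thin_double_category =
  fixes D :: "('o, 't, 'l, 'x) dbl_data_scheme" (structure)
  assumes tight_category: "category (Tight D)"
    and lsrc_Obj: "f \<in> Loose D \<Longrightarrow> lsrc D f \<in> Obj (Tight D)"
    and ltgt_Obj: "f \<in> Loose D \<Longrightarrow> ltgt D f \<in> Obj (Tight D)"
    and lident_LHom: "A \<in> Obj (Tight D) \<Longrightarrow> lident D A \<in> LHom D A A"
    and lcomp_LHom: "f \<in> LHom D A B \<Longrightarrow> g \<in> LHom D B E \<Longrightarrow> g \<bullet> f \<in> LHom D A E"
    and Cell_Loose: "Cell D f g s t \<Longrightarrow> f \<in> Loose D \<and> g \<in> Loose D"
    and Cell_Tight:
      "Cell D f g s t \<Longrightarrow> s \<in> Hom (Tight D) (lsrc D f) (lsrc D g)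
                        \<and> t \<in> Hom (Tight D) (ltgt D f) (ltgt D g)"
    and Cell_vident:
      "f \<in> LHom D A B \<Longrightarrow> Cell D f f (\<one>\<^bsub>Tight D\<^esub> A) (\<one>\<^bsub>Tight D\<^esub> B)"
    and Cell_vcomp:
      "Cell D f g s t \<Longrightarrow> Cell D g h s' t'
       \<Longrightarrow> Cell D f h (s' \<cdot>\<^bsub>Tight D\<^esub> s) (t' \<cdot>\<^bsub>Tight D\<^esub> t)"
    and Cell_lident:
      "s \<in> Hom (Tight D) A B \<Longrightarrow> Cell D (lident D A) (lident D B) s s"
    and Cell_lcomp:
      "f \<in> LHom D A B \<Longrightarrow> f' \<in> LHom D B E \<Longrightarrow> g \<in> LHom D A' B' \<Longrightarrow> g' \<in> LHom D B' E'
       \<Longrightarrow> Cell D f g s t \<Longrightarrow> Cell D f' g' t u \<Longrightarrow> Cell D (f' \<bullet> f) (g' \<bullet> g) s u"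
    and lcomp_assoc:
      "f \<in> LHom D A B \<Longrightarrow> g \<in> LHom D B E \<Longrightarrow> h \<in> LHom D E F
       \<Longrightarrow> globular_iso D ((h \<bullet> g) \<bullet> f) (h \<bullet> (g \<bullet> f))"
    and lcomp_ident_left: "f \<in> LHom D A B \<Longrightarrow> globular_iso D (lident D B \<bullet> f) f"
    and lcomp_ident_right: "f \<in> LHom D A B \<Longrightarrow> globular_iso D (f \<bullet> lident D A) f"

text \<open>
  The loose maps and cells also form a symmetric monoidal category, with unit the loose identity
  on \<open>\<I>\<close>, strictly preserved by source and target.  Its structural isomorphisms are
  cells whose two sides are the corresponding tight structural isomorphisms.
\<close>

locale thin_symmetric_monoidal_double_category = thin_double_category D
  for D :: "('o, 't, 'l, 'x) dbl_data_scheme" (structure) +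
  assumes tight_symmetric_monoidal: "symmetric_monoidal_category (Tight D)"
    and ltensor_LHom:
      "f \<in> LHom D A B \<Longrightarrow> g \<in> LHom D A' B'
       \<Longrightarrow> f \<otimes>\<^sub>l g \<in> LHom D (A \<otimes>\<^bsub>Tight D\<^esub> A') (B \<otimes>\<^bsub>Tight D\<^esub> B')"
    and Cell_ltensor:
      "Cell D f g s t \<Longrightarrow> Cell D f' g' s' t'
       \<Longrightarrow> Cell D (f \<otimes>\<^sub>l f') (g \<otimes>\<^sub>l g') (s \<odot>\<^bsub>Tight D\<^esub> s') (t \<odot>\<^bsub>Tight D\<^esub> t')"
    and ltensor_lcomp:
      "f \<in> LHom D A B \<Longrightarrow> g \<in> LHom D B E \<Longrightarrow> f' \<in> LHom D A' B' \<Longrightarrow> g' \<in> LHom D B' E'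
       \<Longrightarrow> globular_iso D ((g \<otimes>\<^sub>l g') \<bullet> (f \<otimes>\<^sub>l f')) ((g \<bullet> f) \<otimes>\<^sub>l (g' \<bullet> f'))"
    and ltensor_lident:
      "A \<in> Obj (Tight D) \<Longrightarrow> B \<in> Obj (Tight D)
       \<Longrightarrow> globular_iso D (lident D (A \<otimes>\<^bsub>Tight D\<^esub> B)) (lident D A \<otimes>\<^sub>l lident D B)"
    and Cell_assoc:
      "f \<in> LHom D A A' \<Longrightarrow> g \<in> LHom D B B' \<Longrightarrow> h \<in> LHom D E E'
       \<Longrightarrow> Cell D ((f \<otimes>\<^sub>l g) \<otimes>\<^sub>l h) (f \<otimes>\<^sub>l (g \<otimes>\<^sub>l h))
             (\<alpha>\<^bsub>Tight D\<^esub> A B E) (\<alpha>\<^bsub>Tight D\<^esub> A' B' E')"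
    and Cell_assoc_inv:
      "f \<in> LHom D A A' \<Longrightarrow> g \<in> LHom D B B' \<Longrightarrow> h \<in> LHom D E E'
       \<Longrightarrow> Cell D (f \<otimes>\<^sub>l (g \<otimes>\<^sub>l h)) ((f \<otimes>\<^sub>l g) \<otimes>\<^sub>l h)
             (inv\<^bsub>Tight D\<^esub> (\<alpha>\<^bsub>Tight D\<^esub> A B E)) (inv\<^bsub>Tight D\<^esub> (\<alpha>\<^bsub>Tight D\<^esub> A' B' E'))"
    and Cell_lunit:
      "f \<in> LHom D A A'
       \<Longrightarrow> Cell D (lident D \<I>\<^bsub>Tight D\<^esub> \<otimes>\<^sub>l f) f (lunit (Tight D) A) (lunit (Tight D) A')"
    and Cell_lunit_inv:
      "f \<in> LHom D A A'
       \<Longrightarrow> Cell D f (lident D \<I>\<^bsub>Tight D\<^esub> \<otimes>\<^sub>l f)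
             (inv\<^bsub>Tight D\<^esub> (lunit (Tight D) A)) (inv\<^bsub>Tight D\<^esub> (lunit (Tight D) A'))"
    and Cell_runit:
      "f \<in> LHom D A A'
       \<Longrightarrow> Cell D (f \<otimes>\<^sub>l lident D \<I>\<^bsub>Tight D\<^esub>) f (\<rho>\<^bsub>Tight D\<^esub> A) (\<rho>\<^bsub>Tight D\<^esub> A')"
    and Cell_runit_inv:
      "f \<in> LHom D A A'
       \<Longrightarrow> Cell D f (f \<otimes>\<^sub>l lident D \<I>\<^bsub>Tight D\<^esub>)
             (inv\<^bsub>Tight D\<^esub> (\<rho>\<^bsub>Tight D\<^esub> A)) (inv\<^bsub>Tight D\<^esub> (\<rho>\<^bsub>Tight D\<^esub> A'))"
    and Cell_braid:
      "f \<in> LHom D A A' \<Longrightarrow> g \<in> LHom D B B'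
       \<Longrightarrow> Cell D (f \<otimes>\<^sub>l g) (g \<otimes>\<^sub>l f) (\<sigma>\<^bsub>Tight D\<^esub> A B) (\<sigma>\<^bsub>Tight D\<^esub> A' B')"


section \<open>Compactness\<close>

definition loose_op :: "('o, 't, 'l, 'x) dbl_data_scheme \<Rightarrow> ('o, 't, 'l, 'x) dbl_data_scheme" where
  "loose_op D = D\<lparr>lsrc := ltgt D, ltgt := lsrc D,
                  lcomp := (\<lambda>g f. f \<bullet>\<^bsub>D\<^esub> g),
                  Cell := (\<lambda>f g s t. Cell D f g t s)\<rparr>"

text \<open>
  Double functors preserve tight composition strictly and loose composition up to invertible
  globular cells; no compatibility with monoidal structure is imposed.
\<close>

locale double_functor =
  fixes D :: "('o, 't, 'l, 'x) dbl_data_scheme"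
    and E :: "('p, 'u, 'k, 'y) dbl_data_scheme"
    and Fo :: "'o \<Rightarrow> 'p" and Ft :: "'t \<Rightarrow> 'u" and Fl :: "'l \<Rightarrow> 'k"
  assumes Fo_Obj: "A \<in> Obj (Tight D) \<Longrightarrow> Fo A \<in> Obj (Tight E)"
    and Ft_Hom: "s \<in> Hom (Tight D) A B \<Longrightarrow> Ft s \<in> Hom (Tight E) (Fo A) (Fo B)"
    and Ft_ident: "A \<in> Obj (Tight D) \<Longrightarrow> Ft (\<one>\<^bsub>Tight D\<^esub> A) = \<one>\<^bsub>Tight E\<^esub> (Fo A)"
    and Ft_comp:
      "s \<in> Hom (Tight D) A B \<Longrightarrow> t \<in> Hom (Tight D) B G
       \<Longrightarrow> Ft (t \<cdot>\<^bsub>Tight D\<^esub> s) = Ft t \<cdot>\<^bsub>Tight E\<^esub> Ft s"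
    and Fl_LHom: "f \<in> LHom D A B \<Longrightarrow> Fl f \<in> LHom E (Fo A) (Fo B)"
    and F_Cell: "Cell D f g s t \<Longrightarrow> Cell E (Fl f) (Fl g) (Ft s) (Ft t)"
    and Fl_lident:
      "A \<in> Obj (Tight D) \<Longrightarrow> globular_iso E (Fl (lident D A)) (lident E (Fo A))"
    and Fl_lcomp:
      "f \<in> LHom D A B \<Longrightarrow> g \<in> LHom D B G
       \<Longrightarrow> globular_iso E (Fl (g \<bullet>\<^bsub>D\<^esub> f)) (Fl g \<bullet>\<^bsub>E\<^esub> Fl f)"

text \<open>
  \<open>so\<close>, \<open>st\<close>, \<open>sl\<close> are the actions of the dual on objects, tight maps and loose maps, and
  \<open>flat A B K\<close> takes loose maps \<open>A \<otimes> B \<rightarrow> K\<close> to loose maps \<open>A \<rightarrow> so B \<otimes> K\<close>.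
\<close>

locale compact_structure =
  thin_symmetric_monoidal_double_category D + dual: double_functor "loose_op D" D so st sl
  for D :: "('o, 't, 'l, 'x) dbl_data_scheme" (structure)
    and so :: "'o \<Rightarrow> 'o" and st :: "'t \<Rightarrow> 't" and sl :: "'l \<Rightarrow> 'l" +
  fixes flat :: "'o \<Rightarrow> 'o \<Rightarrow> 'o \<Rightarrow> 'l \<Rightarrow> 'l"
  assumes flat_bij:
      "A \<in> Obj (Tight D) \<Longrightarrow> B \<in> Obj (Tight D) \<Longrightarrow> K \<in> Obj (Tight D)
       \<Longrightarrow> bij_betw (flat A B K)
             (LHom D (A \<otimes>\<^bsub>Tight D\<^esub> B) K) (LHom D A (so B \<otimes>\<^bsub>Tight D\<^esub> K))"
    and flat_Cell_iff:
      "s \<in> Hom (Tight D) A1 A2 \<Longrightarrow> t \<in> Hom (Tight D) B1 B2 \<Longrightarrow> u \<in> Hom (Tight D) K1 K2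
       \<Longrightarrow> f1 \<in> LHom D (A1 \<otimes>\<^bsub>Tight D\<^esub> B1) K1 \<Longrightarrow> f2 \<in> LHom D (A2 \<otimes>\<^bsub>Tight D\<^esub> B2) K2
       \<Longrightarrow> Cell D f1 f2 (s \<odot>\<^bsub>Tight D\<^esub> t) u
         \<longleftrightarrow> Cell D (flat A1 B1 K1 f1) (flat A2 B2 K2 f2) s (st t \<odot>\<^bsub>Tight D\<^esub> u)"
    and flat_natural:
      "a \<in> LHom D A' A \<Longrightarrow> b \<in> LHom D B' B \<Longrightarrow> c \<in> LHom D K K'
       \<Longrightarrow> f \<in> LHom D (A \<otimes>\<^bsub>Tight D\<^esub> B) K
       \<Longrightarrow> globular_iso D ((sl b \<otimes>\<^sub>l c) \<bullet> flat A B K f \<bullet> a)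
                           (flat A' B' K' (c \<bullet> f \<bullet> (a \<otimes>\<^sub>l b)))"

definition compact_double_category :: "('o, 't, 'l, 'x) dbl_data_scheme \<Rightarrow> bool" where
  "compact_double_category D \<longleftrightarrow> (\<exists>so st sl flat. compact_structure D so st sl flat)"


section \<open>The Int construction\<close>

text \<open>An object or tight map is a pair \<open>(X\<^sup>-, X\<^sup>+)\<close>.\<close>

abbreviation neg :: "'a \<times> 'a \<Rightarrow> 'a" ("_\<^sup>-" [1000] 999) where "X\<^sup>- \<equiv> fst X"
abbreviation pos :: "'a \<times> 'a \<Rightarrow> 'a" ("_\<^sup>+" [1000] 999) where "X\<^sup>+ \<equiv> snd X"

text \<open>
  An arrow of \<open>U\<close> does not determine the boundary of a loose map, so a loose map
  \<open>A \<rightarrow> B\<close> is a triple \<open>(A, B, f)\<close> with \<open>f : B\<^sup>- \<otimes> A\<^sup>+ \<rightarrow> B\<^sup>+ \<otimes> A\<^sup>-\<close>.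
\<close>

type_synonym ('o, 'm) int_loose = "('o \<times> 'o) \<times> ('o \<times> 'o) \<times> 'm"

definition int_Loose :: "('o, 'm, 'x) traced_data_scheme \<Rightarrow> ('o, 'm) int_loose set" where
  "int_Loose U = {(A, B, f). A \<in> Obj U \<times> Obj U \<and> B \<in> Obj U \<times> Obj U
      \<and> f \<in> Hom U (B\<^sup>- \<otimes>\<^bsub>U\<^esub> A\<^sup>+) (B\<^sup>+ \<otimes>\<^bsub>U\<^esub> A\<^sup>-)}"

definition int_lident :: "('o, 'm, 'x) traced_data_scheme \<Rightarrow> 'o \<times> 'o \<Rightarrow> ('o, 'm) int_loose" where
  "int_lident U A = (A, A, \<sigma>\<^bsub>U\<^esub> (A\<^sup>-) (A\<^sup>+))"

text \<open>\<open>(X \<otimes> Y) \<otimes> Z \<rightarrow> (X \<otimes> Z) \<otimes> Y\<close>\<close>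

definition swap_right :: "('o, 'm, 'x) sm_data_scheme \<Rightarrow> 'o \<Rightarrow> 'o \<Rightarrow> 'o \<Rightarrow> 'm" where
  "swap_right U X Y Z =
     inv\<^bsub>U\<^esub> (\<alpha>\<^bsub>U\<^esub> X Z Y) \<cdot>\<^bsub>U\<^esub> (\<one>\<^bsub>U\<^esub> X \<odot>\<^bsub>U\<^esub> \<sigma>\<^bsub>U\<^esub> Y Z) \<cdot>\<^bsub>U\<^esub> \<alpha>\<^bsub>U\<^esub> X Y Z"

text \<open>
  The traced arrow of \<open>g \<circ> f\<close>, for \<open>f : A \<rightarrow> B\<close> and \<open>g : B \<rightarrow> E\<close>, is
  \<open>(E\<^sup>- \<otimes> A\<^sup>+) \<otimes> B\<^sup>- \<rightarrow> (E\<^sup>- \<otimes> B\<^sup>-) \<otimes> A\<^sup>+ \<rightarrow> (E\<^sup>- \<otimes> B\<^sup>+) \<otimes> A\<^sup>- \<rightarrow> (E\<^sup>+ \<otimes> B\<^sup>-) \<otimes> A\<^sup>- \<rightarrow> (E\<^sup>+ \<otimes> A\<^sup>-) \<otimes> B\<^sup>-\<close>.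
\<close>

fun int_lcomp :: "('o, 'm, 'x) traced_data_scheme
    \<Rightarrow> ('o, 'm) int_loose \<Rightarrow> ('o, 'm) int_loose \<Rightarrow> ('o, 'm) int_loose" where
  "int_lcomp U (B', E, g) (A, B, f) =
    (A, E, Tr\<^bsub>U\<^esub> (B\<^sup>-) (E\<^sup>- \<otimes>\<^bsub>U\<^esub> A\<^sup>+) (E\<^sup>+ \<otimes>\<^bsub>U\<^esub> A\<^sup>-)
      (swap_right U (E\<^sup>+) (B\<^sup>-) (A\<^sup>-)
       \<cdot>\<^bsub>U\<^esub> (g \<odot>\<^bsub>U\<^esub> \<one>\<^bsub>U\<^esub> (A\<^sup>-))
       \<cdot>\<^bsub>U\<^esub> inv\<^bsub>U\<^esub> (\<alpha>\<^bsub>U\<^esub> (E\<^sup>-) (B\<^sup>+) (A\<^sup>-))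
       \<cdot>\<^bsub>U\<^esub> (\<one>\<^bsub>U\<^esub> (E\<^sup>-) \<odot>\<^bsub>U\<^esub> f)
       \<cdot>\<^bsub>U\<^esub> \<alpha>\<^bsub>U\<^esub> (E\<^sup>-) (B\<^sup>-) (A\<^sup>+)
       \<cdot>\<^bsub>U\<^esub> swap_right U (E\<^sup>-) (A\<^sup>+) (B\<^sup>-)))"

text \<open>Middle-four interchange \<open>(W \<otimes> X) \<otimes> (Y \<otimes> Z) \<rightarrow> (W \<otimes> Y) \<otimes> (X \<otimes> Z)\<close>\<close>

definition mid_four :: "('o, 'm, 'x) sm_data_scheme \<Rightarrow> 'o \<Rightarrow> 'o \<Rightarrow> 'o \<Rightarrow> 'o \<Rightarrow> 'm" where
  "mid_four U W X Y Z =
     \<alpha>\<^bsub>U\<^esub> (W \<otimes>\<^bsub>U\<^esub> Y) X Z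
     \<cdot>\<^bsub>U\<^esub> (swap_right U W X Y \<odot>\<^bsub>U\<^esub> \<one>\<^bsub>U\<^esub> Z)
     \<cdot>\<^bsub>U\<^esub> inv\<^bsub>U\<^esub> (\<alpha>\<^bsub>U\<^esub> (W \<otimes>\<^bsub>U\<^esub> X) Y Z)"

fun int_ltensor :: "('o, 'm, 'x) traced_data_scheme
    \<Rightarrow> ('o, 'm) int_loose \<Rightarrow> ('o, 'm) int_loose \<Rightarrow> ('o, 'm) int_loose" where
  "int_ltensor U (A, B, f) (A', B', f') =
    ((A\<^sup>- \<otimes>\<^bsub>U\<^esub> A'\<^sup>-, A\<^sup>+ \<otimes>\<^bsub>U\<^esub> A'\<^sup>+),
     (B\<^sup>- \<otimes>\<^bsub>U\<^esub> B'\<^sup>-, B\<^sup>+ \<otimes>\<^bsub>U\<^esub> B'\<^sup>+),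
     mid_four U (B\<^sup>+) (A\<^sup>-) (B'\<^sup>+) (A'\<^sup>-)
       \<cdot>\<^bsub>U\<^esub> (f \<odot>\<^bsub>U\<^esub> f')
       \<cdot>\<^bsub>U\<^esub> mid_four U (B\<^sup>-) (B'\<^sup>-) (A\<^sup>+) (A'\<^sup>+))"

fun int_Cell :: "('o, 'm, 'x) traced_data_scheme
    \<Rightarrow> ('o, 'm) int_loose \<Rightarrow> ('o, 'm) int_loose \<Rightarrow> 'm \<times> 'm \<Rightarrow> 'm \<times> 'm \<Rightarrow> bool" where
  "int_Cell U (A1, B1, f1) (A2, B2, f2) s t \<longleftrightarrow>
     (A1, B1, f1) \<in> int_Loose U \<and> (A2, B2, f2) \<in> int_Loose U
     \<and> s \<in> Hom (prod_sm U U) A1 A2 \<and> t \<in> Hom (prod_sm U U) B1 B2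
     \<and> (t\<^sup>+ \<odot>\<^bsub>U\<^esub> s\<^sup>-) \<cdot>\<^bsub>U\<^esub> f1 = f2 \<cdot>\<^bsub>U\<^esub> (t\<^sup>- \<odot>\<^bsub>U\<^esub> s\<^sup>+)"

definition int_double :: "('o, 'm, 'x) traced_data_scheme
    \<Rightarrow> ('o \<times> 'o, 'm \<times> 'm, ('o, 'm) int_loose) dbl_data" where
  "int_double U =
    \<lparr>Tight = prod_sm U U,
     Loose = int_Loose U,
     lsrc = fst,
     ltgt = fst \<circ> snd,
     lident = int_lident U,
     lcomp = int_lcomp U,
     ltensor = int_ltensor U,
     Cell = int_Cell U\<rparr>"

end

theory Submission
  imports Defs
begin

text \<open>
  Every arrow that the operations on loose maps build from given arrows of \<open>U\<close> is a wiring
  diagram: boxes, wires between them, and feedback loops.  Two such diagrams with the same boxes and the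
  same connections denote the same arrow, and most of the required equations are of this kind.
  The proof turns this remark into a calculus in which the equations become equations between
  sets of wires.

  Wires carry names, and a finite set \<open>S\<close> of names has an object \<open>obj S\<close>.  For disjoint \<open>S\<close> and
  \<open>T\<close> there is an isomorphism \<open>join S T : obj S \<otimes> obj T \<rightarrow> obj (S \<union> T)\<close>, and these isomorphisms are
  associative and commutative up to \<open>\<alpha>\<close> and \<open>\<sigma>\<close> (\<open>join_assoc\<close>, \<open>join_comm\<close>).  That is the whole
  content of coherence needed here; it comes from merging sorted lists.  A net is an arrow
  \<open>obj S \<rightarrow> obj T\<close>.  Juxtaposition \<open>\<parallel>\<close> of nets is strictly associative and commutative
  (\<open>par_assoc\<close>, \<open>par_comm\<close>) because names replace positions, and all braidings and
  rebracketings become identities (\<open>denotes_assoc\<close>, \<open>denotes_braid\<close>).  The trace becomes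
  contraction of a set of names, with \<open>contract_contract\<close> and \<open>contract_par\<close> as its laws.

  The key fact is \<open>contract_parallel_is_composite\<close>: plugging outputs of one net into inputs of
  another is itself a contraction, a consequence of yanking.  Hence the composite of
  \<open>f : A \<rightarrow> B\<close> and \<open>g : B \<rightarrow> E\<close> denotes the contraction of \<open>F \<parallel> G\<close> along both wires
  \<open>B\<^sup>-\<close> and \<open>B\<^sup>+\<close> (\<open>denotes_lcomp\<close>), a formula that is symmetric in \<open>f\<close> and \<open>g\<close>, although the
  definition by a trace along \<open>B\<^sup>-\<close> alone is not.  The tensor of loose maps denotes \<open>F \<parallel> G\<close>.

  The dual exchanges \<open>A\<^sup>-\<close> and \<open>A\<^sup>+\<close>, and \<open>flat\<close> moves wires across \<open>\<otimes>\<close>; both only conjugate by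
  structural isomorphisms, so neither changes the denoted net (\<open>denotes_dual\<close>, \<open>denotes_flat\<close>).
  Associativity of composition, its interchange with the tensor, contravariance of the dual and
  naturality of \<open>flat\<close> therefore all compare two ways of bracketing the same contraction.  The unit
  laws are instances of yanking.  Uniformity enters in one place, horizontal composition of
  cells (\<open>icell_lcomp\<close>): the two composites are traced along different objects \<open>B\<^sub>1\<^sup>-\<close> and
  \<open>B\<^sub>2\<^sup>-\<close>, and strictness of \<open>t\<^sup>- : B\<^sub>1\<^sup>- \<rightarrow> B\<^sub>2\<^sup>-\<close> is what compares the traces.
\<close>

section \<open>Rewriting in categories\<close>

lemma in_Hom_iff: "f \<in> Hom C A B \<longleftrightarrow> f \<in> Arr C \<and> Dom C f = A \<and> Cod C f = B"
  by (simp add: Hom_def)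

context category
begin

lemma ident_typing [simp]:
  assumes "A \<in> Obj C"
  shows "\<one> A \<in> Arr C" "Dom C (\<one> A) = A" "Cod C (\<one> A) = A"
  using ident_Hom[OF assms] by (auto simp: Hom_def)

lemma comp_typing [simp]:
  assumes "f \<in> Arr C" "g \<in> Arr C" "Dom C g = Cod C f"
  shows "g \<cdot> f \<in> Arr C" "Dom C (g \<cdot> f) = Dom C f" "Cod C (g \<cdot> f) = Cod C g"
  using comp_Hom[of f "Dom C f" "Cod C f" g "Cod C g"] assms by (auto simp: Hom_def)

lemma Dom_Obj' [simp]: "f \<in> Arr C \<Longrightarrow> Dom C f \<in> Obj C" by (rule Dom_Obj)
lemma Cod_Obj' [simp]: "f \<in> Arr C \<Longrightarrow> Cod C f \<in> Obj C" by (rule Cod_Obj)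

lemma Hom_Obj:
  assumes "f \<in> Hom C A B"
  shows "A \<in> Obj C" "B \<in> Obj C"
  using assms Dom_Obj Cod_Obj by (auto simp: Hom_def)

lemma id_comp [simp]: "f \<in> Arr C \<Longrightarrow> Cod C f = B \<Longrightarrow> \<one> B \<cdot> f = f"
  using ident_left[of f "Dom C f" B] by (auto simp: Hom_def)

lemma comp_id [simp]: "f \<in> Arr C \<Longrightarrow> Dom C f = A \<Longrightarrow> f \<cdot> \<one> A = f"
  using ident_right[of f A "Cod C f"] by (auto simp: Hom_def)

text \<open>
  The axioms speak of hom-sets, whose endpoints the simplifier cannot guess.  Stated
  with \<open>Dom\<close> and \<open>Cod\<close>, their side conditions are closed terms that rewriting can decide.
\<close>

lemma comp_assoc':
  "f \<in> Arr C \<Longrightarrow> g \<in> Arr C \<Longrightarrow> h \<in> Arr C \<Longrightarrow> Dom C g = Cod C f \<Longrightarrow> Dom C h = Cod C g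
   \<Longrightarrow> (h \<cdot> g) \<cdot> f = h \<cdot> g \<cdot> f"
  using comp_assoc[of f "Dom C f" "Cod C f" g "Cod C g" h "Cod C h"] by (auto simp: Hom_def)

lemma inverse_arrows_unique:
  assumes "inverse_arrows C f g" "inverse_arrows C f g'"
  shows "g = g'"
proof -
  have f: "f \<in> Arr C" and g: "g \<in> Hom C (Cod C f) (Dom C f)" "g' \<in> Hom C (Cod C f) (Dom C f)"
    and eq: "g \<cdot> f = \<one> (Dom C f)" "f \<cdot> g' = \<one> (Cod C f)"
    using assms by (auto simp: inverse_arrows_def)
  have "(g \<cdot> f) \<cdot> g' = g \<cdot> (f \<cdot> g')"
    by (rule comp_assoc') (use f g in \<open>auto simp: in_Hom_iff\<close>)
  then show ?thesis using f g eq by (simp add: in_Hom_iff)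
qed

lemma inverse_arrows_inv:
  assumes "inverse_arrows C f g"
  shows "inv f = g"
  unfolding inv_arrow_def by (rule the_equality) (use assms inverse_arrows_unique in auto)

lemma iso_inverse_arrows: "iso_arrow C f \<Longrightarrow> inverse_arrows C f (inv f)"
  unfolding iso_arrow_def using inverse_arrows_inv by auto

lemma iso_Arr: "iso_arrow C f \<Longrightarrow> f \<in> Arr C"
  by (auto simp: iso_arrow_def inverse_arrows_def)

lemma inv_typing [simp]:
  assumes "iso_arrow C f"
  shows "inv f \<in> Arr C" "Dom C (inv f) = Cod C f" "Cod C (inv f) = Dom C f"
  using iso_inverse_arrows[OF assms] by (auto simp: inverse_arrows_def in_Hom_iff)

lemma inv_comp [simp]: "iso_arrow C f \<Longrightarrow> Dom C f = A \<Longrightarrow> inv f \<cdot> f = \<one> A"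
  using iso_inverse_arrows by (auto simp: inverse_arrows_def)

lemma comp_inv [simp]: "iso_arrow C f \<Longrightarrow> Cod C f = A \<Longrightarrow> f \<cdot> inv f = \<one> A"
  using iso_inverse_arrows by (auto simp: inverse_arrows_def)

lemma inv_comp_cancel [simp]:
  "iso_arrow C f \<Longrightarrow> h \<in> Arr C \<Longrightarrow> Cod C h = Dom C f \<Longrightarrow> inv f \<cdot> f \<cdot> h = h"
  by (subst comp_assoc'[symmetric]) (auto simp: iso_Arr)

lemma comp_inv_cancel [simp]:
  "iso_arrow C f \<Longrightarrow> h \<in> Arr C \<Longrightarrow> Cod C h = Cod C f \<Longrightarrow> f \<cdot> inv f \<cdot> h = h"
  by (subst comp_assoc'[symmetric]) (auto simp: iso_Arr)

lemma isoI:
  assumes "f \<in> Hom C A B" "g \<in> Hom C B A" "g \<cdot> f = \<one> A" "f \<cdot> g = \<one> B"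
  shows "iso_arrow C f" "inv f = g"
proof -
  have "inverse_arrows C f g" using assms by (auto simp: inverse_arrows_def in_Hom_iff)
  then show "iso_arrow C f" "inv f = g" using inverse_arrows_inv by (auto simp: iso_arrow_def)
qed

lemma iso_ident [simp]: "A \<in> Obj C \<Longrightarrow> iso_arrow C (\<one> A)"
  and inv_ident [simp]: "A \<in> Obj C \<Longrightarrow> inv (\<one> A) = \<one> A"
  using isoI[of "\<one> A" A A "\<one> A"] by (auto simp: in_Hom_iff)

lemma iso_inv [simp]:
  assumes "iso_arrow C f"
  shows "iso_arrow C (inv f)" "inv (inv f) = f"
  using isoI[of "inv f" "Cod C f" "Dom C f" f] assms by (auto simp: in_Hom_iff iso_Arr)

lemma iso_comp:
  assumes "iso_arrow C f" "iso_arrow C g" "Dom C g = Cod C f"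
  shows "iso_arrow C (g \<cdot> f)" "inv (g \<cdot> f) = inv f \<cdot> inv g"
  using isoI[of "g \<cdot> f" "Dom C f" "Cod C g" "inv f \<cdot> inv g"] assms
  by (auto simp: in_Hom_iff iso_Arr comp_assoc')

lemma iso_cancel_left:
  assumes "iso_arrow C f" "f \<cdot> g = f \<cdot> h" "g \<in> Arr C" "h \<in> Arr C"
    "Cod C g = Dom C f" "Cod C h = Dom C f"
  shows "g = h"
  using assms inv_comp_cancel by metis

lemma iso_cancel_right:
  assumes "iso_arrow C f" "g \<cdot> f = h \<cdot> f" "g \<in> Arr C" "h \<in> Arr C"
    "Dom C g = Cod C f" "Dom C h = Cod C f"
  shows "g = h"
proof -
  have "(g \<cdot> f) \<cdot> inv f = (h \<cdot> f) \<cdot> inv f" using assms by simp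
  then show ?thesis using assms(1,3-6) by (simp add: comp_assoc' iso_Arr)
qed

end

section \<open>Units in a symmetric monoidal category\<close>

context symmetric_monoidal_category
begin

lemma unit_Obj' [simp]: "\<I> \<in> Obj C" by (rule unit_Obj)
lemma tensor_Obj' [simp]: "A \<in> Obj C \<Longrightarrow> B \<in> Obj C \<Longrightarrow> A \<otimes> B \<in> Obj C" by (rule tensor_Obj)

lemma tensor_typing [simp]:
  assumes "f \<in> Arr C" "g \<in> Arr C"
  shows "f \<odot> g \<in> Arr C" "Dom C (f \<odot> g) = Dom C f \<otimes> Dom C g"
    "Cod C (f \<odot> g) = Cod C f \<otimes> Cod C g"
  using tensor_Hom[of f "Dom C f" "Cod C f" g "Dom C g" "Cod C g"] assms by (auto simp: Hom_def)

lemma structure_typing [simp]: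
  assumes "A \<in> Obj C"
  shows "lunit C A \<in> Arr C" "Dom C (lunit C A) = \<I> \<otimes> A" "Cod C (lunit C A) = A"
    "\<rho> A \<in> Arr C" "Dom C (\<rho> A) = A \<otimes> \<I>" "Cod C (\<rho> A) = A"
    "iso_arrow C (lunit C A)" "iso_arrow C (\<rho> A)"
  using lunit_Hom[OF assms] runit_Hom[OF assms] lunit_iso[OF assms] runit_iso[OF assms]
  by (auto simp: Hom_def)

lemma assoc_typing [simp]:
  assumes "A \<in> Obj C" "B \<in> Obj C" "E \<in> Obj C"
  shows "\<alpha> A B E \<in> Arr C" "Dom C (\<alpha> A B E) = (A \<otimes> B) \<otimes> E"
    "Cod C (\<alpha> A B E) = A \<otimes> (B \<otimes> E)" "iso_arrow C (\<alpha> A B E)"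
  using assoc_Hom[OF assms] assoc_iso[OF assms] by (auto simp: Hom_def)

lemma braid_typing [simp]:
  assumes "A \<in> Obj C" "B \<in> Obj C"
  shows "\<sigma> A B \<in> Arr C" "Dom C (\<sigma> A B) = A \<otimes> B" "Cod C (\<sigma> A B) = B \<otimes> A"
    "iso_arrow C (\<sigma> A B)" "inv (\<sigma> A B) = \<sigma> B A"
  using braid_Hom[OF assms] braid_symmetric assms
    isoI[of "\<sigma> A B" "A \<otimes> B" "B \<otimes> A" "\<sigma> B A"] braid_Hom[OF assms(2) assms(1)]
  by (auto simp: Hom_def)

lemma tensor_id [simp]: "A \<in> Obj C \<Longrightarrow> B \<in> Obj C \<Longrightarrow> \<one> A \<odot> \<one> B = \<one> (A \<otimes> B)"
  by (rule tensor_ident)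

lemma interchange:
  "f \<in> Arr C \<Longrightarrow> g \<in> Arr C \<Longrightarrow> f' \<in> Arr C \<Longrightarrow> g' \<in> Arr C \<Longrightarrow> Dom C g = Cod C f
   \<Longrightarrow> Dom C g' = Cod C f' \<Longrightarrow> (g \<odot> g') \<cdot> (f \<odot> f') = (g \<cdot> f) \<odot> (g' \<cdot> f')"
  using tensor_comp[of f "Dom C f" "Cod C f" g "Cod C g" f' "Dom C f'" "Cod C f'" g' "Cod C g'"]
  by (auto simp: Hom_def)

lemma interchange':
  "f \<in> Arr C \<Longrightarrow> g \<in> Arr C \<Longrightarrow> f' \<in> Arr C \<Longrightarrow> g' \<in> Arr C \<Longrightarrow> Dom C g = Cod C f
   \<Longrightarrow> Dom C g' = Cod C f' \<Longrightarrow> k \<in> Arr C \<Longrightarrow> Cod C k = Dom C f \<otimes> Dom C f'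
   \<Longrightarrow> (g \<odot> g') \<cdot> (f \<odot> f') \<cdot> k = ((g \<cdot> f) \<odot> (g' \<cdot> f')) \<cdot> k"
  by (subst comp_assoc'[symmetric]) (auto simp: interchange)

lemmas merge_tensor = comp_assoc' interchange interchange'

lemma iso_tensor:
  assumes "iso_arrow C f" "iso_arrow C g"
  shows "iso_arrow C (f \<odot> g)" "inv (f \<odot> g) = inv f \<odot> inv g"
  using isoI[of "f \<odot> g" "Dom C f \<otimes> Dom C g" "Cod C f \<otimes> Cod C g" "inv f \<odot> inv g"] assms
  by (auto simp: in_Hom_iff iso_Arr interchange)

lemma assoc_nat:
  "f \<in> Arr C \<Longrightarrow> g \<in> Arr C \<Longrightarrow> h \<in> Arr C \<Longrightarrow> Dom C f = A \<Longrightarrow> Dom C g = B \<Longrightarrow> Dom C h = E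
    \<Longrightarrow> Cod C f = A' \<Longrightarrow> Cod C g = B' \<Longrightarrow> Cod C h = E'
    \<Longrightarrow> (f \<odot> (g \<odot> h)) \<cdot> \<alpha> A B E = \<alpha> A' B' E' \<cdot> ((f \<odot> g) \<odot> h)"
  using assoc_natural by (auto simp: in_Hom_iff)

lemma unit_tensor_faithful:
  assumes "\<one> \<I> \<odot> f = \<one> \<I> \<odot> g" "f \<in> Hom C A B" "g \<in> Hom C A B"
  shows "f = g"
proof (rule iso_cancel_right[of "lunit C A"])
  show "f \<cdot> lunit C A = g \<cdot> lunit C A"
    using lunit_natural[OF assms(2)] lunit_natural[OF assms(3)] assms(1) by simp
qed (use assms Hom_Obj[OF assms(2)] in \<open>auto simp: in_Hom_iff\<close>)

lemma tensor_unit_faithful: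
  assumes "f \<odot> \<one> \<I> = g \<odot> \<one> \<I>" "f \<in> Hom C A B" "g \<in> Hom C A B"
  shows "f = g"
proof (rule iso_cancel_right[of "\<rho> A"])
  show "f \<cdot> \<rho> A = g \<cdot> \<rho> A"
    using runit_natural[OF assms(2)] runit_natural[OF assms(3)] assms(1) by simp
qed (use assms Hom_Obj[OF assms(2)] in \<open>auto simp: in_Hom_iff\<close>)

lemma pentagon':
  "A \<in> Obj C \<Longrightarrow> B \<in> Obj C \<Longrightarrow> E \<in> Obj C \<Longrightarrow> F \<in> Obj C \<Longrightarrow> k \<in> Arr C
    \<Longrightarrow> Cod C k = ((A \<otimes> B) \<otimes> E) \<otimes> F
    \<Longrightarrow> (\<one> A \<odot> \<alpha> B E F) \<cdot> \<alpha> A (B \<otimes> E) F \<cdot> (\<alpha> A B E \<odot> \<one> F) \<cdot> k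
       = \<alpha> A B (E \<otimes> F) \<cdot> \<alpha> (A \<otimes> B) E F \<cdot> k"
  using pentagon[of A B E F] by (simp add: comp_assoc'[symmetric])

text \<open>
  Kelly's argument: tensoring with \<open>\<I>\<close> on the left is faithful, and after tensoring the claim
  is the pentagon with the triangle and naturality of \<open>\<alpha>\<close>.
\<close>

lemma lunit_tensor:
  assumes [simp]: "A \<in> Obj C" "B \<in> Obj C"
  shows "lunit C (A \<otimes> B) \<cdot> \<alpha> \<I> A B = lunit C A \<odot> \<one> B"
proof (rule unit_tensor_faithful)
  let ?k = "\<alpha> \<I> (\<I> \<otimes> A) B \<cdot> (\<alpha> \<I> \<I> A \<odot> \<one> B)"
  show "\<one> \<I> \<odot> (lunit C (A \<otimes> B) \<cdot> \<alpha> \<I> A B) = \<one> \<I> \<odot> (lunit C A \<odot> \<one> B)"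
  proof (rule iso_cancel_right[of ?k])
    have "(\<one> \<I> \<odot> (lunit C (A \<otimes> B) \<cdot> \<alpha> \<I> A B)) \<cdot> ?k
      = (\<one> \<I> \<odot> lunit C (A \<otimes> B)) \<cdot> (\<one> \<I> \<odot> \<alpha> \<I> A B) \<cdot> ?k"
      by (simp add: interchange')
    also have "\<dots> = (\<one> \<I> \<odot> lunit C (A \<otimes> B)) \<cdot> \<alpha> \<I> \<I> (A \<otimes> B) \<cdot> \<alpha> (\<I> \<otimes> \<I>) A B"
      by (simp add: pentagon)
    also have "\<dots> = (\<rho> \<I> \<odot> \<one> (A \<otimes> B)) \<cdot> \<alpha> (\<I> \<otimes> \<I>) A B"
      by (simp add: comp_assoc'[symmetric] triangle)
    also have "\<dots> = \<alpha> \<I> A B \<cdot> ((\<rho> \<I> \<odot> \<one> A) \<odot> \<one> B)"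
      by (simp add: assoc_nat flip: tensor_id)
    also have "\<dots> = \<alpha> \<I> A B \<cdot> ((\<one> \<I> \<odot> lunit C A) \<odot> \<one> B) \<cdot> (\<alpha> \<I> \<I> A \<odot> \<one> B)"
      by (simp add: interchange triangle)
    also have "\<dots> = (\<one> \<I> \<odot> (lunit C A \<odot> \<one> B)) \<cdot> ?k"
      by (simp add: comp_assoc'[symmetric] assoc_nat)
    finally show "(\<one> \<I> \<odot> (lunit C (A \<otimes> B) \<cdot> \<alpha> \<I> A B)) \<cdot> ?k = (\<one> \<I> \<odot> (lunit C A \<odot> \<one> B)) \<cdot> ?k" .
  qed (simp_all add: iso_comp iso_tensor)
qed (simp_all add: in_Hom_iff)

text \<open>The mirror image of the previous argument, with \<open>\<I>\<close> tensored on the right.\<close>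

lemma runit_tensor:
  assumes [simp]: "A \<in> Obj C" "B \<in> Obj C"
  shows "(\<one> A \<odot> \<rho> B) \<cdot> \<alpha> A B \<I> = \<rho> (A \<otimes> B)"
proof (rule tensor_unit_faithful)
  show "((\<one> A \<odot> \<rho> B) \<cdot> \<alpha> A B \<I>) \<odot> \<one> \<I> = \<rho> (A \<otimes> B) \<odot> \<one> \<I>"
  proof (rule iso_cancel_left[of "\<alpha> A B \<I>"])
    have "\<alpha> A B \<I> \<cdot> (((\<one> A \<odot> \<rho> B) \<cdot> \<alpha> A B \<I>) \<odot> \<one> \<I>)
      = \<alpha> A B \<I> \<cdot> ((\<one> A \<odot> \<rho> B) \<odot> \<one> \<I>) \<cdot> (\<alpha> A B \<I> \<odot> \<one> \<I>)"
      by (simp add: interchange)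
    also have "\<dots> = (\<one> A \<odot> (\<rho> B \<odot> \<one> \<I>)) \<cdot> \<alpha> A (B \<otimes> \<I>) \<I> \<cdot> (\<alpha> A B \<I> \<odot> \<one> \<I>)"
      by (simp add: comp_assoc'[symmetric] assoc_nat)
    also have "\<dots> = (\<one> A \<odot> (\<one> B \<odot> lunit C \<I>)) \<cdot> (\<one> A \<odot> \<alpha> B \<I> \<I>) \<cdot> \<alpha> A (B \<otimes> \<I>) \<I> \<cdot> (\<alpha> A B \<I> \<odot> \<one> \<I>)"
      by (simp add: interchange' triangle)
    also have "\<dots> = (\<one> A \<odot> (\<one> B \<odot> lunit C \<I>)) \<cdot> \<alpha> A B (\<I> \<otimes> \<I>) \<cdot> \<alpha> (A \<otimes> B) \<I> \<I>"
      by (simp add: pentagon)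
    also have "\<dots> = \<alpha> A B \<I> \<cdot> (\<one> (A \<otimes> B) \<odot> lunit C \<I>) \<cdot> \<alpha> (A \<otimes> B) \<I> \<I>"
      by (simp add: comp_assoc'[symmetric] assoc_nat)
    also have "\<dots> = \<alpha> A B \<I> \<cdot> (\<rho> (A \<otimes> B) \<odot> \<one> \<I>)"
      by (simp add: triangle)
    finally show "\<alpha> A B \<I> \<cdot> (((\<one> A \<odot> \<rho> B) \<cdot> \<alpha> A B \<I>) \<odot> \<one> \<I>) = \<alpha> A B \<I> \<cdot> (\<rho> (A \<otimes> B) \<odot> \<one> \<I>)" .
  qed simp_all
qed (simp_all add: in_Hom_iff)

text \<open>
  The hexagon with \<open>\<I>\<close> as its second object, followed by the left unit, which turns the
  two associators into units by \<open>lunit_tensor\<close> and the triangle.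
\<close>

lemma lunit_braid:
  assumes [simp]: "A \<in> Obj C"
  shows "lunit C A \<cdot> \<sigma> A \<I> = \<rho> A"
proof (rule tensor_unit_faithful)
  show "(lunit C A \<cdot> \<sigma> A \<I>) \<odot> \<one> \<I> = \<rho> A \<odot> \<one> \<I>"
  proof (rule iso_cancel_left[of "\<sigma> A \<I>"])
    have "\<sigma> A \<I> \<cdot> ((lunit C A \<cdot> \<sigma> A \<I>) \<odot> \<one> \<I>) = \<sigma> A \<I> \<cdot> (lunit C A \<odot> \<one> \<I>) \<cdot> (\<sigma> A \<I> \<odot> \<one> \<I>)"
      by (simp add: interchange)
    also have "\<dots> = \<sigma> A \<I> \<cdot> lunit C (A \<otimes> \<I>) \<cdot> \<alpha> \<I> A \<I> \<cdot> (\<sigma> A \<I> \<odot> \<one> \<I>)"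
      by (simp add: lunit_tensor[symmetric] comp_assoc')
    also have "\<dots> = lunit C (\<I> \<otimes> A) \<cdot> (\<one> \<I> \<odot> \<sigma> A \<I>) \<cdot> \<alpha> \<I> A \<I> \<cdot> (\<sigma> A \<I> \<odot> \<one> \<I>)"
      by (simp add: lunit_natural[of "\<sigma> A \<I>" "A \<otimes> \<I>" "\<I> \<otimes> A"] in_Hom_iff comp_assoc'[symmetric])
    also have "\<dots> = lunit C (\<I> \<otimes> A) \<cdot> \<alpha> \<I> \<I> A \<cdot> \<sigma> A (\<I> \<otimes> \<I>) \<cdot> \<alpha> A \<I> \<I>"
      by (simp add: hexagon)
    also have "\<dots> = (lunit C \<I> \<odot> \<one> A) \<cdot> \<sigma> A (\<I> \<otimes> \<I>) \<cdot> \<alpha> A \<I> \<I>"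
      by (simp add: comp_assoc'[symmetric] lunit_tensor)
    also have "\<dots> = \<sigma> A \<I> \<cdot> (\<one> A \<odot> lunit C \<I>) \<cdot> \<alpha> A \<I> \<I>"
      using braid_natural[of "\<one> A" A A "lunit C \<I>" "\<I> \<otimes> \<I>" \<I>]
      by (simp add: comp_assoc'[symmetric] in_Hom_iff)
    also have "\<dots> = \<sigma> A \<I> \<cdot> (\<rho> A \<odot> \<one> \<I>)" by (simp add: triangle)
    finally show "\<sigma> A \<I> \<cdot> ((lunit C A \<cdot> \<sigma> A \<I>) \<odot> \<one> \<I>) = \<sigma> A \<I> \<cdot> (\<rho> A \<odot> \<one> \<I>)" .
  qed simp_all
qed (simp_all add: in_Hom_iff)

lemma runit_braid:
  assumes [simp]: "A \<in> Obj C"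
  shows "\<rho> A \<cdot> \<sigma> \<I> A = lunit C A"
  using braid_symmetric[of \<I> A] by (simp add: lunit_braid[symmetric] comp_assoc')

lemma lunit_unit: "lunit C \<I> = \<rho> \<I>"
proof (rule tensor_unit_faithful)
  have "lunit C (\<I> \<otimes> \<I>) = \<one> \<I> \<odot> lunit C \<I>"
    by (rule iso_cancel_left[of "lunit C \<I>"])
      (use lunit_natural[of "lunit C \<I>" "\<I> \<otimes> \<I>" \<I>] in \<open>auto simp: in_Hom_iff\<close>)
  then show "lunit C \<I> \<odot> \<one> \<I> = \<rho> \<I> \<odot> \<one> \<I>"
    using lunit_tensor[of \<I> \<I>] triangle[of \<I> \<I>] by simp
qed (auto simp: in_Hom_iff)

end

section \<open>Coherence for moving one factor to the front\<close>

context symmetric_monoidal_category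
begin

text \<open>
  A merge of lists moves one factor at a time past a block of factors; this is that move,
  \<open>A \<otimes> (B \<otimes> E) \<rightarrow> B \<otimes> (A \<otimes> E)\<close>.
\<close>

definition twist :: "'o \<Rightarrow> 'o \<Rightarrow> 'o \<Rightarrow> 'm" where
  "twist A B E = \<alpha> B A E \<cdot> (\<sigma> A B \<odot> \<one> E) \<cdot> inv (\<alpha> A B E)"

lemma twist_typing [simp]:
  assumes "A \<in> Obj C" "B \<in> Obj C" "E \<in> Obj C"
  shows "twist A B E \<in> Arr C" "Dom C (twist A B E) = A \<otimes> (B \<otimes> E)"
    "Cod C (twist A B E) = B \<otimes> (A \<otimes> E)" "iso_arrow C (twist A B E)"
  using assms by (auto simp: twist_def intro!: iso_comp iso_tensor)

lemma braid_nat: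
  "f \<in> Arr C \<Longrightarrow> g \<in> Arr C \<Longrightarrow> Dom C f = A \<Longrightarrow> Cod C f = A' \<Longrightarrow> Dom C g = B \<Longrightarrow> Cod C g = B'
   \<Longrightarrow> \<sigma> A' B' \<cdot> (f \<odot> g) = (g \<odot> f) \<cdot> \<sigma> A B"
  using braid_natural by (auto simp: in_Hom_iff)

lemma whisker:
  assumes "f \<in> Arr C" "g \<in> Arr C" "Dom C g = Cod C f" "A \<in> Obj C"
  shows "\<one> A \<odot> (g \<cdot> f) = (\<one> A \<odot> g) \<cdot> (\<one> A \<odot> f)"
    "(g \<cdot> f) \<odot> \<one> A = (g \<odot> \<one> A) \<cdot> (f \<odot> \<one> A)"
  using assms by (auto simp: interchange)

lemma assoc_nat':
  assumes "f \<in> Arr C" "g \<in> Arr C" "h \<in> Arr C" "Dom C f = A" "Dom C g = B" "Dom C h = E"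
    "Cod C f = A'" "Cod C g = B'" "Cod C h = E'" "k \<in> Arr C" "Cod C k = (A \<otimes> B) \<otimes> E"
  shows "(f \<odot> (g \<odot> h)) \<cdot> \<alpha> A B E \<cdot> k = \<alpha> A' B' E' \<cdot> ((f \<odot> g) \<odot> h) \<cdot> k"
  using assms assoc_nat[of f g h A B E A' B' E'] by (auto simp flip: comp_assoc')

lemma assoc_inv_nat:
  assumes "f \<in> Arr C" "g \<in> Arr C" "h \<in> Arr C" "Dom C f = A" "Dom C g = B" "Dom C h = E"
    "Cod C f = A'" "Cod C g = B'" "Cod C h = E'"
  shows "((f \<odot> g) \<odot> h) \<cdot> inv (\<alpha> A B E) = inv (\<alpha> A' B' E') \<cdot> (f \<odot> (g \<odot> h))"
proof -
  have [simp]: "A \<in> Obj C" "B \<in> Obj C" "E \<in> Obj C" "A' \<in> Obj C" "B' \<in> Obj C" "E' \<in> Obj C"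
    using assms by auto
  have "inv (\<alpha> A' B' E') \<cdot> ((f \<odot> (g \<odot> h)) \<cdot> \<alpha> A B E) \<cdot> inv (\<alpha> A B E)
      = inv (\<alpha> A' B' E') \<cdot> (\<alpha> A' B' E' \<cdot> ((f \<odot> g) \<odot> h)) \<cdot> inv (\<alpha> A B E)"
    by (simp only: assoc_nat[OF assms])
  then show ?thesis using assms by (simp add: comp_assoc')
qed

lemma hexagon_twist:
  assumes [simp]: "A \<in> Obj C" "B \<in> Obj C" "E \<in> Obj C"
  shows "\<alpha> B E A \<cdot> \<sigma> A (B \<otimes> E) = (\<one> B \<odot> \<sigma> A E) \<cdot> twist A B E"
  by (rule iso_cancel_right[of "\<alpha> A B E"]) (simp_all add: twist_def comp_assoc' hexagon)

lemma twist_involutive: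
  assumes [simp]: "A \<in> Obj C" "B \<in> Obj C" "E \<in> Obj C"
  shows "twist B A E \<cdot> twist A B E = \<one> (A \<otimes> (B \<otimes> E))"
  using braid_symmetric[of A B] by (simp add: twist_def comp_assoc' interchange')

lemma hexagon_twist':
  assumes [simp]: "A \<in> Obj C" "B \<in> Obj C" "E \<in> Obj C"
  shows "twist E A B \<cdot> \<sigma> (A \<otimes> B) E = (\<one> A \<odot> \<sigma> B E) \<cdot> \<alpha> A B E"
proof -
  have "(\<one> A \<odot> \<sigma> B E) \<cdot> \<alpha> A B E \<cdot> \<sigma> E (A \<otimes> B)
      = (\<one> A \<odot> \<sigma> B E) \<cdot> (\<one> A \<odot> \<sigma> E B) \<cdot> twist E A B"
    by (simp add: hexagon_twist)
  also have "\<dots> = twist E A B" by (simp add: interchange' braid_symmetric)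
  finally have "((\<one> A \<odot> \<sigma> B E) \<cdot> \<alpha> A B E \<cdot> \<sigma> E (A \<otimes> B)) \<cdot> \<sigma> (A \<otimes> B) E = twist E A B \<cdot> \<sigma> (A \<otimes> B) E"
    by simp
  then show ?thesis by (simp add: comp_assoc' braid_symmetric)
qed

lemma twist_nat:
  assumes "f \<in> Arr C" "g \<in> Arr C" "h \<in> Arr C" "Dom C f = A" "Dom C g = B" "Dom C h = E"
    "Cod C f = A'" "Cod C g = B'" "Cod C h = E'"
  shows "twist A' B' E' \<cdot> (f \<odot> (g \<odot> h)) = (g \<odot> (f \<odot> h)) \<cdot> twist A B E"
proof -
  have [simp]: "A \<in> Obj C" "B \<in> Obj C" "E \<in> Obj C" "A' \<in> Obj C" "B' \<in> Obj C" "E' \<in> Obj C"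
    using assms by auto
  have "twist A' B' E' \<cdot> (f \<odot> (g \<odot> h)) = \<alpha> B' A' E' \<cdot> (\<sigma> A' B' \<odot> \<one> E') \<cdot> ((f \<odot> g) \<odot> h) \<cdot> inv (\<alpha> A B E)"
    using assms by (simp add: twist_def comp_assoc' assoc_inv_nat)
  also have "\<dots> = \<alpha> B' A' E' \<cdot> ((g \<odot> f) \<odot> h) \<cdot> (\<sigma> A B \<odot> \<one> E) \<cdot> inv (\<alpha> A B E)"
    using assms braid_nat[of f g A A' B B'] by (simp add: interchange')
  also have "\<dots> = (g \<odot> (f \<odot> h)) \<cdot> twist A B E"
    using assms by (simp add: twist_def assoc_nat')
  finally show ?thesis .
qed

lemma pentagon_inv:
  assumes [simp]: "A \<in> Obj C" "B \<in> Obj C" "E \<in> Obj C" "F \<in> Obj C"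
  shows "inv (\<alpha> A B (E \<otimes> F)) \<cdot> (\<one> A \<odot> \<alpha> B E F) \<cdot> \<alpha> A (B \<otimes> E) F = \<alpha> (A \<otimes> B) E F \<cdot> (inv (\<alpha> A B E) \<odot> \<one> F)"
proof (rule iso_cancel_right[of "\<alpha> A B E \<odot> \<one> F"])
  show "(inv (\<alpha> A B (E \<otimes> F)) \<cdot> (\<one> A \<odot> \<alpha> B E F) \<cdot> \<alpha> A (B \<otimes> E) F) \<cdot> (\<alpha> A B E \<odot> \<one> F)
    = (\<alpha> (A \<otimes> B) E F \<cdot> (inv (\<alpha> A B E) \<odot> \<one> F)) \<cdot> (\<alpha> A B E \<odot> \<one> F)"
    by (simp add: comp_assoc' interchange pentagon)
qed (simp_all add: iso_tensor)

lemma twist_tensor_middle: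
  assumes [simp]: "A \<in> Obj C" "B \<in> Obj C" "E \<in> Obj C" "Y \<in> Obj C"
  shows "(\<one> Y \<odot> \<alpha> A B E) \<cdot> \<alpha> Y (A \<otimes> B) E \<cdot> (twist A Y B \<odot> \<one> E)
       = twist A Y (B \<otimes> E) \<cdot> (\<one> A \<odot> \<alpha> Y B E) \<cdot> \<alpha> A (Y \<otimes> B) E"
proof -
  have "twist A Y (B \<otimes> E) \<cdot> (\<one> A \<odot> \<alpha> Y B E) \<cdot> \<alpha> A (Y \<otimes> B) E
     = \<alpha> Y A (B \<otimes> E) \<cdot> (\<sigma> A Y \<odot> \<one> (B \<otimes> E)) \<cdot> \<alpha> (A \<otimes> Y) B E \<cdot> (inv (\<alpha> A Y B) \<odot> \<one> E)"
    by (simp add: twist_def comp_assoc' pentagon_inv)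
  also have "\<dots> = \<alpha> Y A (B \<otimes> E) \<cdot> \<alpha> (Y \<otimes> A) B E \<cdot> ((\<sigma> A Y \<odot> \<one> B) \<odot> \<one> E) \<cdot> (inv (\<alpha> A Y B) \<odot> \<one> E)"
    by (simp add: assoc_nat' flip: tensor_id)
  also have "\<dots> = (\<one> Y \<odot> \<alpha> A B E) \<cdot> \<alpha> Y (A \<otimes> B) E \<cdot> (\<alpha> Y A B \<odot> \<one> E) \<cdot> ((\<sigma> A Y \<odot> \<one> B) \<odot> \<one> E) \<cdot> (inv (\<alpha> A Y B) \<odot> \<one> E)"
    by (simp add: pentagon')
  also have "\<dots> = (\<one> Y \<odot> \<alpha> A B E) \<cdot> \<alpha> Y (A \<otimes> B) E \<cdot> (twist A Y B \<odot> \<one> E)"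
    by (simp add: twist_def interchange comp_assoc')
  finally show ?thesis by simp
qed

lemma braid_tensor_left:
  assumes [simp]: "A \<in> Obj C" "B \<in> Obj C" "Z \<in> Obj C"
  shows "\<sigma> (A \<otimes> B) Z = \<alpha> Z A B \<cdot> (\<sigma> A Z \<odot> \<one> B) \<cdot> inv (\<alpha> A Z B) \<cdot> (\<one> A \<odot> \<sigma> B Z) \<cdot> \<alpha> A B Z"
proof -
  have "twist A Z B \<cdot> twist Z A B \<cdot> \<sigma> (A \<otimes> B) Z = twist A Z B \<cdot> (\<one> A \<odot> \<sigma> B Z) \<cdot> \<alpha> A B Z"
    by (simp add: hexagon_twist')
  moreover have "twist A Z B \<cdot> twist Z A B \<cdot> \<sigma> (A \<otimes> B) Z = \<sigma> (A \<otimes> B) Z"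
    by (subst comp_assoc'[symmetric]) (simp_all add: twist_involutive)
  ultimately show ?thesis by (simp add: twist_def comp_assoc')
qed

text \<open>
  Moving \<open>Z\<close> past \<open>A \<otimes> B\<close> is moving it past \<open>B\<close> and then past \<open>A\<close>.  The braiding is split by
  \<open>braid_tensor_left\<close>; the associators that arise cancel by three pentagons.
\<close>

lemma twist_tensor_left:
  assumes [simp]: "A \<in> Obj C" "B \<in> Obj C" "E \<in> Obj C" "Z \<in> Obj C"
  shows "(\<one> Z \<odot> \<alpha> A B E) \<cdot> twist (A \<otimes> B) Z E
       = twist A Z (B \<otimes> E) \<cdot> (\<one> A \<odot> twist B Z E) \<cdot> \<alpha> A B (Z \<otimes> E)"
proof (rule iso_cancel_right[of "\<alpha> (A \<otimes> B) Z E"])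
  let ?e = "\<alpha> A B Z \<odot> \<one> E" and ?t = "(\<one> A \<odot> \<sigma> B Z) \<odot> \<one> E"
  have "((\<one> Z \<odot> \<alpha> A B E) \<cdot> twist (A \<otimes> B) Z E) \<cdot> \<alpha> (A \<otimes> B) Z E
     = (\<one> Z \<odot> \<alpha> A B E) \<cdot> \<alpha> Z (A \<otimes> B) E \<cdot> (\<sigma> (A \<otimes> B) Z \<odot> \<one> E)"
    by (simp add: twist_def comp_assoc')
  also have "\<dots> = (\<one> Z \<odot> \<alpha> A B E) \<cdot> \<alpha> Z (A \<otimes> B) E \<cdot> (\<alpha> Z A B \<odot> \<one> E) \<cdot> ((\<sigma> A Z \<odot> \<one> B) \<odot> \<one> E)
       \<cdot> (inv (\<alpha> A Z B) \<odot> \<one> E) \<cdot> ?t \<cdot> ?e"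
    by (simp add: braid_tensor_left whisker comp_assoc')
  also have "\<dots> = \<alpha> Z A (B \<otimes> E) \<cdot> \<alpha> (Z \<otimes> A) B E \<cdot> ((\<sigma> A Z \<odot> \<one> B) \<odot> \<one> E)
       \<cdot> (inv (\<alpha> A Z B) \<odot> \<one> E) \<cdot> ?t \<cdot> ?e"
    by (simp add: pentagon')
  also have "\<dots> = \<alpha> Z A (B \<otimes> E) \<cdot> (\<sigma> A Z \<odot> \<one> (B \<otimes> E)) \<cdot> (\<alpha> (A \<otimes> Z) B E
       \<cdot> (inv (\<alpha> A Z B) \<odot> \<one> E)) \<cdot> ?t \<cdot> ?e"
    by (simp add: assoc_nat'[symmetric] comp_assoc' flip: tensor_id)
  also have "\<dots> = \<alpha> Z A (B \<otimes> E) \<cdot> (\<sigma> A Z \<odot> \<one> (B \<otimes> E)) \<cdot> (inv (\<alpha> A Z (B \<otimes> E)) \<cdot> (\<one> A \<odot> \<alpha> Z B E)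
       \<cdot> \<alpha> A (Z \<otimes> B) E) \<cdot> ?t \<cdot> ?e"
    by (simp add: pentagon_inv)
  also have "\<dots> = \<alpha> Z A (B \<otimes> E) \<cdot> (\<sigma> A Z \<odot> \<one> (B \<otimes> E)) \<cdot> inv (\<alpha> A Z (B \<otimes> E)) \<cdot> (\<one> A \<odot> \<alpha> Z B E)
       \<cdot> (\<one> A \<odot> (\<sigma> B Z \<odot> \<one> E)) \<cdot> \<alpha> A (B \<otimes> Z) E \<cdot> (\<alpha> A B Z \<odot> \<one> E)"
    by (simp add: assoc_nat' comp_assoc')
  also have "\<dots> = (twist A Z (B \<otimes> E) \<cdot> (\<one> A \<odot> twist B Z E) \<cdot> \<alpha> A B (Z \<otimes> E)) \<cdot> \<alpha> (A \<otimes> B) Z E"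
    by (simp add: twist_def comp_assoc' interchange' flip: pentagon)
  finally show "((\<one> Z \<odot> \<alpha> A B E) \<cdot> twist (A \<otimes> B) Z E) \<cdot> \<alpha> (A \<otimes> B) Z E
    = (twist A Z (B \<otimes> E) \<cdot> (\<one> A \<odot> twist B Z E) \<cdot> \<alpha> A B (Z \<otimes> E)) \<cdot> \<alpha> (A \<otimes> B) Z E" .
qed simp_all

text \<open>
  The next three lemmas are the induction steps for associativity of merging three lists, one for each list that can hold the least head.  The objects \<open>A\<close>, \<open>B\<close>, \<open>E\<close> are those of
  the lists once that head is removed, and \<open>eq\<close> is the induction hypothesis.
  Here the head \<open>X\<close> belongs to the first list, and the step is the pentagon.
\<close>

lemma shuffle_assoc_first:
  assumes [simp]: "X \<in> Obj C" "A \<in> Obj C" "B \<in> Obj C" "E \<in> Obj C"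
    and h: "p \<in> Hom C (A \<otimes> B) R" "q \<in> Hom C (R \<otimes> E) W" "r \<in> Hom C (B \<otimes> E) V" "t \<in> Hom C (A \<otimes> V) W"
    and eq: "t \<cdot> (\<one> A \<odot> r) \<cdot> \<alpha> A B E = q \<cdot> (p \<odot> \<one> E)"
  shows "((\<one> X \<odot> t) \<cdot> \<alpha> X A V) \<cdot> (\<one> (X \<otimes> A) \<odot> r) \<cdot> \<alpha> (X \<otimes> A) B E
    = ((\<one> X \<odot> q) \<cdot> \<alpha> X R E) \<cdot> (((\<one> X \<odot> p) \<cdot> \<alpha> X A B) \<odot> \<one> E)"
proof -
  have [simp]: "R \<in> Obj C" "W \<in> Obj C" "V \<in> Obj C" using h Hom_Obj by auto
  note h [unfolded in_Hom_iff, simp]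
  have "((\<one> X \<odot> t) \<cdot> \<alpha> X A V) \<cdot> (\<one> (X \<otimes> A) \<odot> r) \<cdot> \<alpha> (X \<otimes> A) B E
    = (\<one> X \<odot> t) \<cdot> (\<one> X \<odot> (\<one> A \<odot> r)) \<cdot> \<alpha> X A (B \<otimes> E) \<cdot> \<alpha> (X \<otimes> A) B E"
    by (simp add: assoc_nat' comp_assoc')
  also have "\<dots> = (\<one> X \<odot> t) \<cdot> (\<one> X \<odot> (\<one> A \<odot> r)) \<cdot> (\<one> X \<odot> \<alpha> A B E) \<cdot> \<alpha> X (A \<otimes> B) E \<cdot> (\<alpha> X A B \<odot> \<one> E)"
    by (simp add: pentagon)
  also have "\<dots> = (\<one> X \<odot> (q \<cdot> (p \<odot> \<one> E))) \<cdot> \<alpha> X (A \<otimes> B) E \<cdot> (\<alpha> X A B \<odot> \<one> E)"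
    by (simp add: interchange' comp_assoc' flip: eq)
  also have "\<dots> = ((\<one> X \<odot> q) \<cdot> \<alpha> X R E) \<cdot> (((\<one> X \<odot> p) \<cdot> \<alpha> X A B) \<odot> \<one> E)"
    by (simp add: whisker assoc_nat' comp_assoc')
  finally show ?thesis .
qed

text \<open>
  The second list starts with the least name, which has to pass the first list: this is
  \<open>twist_tensor_middle\<close>.
\<close>

lemma shuffle_assoc_second:
  assumes [simp]: "Y \<in> Obj C" "A \<in> Obj C" "B \<in> Obj C" "E \<in> Obj C"
    and h: "p \<in> Hom C (A \<otimes> B) R" "q \<in> Hom C (R \<otimes> E) W" "r \<in> Hom C (B \<otimes> E) V" "t \<in> Hom C (A \<otimes> V) W"
    and eq: "t \<cdot> (\<one> A \<odot> r) \<cdot> \<alpha> A B E = q \<cdot> (p \<odot> \<one> E)"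
  shows "((\<one> Y \<odot> t) \<cdot> twist A Y V) \<cdot> (\<one> A \<odot> ((\<one> Y \<odot> r) \<cdot> \<alpha> Y B E)) \<cdot> \<alpha> A (Y \<otimes> B) E
    = ((\<one> Y \<odot> q) \<cdot> \<alpha> Y R E) \<cdot> (((\<one> Y \<odot> p) \<cdot> twist A Y B) \<odot> \<one> E)"
proof -
  have [simp]: "R \<in> Obj C" "W \<in> Obj C" "V \<in> Obj C" using h Hom_Obj by auto
  note h [unfolded in_Hom_iff, simp]
  have "((\<one> Y \<odot> t) \<cdot> twist A Y V) \<cdot> (\<one> A \<odot> ((\<one> Y \<odot> r) \<cdot> \<alpha> Y B E)) \<cdot> \<alpha> A (Y \<otimes> B) E
    = (\<one> Y \<odot> t) \<cdot> (twist A Y V \<cdot> (\<one> A \<odot> (\<one> Y \<odot> r))) \<cdot> (\<one> A \<odot> \<alpha> Y B E) \<cdot> \<alpha> A (Y \<otimes> B) E"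
    by (simp add: whisker comp_assoc')
  also have "\<dots> = (\<one> Y \<odot> t) \<cdot> (\<one> Y \<odot> (\<one> A \<odot> r)) \<cdot> twist A Y (B \<otimes> E) \<cdot> (\<one> A \<odot> \<alpha> Y B E) \<cdot> \<alpha> A (Y \<otimes> B) E"
    by (simp add: twist_nat[of _ _ _ A Y "B \<otimes> E"] comp_assoc')
  also have "\<dots> = (\<one> Y \<odot> t) \<cdot> (\<one> Y \<odot> (\<one> A \<odot> r)) \<cdot> (\<one> Y \<odot> \<alpha> A B E) \<cdot> \<alpha> Y (A \<otimes> B) E \<cdot> (twist A Y B \<odot> \<one> E)"
    by (simp add: twist_tensor_middle)
  also have "\<dots> = (\<one> Y \<odot> (q \<cdot> (p \<odot> \<one> E))) \<cdot> \<alpha> Y (A \<otimes> B) E \<cdot> (twist A Y B \<odot> \<one> E)"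
    by (simp add: interchange' comp_assoc' flip: eq)
  also have "\<dots> = ((\<one> Y \<odot> q) \<cdot> \<alpha> Y R E) \<cdot> (((\<one> Y \<odot> p) \<cdot> twist A Y B) \<odot> \<one> E)"
    by (simp add: whisker assoc_nat' comp_assoc')
  finally show ?thesis .
qed

text \<open>
  The third list starts with the least name, which has to pass both other lists: this is
  \<open>twist_tensor_left\<close>.
\<close>

lemma shuffle_assoc_third:
  assumes [simp]: "Z \<in> Obj C" "A \<in> Obj C" "B \<in> Obj C" "E \<in> Obj C"
    and h: "p \<in> Hom C (A \<otimes> B) R" "q \<in> Hom C (R \<otimes> E) W" "r \<in> Hom C (B \<otimes> E) V" "t \<in> Hom C (A \<otimes> V) W"
    and eq: "t \<cdot> (\<one> A \<odot> r) \<cdot> \<alpha> A B E = q \<cdot> (p \<odot> \<one> E)"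
  shows "((\<one> Z \<odot> t) \<cdot> twist A Z V) \<cdot> (\<one> A \<odot> ((\<one> Z \<odot> r) \<cdot> twist B Z E)) \<cdot> \<alpha> A B (Z \<otimes> E)
    = ((\<one> Z \<odot> q) \<cdot> twist R Z E) \<cdot> (p \<odot> \<one> (Z \<otimes> E))"
proof -
  have [simp]: "R \<in> Obj C" "W \<in> Obj C" "V \<in> Obj C" using h Hom_Obj by auto
  note h [unfolded in_Hom_iff, simp]
  have "((\<one> Z \<odot> t) \<cdot> twist A Z V) \<cdot> (\<one> A \<odot> ((\<one> Z \<odot> r) \<cdot> twist B Z E)) \<cdot> \<alpha> A B (Z \<otimes> E)
    = (\<one> Z \<odot> t) \<cdot> (twist A Z V \<cdot> (\<one> A \<odot> (\<one> Z \<odot> r))) \<cdot> (\<one> A \<odot> twist B Z E) \<cdot> \<alpha> A B (Z \<otimes> E)"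
    by (simp add: whisker comp_assoc')
  also have "\<dots> = (\<one> Z \<odot> t) \<cdot> (\<one> Z \<odot> (\<one> A \<odot> r)) \<cdot> twist A Z (B \<otimes> E) \<cdot> (\<one> A \<odot> twist B Z E) \<cdot> \<alpha> A B (Z \<otimes> E)"
    by (simp add: twist_nat[of _ _ _ A Z "B \<otimes> E"] comp_assoc')
  also have "\<dots> = (\<one> Z \<odot> t) \<cdot> (\<one> Z \<odot> (\<one> A \<odot> r)) \<cdot> (\<one> Z \<odot> \<alpha> A B E) \<cdot> twist (A \<otimes> B) Z E"
    by (simp add: twist_tensor_left)
  also have "\<dots> = (\<one> Z \<odot> (q \<cdot> (p \<odot> \<one> E))) \<cdot> twist (A \<otimes> B) Z E"
    by (simp add: interchange' comp_assoc' flip: eq)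
  also have "\<dots> = (\<one> Z \<odot> q) \<cdot> twist R Z E \<cdot> (p \<odot> (\<one> Z \<odot> \<one> E))"
    by (subst twist_nat[of p "\<one> Z" "\<one> E" "A \<otimes> B" Z E]) (simp_all add: whisker comp_assoc' del: tensor_id)
  finally show ?thesis by (simp add: comp_assoc')
qed

end

section \<open>Objects indexed by finite sets of names\<close>

fun merge :: "nat list \<Rightarrow> nat list \<Rightarrow> nat list" where
  "merge [] ys = ys"
| "merge (x # xs) [] = x # xs"
| "merge (x # xs) (y # ys) = (if x < y then x # merge xs (y # ys) else y # merge (x # xs) ys)"

lemma merge_Nil2 [simp]: "merge xs [] = xs"
  by (cases xs) auto

lemma set_merge [simp]: "set (merge xs ys) = set xs \<union> set ys"
  by (induction xs ys rule: merge.induct) auto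

lemma strict_sorted_merge:
  "set xs \<inter> set ys = {} \<Longrightarrow> sorted_wrt (<) xs \<Longrightarrow> sorted_wrt (<) ys \<Longrightarrow> sorted_wrt (<) (merge xs ys)"
proof (induction xs ys rule: merge.induct)
  case (3 x xs y ys)
  then show ?case by (cases "x < y") (auto simp: not_less order.order_iff_strict intro: less_trans)
qed auto

lemma merge_sorted_list_of_set:
  assumes "finite S" "finite T" "S \<inter> T = {}"
  shows "merge (sorted_list_of_set S) (sorted_list_of_set T) = sorted_list_of_set (S \<union> T)"
proof -
  have "sorted_wrt (<) (merge (sorted_list_of_set S) (sorted_list_of_set T))"
    by (rule strict_sorted_merge) (use assms in auto)
  then show ?thesis
    using assms by (intro strict_sorted_equal) auto
qed

text \<open>
  A valuation gives an object for every name.  Different names may have the same object; this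
  is how two copies of an object are told apart in a diagram.
\<close>

locale wires = symmetric_monoidal_category C
  for C :: "('o, 'm, 'x) sm_data_scheme" (structure) +
  fixes v :: "nat \<Rightarrow> 'o"
  assumes v_Obj [simp]: "v i \<in> Obj C"
begin

fun list_obj :: "nat list \<Rightarrow> 'o" where
  "list_obj [] = \<I>"
| "list_obj (x # xs) = v x \<otimes> list_obj xs"

lemma list_obj_Obj [simp]: "list_obj xs \<in> Obj C"
  by (induction xs) auto

text \<open>
  The permutation of tensor factors that accompanies \<open>merge\<close>, built along the same recursion
  so that its properties follow by the same induction.
\<close>

fun shuffle :: "nat list \<Rightarrow> nat list \<Rightarrow> 'm" where
  "shuffle [] ys = lunit C (list_obj ys)"
| "shuffle (x # xs) [] = \<rho> (list_obj (x # xs))"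
| "shuffle (x # xs) (y # ys) =
    (if x < y
     then (\<one> (v x) \<odot> shuffle xs (y # ys)) \<cdot> \<alpha> (v x) (list_obj xs) (list_obj (y # ys))
     else (\<one> (v y) \<odot> shuffle (x # xs) ys) \<cdot> twist (list_obj (x # xs)) (v y) (list_obj ys))"

lemma shuffle_Nil2: "shuffle xs [] = \<rho> (list_obj xs)"
  by (cases xs) (auto simp: lunit_unit)

lemma shuffle_typing [simp]:
  "shuffle xs ys \<in> Arr C \<and> Dom C (shuffle xs ys) = list_obj xs \<otimes> list_obj ys
    \<and> Cod C (shuffle xs ys) = list_obj (merge xs ys) \<and> iso_arrow C (shuffle xs ys)"
  by (induction xs ys rule: shuffle.induct) (auto intro!: iso_comp iso_tensor)

lemma shuffle_Hom: "shuffle xs ys \<in> Hom C (list_obj xs \<otimes> list_obj ys) (list_obj (merge xs ys))"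
  by (simp add: in_Hom_iff)

lemma shuffle_comm:
  "set xs \<inter> set ys = {} \<Longrightarrow> shuffle ys xs \<cdot> \<sigma> (list_obj xs) (list_obj ys) = shuffle xs ys"
proof (induction xs ys rule: merge.induct)
  case (1 ys)
  then show ?case by (simp add: shuffle_Nil2 runit_braid)
next
  case (2 x xs)
  then show ?case by (simp add: lunit_braid)
next
  case (3 x xs y ys)
  show ?case
  proof (cases "x < y")
    case True
    have IH: "shuffle (y # ys) xs \<cdot> \<sigma> (list_obj xs) (v y \<otimes> list_obj ys) = shuffle xs (y # ys)"
      using 3 True by auto
    have "shuffle (y # ys) (x # xs) \<cdot> \<sigma> (list_obj (x # xs)) (list_obj (y # ys))
      = (\<one> (v x) \<odot> shuffle (y # ys) xs) \<cdot> (\<one> (v x) \<odot> \<sigma> (list_obj xs) (v y \<otimes> list_obj ys))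
          \<cdot> \<alpha> (v x) (list_obj xs) (v y \<otimes> list_obj ys)"
      using True by (simp add: comp_assoc' hexagon_twist')
    then show ?thesis using True by (simp add: interchange' IH)
  next
    case False
    have IH: "shuffle ys (x # xs) \<cdot> \<sigma> (v x \<otimes> list_obj xs) (list_obj ys) = shuffle (x # xs) ys"
      and "y < x"
      using 3 False by auto
    then have "shuffle (y # ys) (x # xs) \<cdot> \<sigma> (list_obj (x # xs)) (list_obj (y # ys))
      = (\<one> (v y) \<odot> shuffle ys (x # xs)) \<cdot> (\<one> (v y) \<odot> \<sigma> (v x \<otimes> list_obj xs) (list_obj ys))
          \<cdot> twist (v x \<otimes> list_obj xs) (v y) (list_obj ys)"
      by (simp add: comp_assoc' hexagon_twist)
    then show ?thesis using False by (simp add: interchange' IH)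
  qed
qed

lemma merge_Cons_Cons:
  obtains w ws where "merge (x # xs) (y # ys) = w # ws" "w = x \<or> w = y"
  by (cases "x < y") auto

text \<open>
  Induction on the total length.  Disjointness makes one of the three heads strictly least, and
  both sides extract that head first.
\<close>

lemma merge_shuffle_assoc:
  assumes "set xs \<inter> set ys = {}" "set xs \<inter> set zs = {}" "set ys \<inter> set zs = {}"
  shows "merge xs (merge ys zs) = merge (merge xs ys) zs \<and>
    shuffle xs (merge ys zs) \<cdot> (\<one> (list_obj xs) \<odot> shuffle ys zs) \<cdot> \<alpha> (list_obj xs) (list_obj ys) (list_obj zs)
     = shuffle (merge xs ys) zs \<cdot> (shuffle xs ys \<odot> \<one> (list_obj zs))"
  using assms
proof (induction "length xs + length ys + length zs" arbitrary: xs ys zs rule: less_induct)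
  case less
  consider "xs = []" | "ys = []" | "zs = []"
    | x a y b z c where "xs = x # a" "ys = y # b" "zs = z # c"
    by (cases xs; cases ys; cases zs) auto
  then show ?case
  proof cases
    case 1
    then show ?thesis
      using lunit_natural[OF shuffle_Hom[of ys zs]]
      by (simp add: comp_assoc' flip: lunit_tensor) (simp flip: comp_assoc')
  next
    case 2
    then show ?thesis by (simp add: triangle shuffle_Nil2)
  next
    case 3
    then show ?thesis
      using runit_natural[OF shuffle_Hom[of xs ys]]
      by (simp add: shuffle_Nil2 runit_tensor)
  next
    case 4
    note eqs = 4
    consider "x < y" "x < z" | "y < x" "y < z" | "z < x" "z < y"
      using less.prems eqs by (auto simp: neq_iff)
    then show ?thesis
    proof cases
      case 1
      obtain w ws where ws: "merge ys zs = w # ws" and "w = y \<or> w = z"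
        using merge_Cons_Cons eqs by metis
      then have *: "x < w" using 1 by auto
      have IH: "merge a (merge ys zs) = merge (merge a ys) zs"
        "shuffle a (merge ys zs) \<cdot> (\<one> (list_obj a) \<odot> shuffle ys zs) \<cdot> \<alpha> (list_obj a) (list_obj ys) (list_obj zs)
         = shuffle (merge a ys) zs \<cdot> (shuffle a ys \<odot> \<one> (list_obj zs))"
        using less.hyps[of a ys zs] less.prems eqs by auto
      have "shuffle xs (merge ys zs) = (\<one> (v x) \<odot> shuffle a (merge ys zs)) \<cdot> \<alpha> (v x) (list_obj a) (list_obj (merge ys zs))"
        and "merge xs (merge ys zs) = x # merge a (merge ys zs)"
        unfolding ws eqs(1) using * by simp_all
      moreover have "merge xs ys = x # merge a ys" "merge (merge xs ys) zs = x # merge (merge a ys) zs"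
        "shuffle xs ys = (\<one> (v x) \<odot> shuffle a ys) \<cdot> \<alpha> (v x) (list_obj a) (list_obj ys)"
        "shuffle (merge xs ys) zs = (\<one> (v x) \<odot> shuffle (merge a ys) zs) \<cdot> \<alpha> (v x) (list_obj (merge a ys)) (list_obj zs)"
        using 1 eqs by simp_all
      ultimately show ?thesis
        using shuffle_assoc_first[OF _ _ _ _ _ _ _ _ IH(2)] IH(1) eqs(1)
        by (simp add: in_Hom_iff)
    next
      case 2
      have IH: "merge xs (merge b zs) = merge (merge xs b) zs"
        "shuffle xs (merge b zs) \<cdot> (\<one> (list_obj xs) \<odot> shuffle b zs) \<cdot> \<alpha> (list_obj xs) (list_obj b) (list_obj zs)
         = shuffle (merge xs b) zs \<cdot> (shuffle xs b \<odot> \<one> (list_obj zs))"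
        using less.hyps[of xs b zs] less.prems eqs by auto
      have "merge ys zs = y # merge b zs" "merge xs (merge ys zs) = y # merge xs (merge b zs)"
        "shuffle ys zs = (\<one> (v y) \<odot> shuffle b zs) \<cdot> \<alpha> (v y) (list_obj b) (list_obj zs)"
        "shuffle xs (merge ys zs) = (\<one> (v y) \<odot> shuffle xs (merge b zs)) \<cdot> twist (list_obj xs) (v y) (list_obj (merge b zs))"
        using 2 eqs by simp_all
      moreover have "merge xs ys = y # merge xs b" "merge (merge xs ys) zs = y # merge (merge xs b) zs"
        "shuffle xs ys = (\<one> (v y) \<odot> shuffle xs b) \<cdot> twist (list_obj xs) (v y) (list_obj b)"
        "shuffle (merge xs ys) zs = (\<one> (v y) \<odot> shuffle (merge xs b) zs) \<cdot> \<alpha> (v y) (list_obj (merge xs b)) (list_obj zs)"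
        using 2 eqs by simp_all
      ultimately show ?thesis
        using shuffle_assoc_second[OF _ _ _ _ _ _ _ _ IH(2)] IH(1) eqs(2)
        by (simp add: in_Hom_iff)
    next
      case 3
      obtain w ws where ws: "merge xs ys = w # ws" and "w = x \<or> w = y"
        using merge_Cons_Cons eqs by metis
      then have *: "z < w" using 3 by auto
      have IH: "merge xs (merge ys c) = merge (merge xs ys) c"
        "shuffle xs (merge ys c) \<cdot> (\<one> (list_obj xs) \<odot> shuffle ys c) \<cdot> \<alpha> (list_obj xs) (list_obj ys) (list_obj c)
         = shuffle (merge xs ys) c \<cdot> (shuffle xs ys \<odot> \<one> (list_obj c))"
        using less.hyps[of xs ys c] less.prems eqs by auto
      have "merge ys zs = z # merge ys c" "merge xs (merge ys zs) = z # merge xs (merge ys c)"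
        "shuffle ys zs = (\<one> (v z) \<odot> shuffle ys c) \<cdot> twist (list_obj ys) (v z) (list_obj c)"
        "shuffle xs (merge ys zs) = (\<one> (v z) \<odot> shuffle xs (merge ys c)) \<cdot> twist (list_obj xs) (v z) (list_obj (merge ys c))"
        using 3 eqs by simp_all
      moreover have "merge (merge xs ys) zs = z # merge (merge xs ys) c"
        "shuffle (merge xs ys) zs = (\<one> (v z) \<odot> shuffle (merge xs ys) c) \<cdot> twist (list_obj (merge xs ys)) (v z) (list_obj c)"
        unfolding ws eqs(3) using * by simp_all
      ultimately show ?thesis
        using shuffle_assoc_third[OF _ _ _ _ _ _ _ _ IH(2)] IH(1) eqs(3)
        by (simp add: in_Hom_iff)
    qed
  qed
qed

text \<open>
  Sorting makes the order of the factors a function of the set, so that permutations of wires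
  disappear from the notation.
\<close>

definition obj :: "nat set \<Rightarrow> 'o" where
  "obj S = list_obj (sorted_list_of_set S)"

definition join :: "nat set \<Rightarrow> nat set \<Rightarrow> 'm" where
  "join S T = shuffle (sorted_list_of_set S) (sorted_list_of_set T)"

lemma obj_Obj [simp]: "obj S \<in> Obj C"
  by (simp add: obj_def)

lemma obj_empty: "obj {} = \<I>" and obj_single: "obj {x} = v x \<otimes> \<I>"
  by (simp_all add: obj_def)

lemma join_typing [simp]:
  assumes "finite S" "finite T" "S \<inter> T = {}"
  shows "join S T \<in> Arr C" "Dom C (join S T) = obj S \<otimes> obj T" "Cod C (join S T) = obj (S \<union> T)"
    "iso_arrow C (join S T)"
  using assms by (simp_all add: join_def obj_def merge_sorted_list_of_set)

lemma join_empty: "join {} S = lunit C (obj S)" "join S {} = \<rho> (obj S)"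
  by (simp_all add: join_def obj_def shuffle_Nil2)

lemma join_comm:
  assumes "finite S" "finite T" "S \<inter> T = {}"
  shows "join T S \<cdot> \<sigma> (obj S) (obj T) = join S T"
  using assms by (simp add: join_def obj_def shuffle_comm)

text \<open>Together with \<open>join_comm\<close> and \<open>join_empty\<close> this is all that is used of coherence below.\<close>

lemma join_assoc:
  assumes "finite S" "finite T" "finite R" "S \<inter> T = {}" "S \<inter> R = {}" "T \<inter> R = {}"
  shows "join S (T \<union> R) \<cdot> (\<one> (obj S) \<odot> join T R) \<cdot> \<alpha> (obj S) (obj T) (obj R)
       = join (S \<union> T) R \<cdot> (join S T \<odot> \<one> (obj R))"
  using assms
    merge_shuffle_assoc[of "sorted_list_of_set S" "sorted_list_of_set T" "sorted_list_of_set R"]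
  by (simp add: join_def obj_def merge_sorted_list_of_set)

end

section \<open>Nets\<close>

text \<open>
  A net records its names, because an arrow does not determine the sets \<open>S\<close> and \<open>T\<close> with
  \<open>obj S\<close> and \<open>obj T\<close> as its domain and codomain.
\<close>

type_synonym 'm net = "nat set \<times> nat set \<times> 'm"

abbreviation ins :: "'m net \<Rightarrow> nat set" where "ins F \<equiv> fst F"
abbreviation outs :: "'m net \<Rightarrow> nat set" where "outs F \<equiv> fst (snd F)"
abbreviation arr :: "'m net \<Rightarrow> 'm" where "arr F \<equiv> snd (snd F)"

text \<open>
  Inputs and outputs are compared separately: a name shared by the outputs of one net and the
  inputs of the other is a connection still to be made, not a clash.
\<close>

definition apart :: "'m net \<Rightarrow> 'm net \<Rightarrow> bool" where
  "apart F G \<longleftrightarrow> ins F \<inter> ins G = {} \<and> outs F \<inter> outs G = {}"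

lemma apart_sym: "apart F G \<Longrightarrow> apart G F"
  by (auto simp: apart_def)

context wires
begin

lemma inv_join_comm:
  assumes "finite S" "finite T" "S \<inter> T = {}"
  shows "\<sigma> (obj T) (obj S) \<cdot> inv (join T S) = inv (join S T)"
proof -
  have [simp]: "T \<inter> S = {}" using assms by auto
  have "inv (join T S \<cdot> \<sigma> (obj S) (obj T)) = \<sigma> (obj T) (obj S) \<cdot> inv (join T S)"
    by (subst iso_comp) (use assms in auto)
  then show ?thesis using join_comm[OF assms] by simp
qed

lemma inv_join_assoc:
  assumes "finite S" "finite T" "finite R" "S \<inter> T = {}" "S \<inter> R = {}" "T \<inter> R = {}"
  shows "inv (\<alpha> (obj S) (obj T) (obj R)) \<cdot> (\<one> (obj S) \<odot> inv (join T R)) \<cdot> inv (join S (T \<union> R))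
       = (inv (join S T) \<odot> \<one> (obj R)) \<cdot> inv (join (S \<union> T) R)"
proof -
  have [simp]: "S \<inter> (T \<union> R) = {}" "(S \<union> T) \<inter> R = {}" using assms by auto
  have "inv (join S (T \<union> R) \<cdot> (\<one> (obj S) \<odot> join T R) \<cdot> \<alpha> (obj S) (obj T) (obj R))
      = inv (join (S \<union> T) R \<cdot> (join S T \<odot> \<one> (obj R)))"
    using join_assoc[OF assms] by simp
  then show ?thesis
    using assms by (simp add: iso_comp iso_tensor comp_assoc' Un_assoc)
qed

definition net :: "'m net \<Rightarrow> bool" where
  "net F \<longleftrightarrow> finite (ins F) \<and> finite (outs F) \<and> arr F \<in> Hom C (obj (ins F)) (obj (outs F))"

lemma net_typing [simp]:
  assumes "net F"
  shows "finite (ins F)" "finite (outs F)" "arr F \<in> Arr C" "Dom C (arr F) = obj (ins F)"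
    "Cod C (arr F) = obj (outs F)"
  using assms by (auto simp: net_def in_Hom_iff)

definition nid :: "nat set \<Rightarrow> 'm net" where
  "nid X = (X, X, \<one> (obj X))"

definition ncomp :: "'m net \<Rightarrow> 'm net \<Rightarrow> 'm net" (infixr "\<circ>\<^sub>n" 55) where
  "G \<circ>\<^sub>n F = (ins F, outs G, arr G \<cdot> arr F)"

definition par :: "'m net \<Rightarrow> 'm net \<Rightarrow> 'm net" (infixr "\<parallel>" 65) where
  "F \<parallel> G = (ins F \<union> ins G, outs F \<union> outs G,
     join (outs F) (outs G) \<cdot> (arr F \<odot> arr G) \<cdot> inv (join (ins F) (ins G)))"

lemma nid_simps [simp]: "ins (nid X) = X" "outs (nid X) = X" "arr (nid X) = \<one> (obj X)"
  by (simp_all add: nid_def)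

lemma ncomp_simps [simp]: "ins (G \<circ>\<^sub>n F) = ins F" "outs (G \<circ>\<^sub>n F) = outs G" "arr (G \<circ>\<^sub>n F) = arr G \<cdot> arr F"
  by (simp_all add: ncomp_def)

lemma par_ins_outs [simp]: "ins (F \<parallel> G) = ins F \<union> ins G" "outs (F \<parallel> G) = outs F \<union> outs G"
  by (simp_all add: par_def)

lemma net_nid [simp]: "net (nid X) \<longleftrightarrow> finite X"
  by (auto simp: net_def in_Hom_iff)

lemma net_ncomp [simp]: "net F \<Longrightarrow> net G \<Longrightarrow> outs F = ins G \<Longrightarrow> net (G \<circ>\<^sub>n F)"
  unfolding net_def[of "G \<circ>\<^sub>n F"] by (simp add: in_Hom_iff)

lemma net_par [simp]: "net F \<Longrightarrow> net G \<Longrightarrow> apart F G \<Longrightarrow> net (F \<parallel> G)"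
  unfolding net_def[of "F \<parallel> G"] by (simp add: apart_def in_Hom_iff) (simp add: par_def)

lemma ncomp_nid [simp]: "net F \<Longrightarrow> ins F = X \<Longrightarrow> F \<circ>\<^sub>n nid X = F"
  by (simp add: prod_eq_iff)

lemma nid_ncomp [simp]: "net F \<Longrightarrow> outs F = X \<Longrightarrow> nid X \<circ>\<^sub>n F = F"
  by (simp add: prod_eq_iff)

lemma nid_par_nid: "finite X \<Longrightarrow> finite Y \<Longrightarrow> X \<inter> Y = {} \<Longrightarrow> nid X \<parallel> nid Y = nid (X \<union> Y)"
  by (simp add: par_def nid_def)

text \<open>Naturality of \<open>\<sigma>\<close>, whose two occurrences are absorbed by the joins.\<close>

lemma par_comm:
  assumes [simp]: "net F" "net G" and d: "apart F G"
  shows "G \<parallel> F = F \<parallel> G"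
proof -
  have [simp]: "ins F \<inter> ins G = {}" "outs F \<inter> outs G = {}" "ins G \<inter> ins F = {}" "outs G \<inter> outs F = {}"
    using d by (auto simp: apart_def)
  have "arr (F \<parallel> G) = (join (outs G) (outs F) \<cdot> \<sigma> (obj (outs F)) (obj (outs G))) \<cdot> (arr F \<odot> arr G)
      \<cdot> \<sigma> (obj (ins G)) (obj (ins F)) \<cdot> inv (join (ins G) (ins F))"
    by (simp add: par_def join_comm inv_join_comm)
  also have "\<dots> = join (outs G) (outs F) \<cdot> (\<sigma> (obj (outs F)) (obj (outs G)) \<cdot> (arr F \<odot> arr G))
      \<cdot> \<sigma> (obj (ins G)) (obj (ins F)) \<cdot> inv (join (ins G) (ins F))"
    by (simp add: comp_assoc')
  also have "\<dots> = join (outs G) (outs F) \<cdot> (arr G \<odot> arr F)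
      \<cdot> (\<sigma> (obj (ins F)) (obj (ins G)) \<cdot> \<sigma> (obj (ins G)) (obj (ins F))) \<cdot> inv (join (ins G) (ins F))"
    by (simp add: comp_assoc' braid_nat)
  also have "\<dots> = arr (G \<parallel> F)" by (simp add: par_def braid_symmetric)
  finally show ?thesis by (auto simp: prod_eq_iff)
qed

lemma par_assoc:
  assumes [simp]: "net F" "net G" "net H" and d: "apart F G" "apart F H" "apart G H"
  shows "(F \<parallel> G) \<parallel> H = F \<parallel> (G \<parallel> H)"
proof -
  have [simp]: "ins F \<inter> ins G = {}" "ins F \<inter> ins H = {}" "ins G \<inter> ins H = {}"
    "outs F \<inter> outs G = {}" "outs F \<inter> outs H = {}" "outs G \<inter> outs H = {}"
    "ins F \<inter> (ins G \<union> ins H) = {}" "(ins F \<union> ins G) \<inter> ins H = {}"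
    "outs F \<inter> (outs G \<union> outs H) = {}" "(outs F \<union> outs G) \<inter> outs H = {}"
    using d by (auto simp: apart_def)
  let ?o = "join (outs F) (outs G)" and ?i = "join (ins F) (ins G)"
  have "arr ((F \<parallel> G) \<parallel> H) = (join (outs F \<union> outs G) (outs H) \<cdot> (?o \<odot> \<one> (obj (outs H))))
     \<cdot> ((arr F \<odot> arr G) \<odot> arr H) \<cdot> (inv ?i \<odot> \<one> (obj (ins H))) \<cdot> inv (join (ins F \<union> ins G) (ins H))"
    by (simp add: par_def comp_assoc' interchange')
  also have "\<dots> = (join (outs F) (outs G \<union> outs H) \<cdot> (\<one> (obj (outs F)) \<odot> join (outs G) (outs H))
       \<cdot> \<alpha> (obj (outs F)) (obj (outs G)) (obj (outs H)))
     \<cdot> ((arr F \<odot> arr G) \<odot> arr H) \<cdot> inv (\<alpha> (obj (ins F)) (obj (ins G)) (obj (ins H)))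
     \<cdot> (\<one> (obj (ins F)) \<odot> inv (join (ins G) (ins H))) \<cdot> inv (join (ins F) (ins G \<union> ins H))"
    by (simp add: inv_join_assoc join_assoc del: comp_typing(3))
  also have "\<dots> = join (outs F) (outs G \<union> outs H) \<cdot> (\<one> (obj (outs F)) \<odot> join (outs G) (outs H))
     \<cdot> (arr F \<odot> (arr G \<odot> arr H))
     \<cdot> (\<one> (obj (ins F)) \<odot> inv (join (ins G) (ins H))) \<cdot> inv (join (ins F) (ins G \<union> ins H))"
    by (simp add: comp_assoc' Un_assoc assoc_nat'[symmetric])
  also have "\<dots> = arr (F \<parallel> (G \<parallel> H))"
    by (simp add: par_def comp_assoc' interchange')
  finally show ?thesis by (auto simp: prod_eq_iff)
qed

lemma par_left_comm:
  assumes "net F" "net G" "net H" "apart F G" "apart F H" "apart G H"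
  shows "G \<parallel> (F \<parallel> H) = F \<parallel> (G \<parallel> H)"
  using assms by (simp add: par_assoc[symmetric] apart_sym par_comm)

lemma par_ncomp:
  assumes [simp]: "net F" "net G" "net F'" "net G'" "outs F = ins G" "outs F' = ins G'"
    and d: "apart F F'" "apart G G'"
  shows "(G \<parallel> G') \<circ>\<^sub>n (F \<parallel> F') = (G \<circ>\<^sub>n F) \<parallel> (G' \<circ>\<^sub>n F')"
proof -
  have [simp]: "ins F \<inter> ins F' = {}" "ins G \<inter> ins G' = {}" "outs G \<inter> outs G' = {}"
    using d by (auto simp: apart_def)
  show ?thesis by (simp add: par_def ncomp_def comp_assoc' interchange')
qed

text \<open>
  Two boxes side by side can be fired one after the other; this is how a diagram that is drawn
  in layers is compared with the bare juxtaposition of its boxes.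
\<close>

lemma par_sequential:
  assumes "net F" "net G" "apart F G" "outs F \<inter> ins G = {}"
  shows "(nid (outs F) \<parallel> G) \<circ>\<^sub>n (F \<parallel> nid (ins G)) = F \<parallel> G"
  using assms by (subst par_ncomp) (auto simp: apart_def)

end

section \<open>Bracketings and the nets denoted by arrows\<close>

text \<open>
  The domain of an arrow of \<open>U\<close> is a bracketed tensor product.  A tree describes such a
  bracketing: \<open>$x\<close> stands for the object of one name, and a block for the object of a whole set of
  names, which in the proof about composites plays the part of a single wire.
\<close>

datatype tree = Name nat ("$_" [1000] 1000) | Block "nat set" | Unit | Fork tree tree (infixr "**" 75)

fun leaves :: "tree \<Rightarrow> nat set" where
  "leaves (Name x) = {x}"
| "leaves (Block X) = X"
| "leaves Unit = {}"
| "leaves (s ** t) = leaves s \<union> leaves t"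

fun linear :: "tree \<Rightarrow> bool" where
  "linear (Name x) \<longleftrightarrow> True"
| "linear (Block X) \<longleftrightarrow> finite X"
| "linear Unit \<longleftrightarrow> True"
| "linear (s ** t) \<longleftrightarrow> linear s \<and> linear t \<and> leaves s \<inter> leaves t = {}"

lemma finite_leaves [simp]: "linear t \<Longrightarrow> finite (leaves t)"
  by (induction t) auto

context wires
begin

fun tree_obj :: "tree \<Rightarrow> 'o" where
  "tree_obj (Name x) = v x"
| "tree_obj (Block X) = obj X"
| "tree_obj Unit = \<I>"
| "tree_obj (s ** t) = tree_obj s \<otimes> tree_obj t"

text \<open>The canonical isomorphism from a bracketing to the object of its set of names.\<close>

fun norm :: "tree \<Rightarrow> 'm" where
  "norm (Name x) = inv (\<rho> (v x))"
| "norm (Block X) = \<one> (obj X)"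
| "norm Unit = \<one> \<I>"
| "norm (s ** t) = join (leaves s) (leaves t) \<cdot> (norm s \<odot> norm t)"

lemma tree_obj_Obj [simp]: "tree_obj t \<in> Obj C"
  by (induction t) auto

lemma norm_typing [simp]:
  assumes "linear t"
  shows "norm t \<in> Arr C" "Dom C (norm t) = tree_obj t" "Cod C (norm t) = obj (leaves t)" "iso_arrow C (norm t)"
proof -
  have "norm t \<in> Arr C \<and> Dom C (norm t) = tree_obj t \<and> Cod C (norm t) = obj (leaves t) \<and> iso_arrow C (norm t)"
    using assms by (induction t) (auto simp: obj_empty obj_single intro!: iso_comp iso_tensor)
  then show "norm t \<in> Arr C" "Dom C (norm t) = tree_obj t" "Cod C (norm t) = obj (leaves t)" "iso_arrow C (norm t)"
    by auto
qed

text \<open>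
  Once the bracketings are fixed, arrow and net determine each other, so an equation between
  arrows may be proved by computing both nets.
\<close>

definition denotes :: "tree \<Rightarrow> tree \<Rightarrow> 'm \<Rightarrow> 'm net \<Rightarrow> bool" where
  "denotes s t f F \<longleftrightarrow> linear s \<and> linear t \<and> f \<in> Hom C (tree_obj s) (tree_obj t)
     \<and> F = (leaves s, leaves t, norm t \<cdot> f \<cdot> inv (norm s))"

lemma denotesD:
  assumes "denotes s t f F"
  shows "linear s" "linear t" "f \<in> Arr C" "Dom C f = tree_obj s" "Cod C f = tree_obj t"
    "net F" "ins F = leaves s" "outs F = leaves t" "arr F = norm t \<cdot> f \<cdot> inv (norm s)"
  using assms by (auto simp: denotes_def in_Hom_iff net_def)

lemma denotesI:
  assumes "linear s" "linear t" "f \<in> Arr C" "Dom C f = tree_obj s" "Cod C f = tree_obj t"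
    "net F" "ins F = leaves s" "outs F = leaves t" "norm t \<cdot> f = arr F \<cdot> norm s"
  shows "denotes s t f F"
proof -
  have "norm t \<cdot> f \<cdot> inv (norm s) = (arr F \<cdot> norm s) \<cdot> inv (norm s)"
    using assms(1-8) unfolding assms(9)[symmetric] by (simp add: comp_assoc')
  also have "\<dots> = arr F"
    using assms(1-8) by (simp add: comp_assoc')
  finally show ?thesis
    using assms by (simp add: denotes_def in_Hom_iff prod_eq_iff)
qed

lemma denotes_exists:
  "linear s \<Longrightarrow> linear t \<Longrightarrow> f \<in> Hom C (tree_obj s) (tree_obj t) \<Longrightarrow> \<exists>F. denotes s t f F"
  by (auto simp: denotes_def)

lemma denotes_unique:
  assumes "denotes s t f F" "denotes s t g F"
  shows "f = g"
proof -
  note [simp] = denotesD(1-5)[OF assms(1)] denotesD(3-5)[OF assms(2)]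
  have "norm t \<cdot> f \<cdot> inv (norm s) = norm t \<cdot> g \<cdot> inv (norm s)"
    using assms by (auto simp: denotes_def)
  then have "f \<cdot> inv (norm s) = g \<cdot> inv (norm s)"
    by (rule iso_cancel_left[rotated]) simp_all
  then show ?thesis by (rule iso_cancel_right[rotated]) simp_all
qed

lemma denotes_eqI: "denotes s t f F \<Longrightarrow> F = F' \<Longrightarrow> denotes s t f F'"
  by simp

text \<open>
  The premise for the arrow applied first comes first: resolution then reaches the second arrow
  with its source bracketing already known, and nets of composites are computed by resolution alone.
\<close>

lemma denotes_comp:
  assumes "denotes s t f F" "denotes t r g G"
  shows "denotes s r (g \<cdot> f) (G \<circ>\<^sub>n F)"
  using denotesD[OF assms(1)] denotesD[OF assms(2)]
  by (auto simp: denotes_def in_Hom_iff ncomp_def comp_assoc')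

lemma denotes_tensor:
  assumes "denotes s t f F" "denotes s' t' f' F'"
    and "leaves s \<inter> leaves s' = {}" "leaves t \<inter> leaves t' = {}"
  shows "denotes (s ** s') (t ** t') (f \<odot> f') (F \<parallel> F')"
proof (rule denotesI)
  note [simp] = denotesD(1-8)[OF assms(1)] denotesD(1-8)[OF assms(2)] assms(3,4)
  show "net (F \<parallel> F')" by (simp add: apart_def)
  show "norm (t ** t') \<cdot> (f \<odot> f') = arr (F \<parallel> F') \<cdot> norm (s ** s')"
    by (simp add: par_def denotesD(9)[OF assms(1)] denotesD(9)[OF assms(2)] comp_assoc' interchange)
qed (use denotesD[OF assms(1)] denotesD[OF assms(2)] assms(3,4) in simp_all)

lemma denotes_ident: "linear s \<Longrightarrow> A = tree_obj s \<Longrightarrow> denotes s s (\<one> A) (nid (leaves s))"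
  by (rule denotesI) simp_all

lemma denotes_nid_inv:
  assumes "denotes s t f (nid X)" "iso_arrow C f"
  shows "denotes t s (inv f) (nid X)"
proof (rule denotesI)
  note [simp] = denotesD(1-5)[OF assms(1)] assms(2)
  have [simp]: "leaves s = X" "leaves t = X"
    using denotesD(7,8)[OF assms(1)] by auto
  have "\<one> (obj X) \<cdot> norm s = (norm t \<cdot> f \<cdot> inv (norm s)) \<cdot> norm s"
    using denotesD(9)[OF assms(1)] by simp
  then have "norm s = norm t \<cdot> f" by (simp add: comp_assoc')
  then have "norm s \<cdot> inv f = (norm t \<cdot> f) \<cdot> inv f" by simp
  then show "norm s \<cdot> inv f = arr (nid X) \<cdot> norm t" by (simp add: comp_assoc')
qed (use denotesD[OF assms(1)] assms(2) in auto)

text \<open>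
  Associativity of \<open>join\<close> says that \<open>\<alpha>\<close> commutes with the canonical isomorphisms, so it
  denotes an identity net; likewise for the other structural arrows.
\<close>

lemma denotes_assoc:
  assumes "linear ((s ** t) ** r)" "A = tree_obj s" "B = tree_obj t" "E = tree_obj r"
  shows "denotes ((s ** t) ** r) (s ** (t ** r)) (\<alpha> A B E) (nid (leaves s \<union> leaves t \<union> leaves r))"
proof (rule denotesI)
  have [simp]: "linear s" "linear t" "linear r" "leaves s \<inter> leaves t = {}"
    "leaves s \<inter> leaves r = {}" "leaves t \<inter> leaves r = {}" "leaves s \<inter> (leaves t \<union> leaves r) = {}"
    "(leaves s \<union> leaves t) \<inter> leaves r = {}"
    using assms(1) by auto
  have "norm (s ** (t ** r)) \<cdot> \<alpha> A B E
    = join (leaves s) (leaves t \<union> leaves r) \<cdot> (\<one> (obj (leaves s)) \<odot> join (leaves t) (leaves r))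
       \<cdot> (norm s \<odot> (norm t \<odot> norm r)) \<cdot> \<alpha> A B E"
    by (simp add: interchange' comp_assoc' assms)
  also have "\<dots> = (join (leaves s) (leaves t \<union> leaves r) \<cdot> (\<one> (obj (leaves s)) \<odot> join (leaves t) (leaves r))
       \<cdot> \<alpha> (obj (leaves s)) (obj (leaves t)) (obj (leaves r))) \<cdot> ((norm s \<odot> norm t) \<odot> norm r)"
    by (simp add: assoc_nat comp_assoc' assms)
  also have "\<dots> = join (leaves s \<union> leaves t) (leaves r) \<cdot> (join (leaves s) (leaves t) \<odot> \<one> (obj (leaves r)))
       \<cdot> ((norm s \<odot> norm t) \<odot> norm r)"
    by (simp add: join_assoc comp_assoc' Un_assoc)
  also have "\<dots> = norm ((s ** t) ** r)" by (simp add: interchange)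
  finally show "norm (s ** (t ** r)) \<cdot> \<alpha> A B E
     = arr (nid (leaves s \<union> leaves t \<union> leaves r)) \<cdot> norm ((s ** t) ** r)"
    by (simp add: Un_assoc)
qed (use assms in \<open>auto simp: Un_assoc\<close>)

lemma denotes_assoc_inv:
  assumes "linear (s ** (t ** r))" "A = tree_obj s" "B = tree_obj t" "E = tree_obj r"
  shows "denotes (s ** (t ** r)) ((s ** t) ** r) (inv (\<alpha> A B E)) (nid (leaves s \<union> leaves t \<union> leaves r))"
  by (rule denotes_nid_inv[OF denotes_assoc]) (use assms in auto)

lemma denotes_braid:
  assumes "linear (s ** t)" "A = tree_obj s" "B = tree_obj t"
  shows "denotes (s ** t) (t ** s) (\<sigma> A B) (nid (leaves s \<union> leaves t))"
proof (rule denotesI)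
  have [simp]: "linear s" "linear t" "leaves s \<inter> leaves t = {}" "leaves t \<inter> leaves s = {}"
    using assms(1) by auto
  have "norm (t ** s) \<cdot> \<sigma> A B = join (leaves t) (leaves s) \<cdot> \<sigma> (obj (leaves s)) (obj (leaves t)) \<cdot> (norm s \<odot> norm t)"
    by (simp add: comp_assoc' braid_nat assms)
  also have "\<dots> = norm (s ** t)"
    by (simp add: join_comm Un_commute flip: comp_assoc')
  finally show "norm (t ** s) \<cdot> \<sigma> A B = arr (nid (leaves s \<union> leaves t)) \<cdot> norm (s ** t)"
    by simp
qed (use assms in auto)

lemma denotes_lunit:
  assumes "linear s" "A = tree_obj s"
  shows "denotes (Unit ** s) s (lunit C A) (nid (leaves s))"
  by (rule denotesI) (use assms lunit_natural[of "norm s" "tree_obj s" "obj (leaves s)"] in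
      \<open>simp_all add: join_empty obj_empty in_Hom_iff\<close>)

lemma denotes_runit:
  assumes "linear s" "A = tree_obj s"
  shows "denotes (s ** Unit) s (\<rho> A) (nid (leaves s))"
  by (rule denotesI) (use assms runit_natural[of "norm s" "tree_obj s" "obj (leaves s)"] in
      \<open>simp_all add: join_empty obj_empty in_Hom_iff\<close>)

lemmas denotes_intros = denotes_comp denotes_tensor denotes_ident denotes_assoc denotes_assoc_inv denotes_braid denotes_lunit denotes_runit

end

context symmetric_monoidal_category
begin

text \<open>
  Names are the positions in a list of objects.  The default value beyond the end of the list only
  keeps the valuation total.
\<close>

definition valuation :: "'o list \<Rightarrow> nat \<Rightarrow> 'o" where
  "valuation Xs i = (if i < length Xs then Xs ! i else \<I>)"

lemma valuation_nth [simp]: "i < length Xs \<Longrightarrow> valuation Xs i = Xs ! i"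
  by (simp add: valuation_def)

lemma wires_valuation: "set Xs \<subseteq> Obj C \<Longrightarrow> wires C (valuation Xs)"
  by unfold_locales (auto simp: valuation_def subset_iff)

lemma swap_right_typing [simp]:
  assumes [simp]: "X \<in> Obj C" "Y \<in> Obj C" "Z \<in> Obj C"
  shows "swap_right C X Y Z \<in> Arr C" "Dom C (swap_right C X Y Z) = (X \<otimes> Y) \<otimes> Z"
    "Cod C (swap_right C X Y Z) = (X \<otimes> Z) \<otimes> Y" "iso_arrow C (swap_right C X Y Z)"
  by (simp_all add: swap_right_def iso_comp iso_tensor)

lemma mid_four_typing [simp]:
  assumes [simp]: "W \<in> Obj C" "X \<in> Obj C" "Y \<in> Obj C" "Z \<in> Obj C"
  shows "mid_four C W X Y Z \<in> Arr C" "Dom C (mid_four C W X Y Z) = (W \<otimes> X) \<otimes> (Y \<otimes> Z)"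
    "Cod C (mid_four C W X Y Z) = (W \<otimes> Y) \<otimes> (X \<otimes> Z)" "iso_arrow C (mid_four C W X Y Z)"
  by (simp_all add: mid_four_def iso_comp iso_tensor)

end

context wires
begin

lemma denotes_swap_right:
  assumes "linear ((x ** y) ** z)" "X = tree_obj x" "Y = tree_obj y" "Z = tree_obj z"
  shows "denotes ((x ** y) ** z) ((x ** z) ** y) (swap_right C X Y Z) (nid (leaves x \<union> leaves y \<union> leaves z))"
  unfolding swap_right_def
  apply (rule denotes_eqI)
   apply (rule denotes_intros | use assms in \<open>simp; fail\<close> | use assms in \<open>auto; fail\<close>)+
  using assms by (simp add: nid_par_nid Un_ac Int_Un_distrib Int_Un_distrib2)

lemma denotes_mid_four:
  assumes "linear ((w ** x) ** (y ** z))" "W = tree_obj w" "X = tree_obj x" "Y = tree_obj y" "Z = tree_obj z"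
  shows "denotes ((w ** x) ** (y ** z)) ((w ** y) ** (x ** z)) (mid_four C W X Y Z)
     (nid (leaves w \<union> leaves x \<union> leaves y \<union> leaves z))"
  unfolding mid_four_def
  apply (rule denotes_eqI)
   apply (rule denotes_intros denotes_swap_right | use assms in \<open>simp; fail\<close> | use assms in \<open>auto; fail\<close>)+
  using assms by (simp add: nid_par_nid Un_ac Int_Un_distrib Int_Un_distrib2)

end

section \<open>Contraction\<close>

context traced_category
begin

lemma tr_typing [simp]:
  assumes "A \<in> Obj C" "B \<in> Obj C" "U \<in> Obj C" "f \<in> Arr C" "Dom C f = A \<otimes> U" "Cod C f = B \<otimes> U"
  shows "Tr U A B f \<in> Arr C" "Dom C (Tr U A B f) = A" "Cod C (Tr U A B f) = B"
  using tr_Hom[of A B U f] assms by (auto simp: in_Hom_iff)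

lemma tr_nat:
  assumes "U \<in> Obj C" "f \<in> Arr C" "g \<in> Arr C" "k \<in> Arr C" "Cod C f = A" "Dom C g = B"
    "Dom C k = A \<otimes> U" "Cod C k = B \<otimes> U"
  shows "Tr U (Dom C f) (Cod C g) ((g \<odot> \<one> U) \<cdot> k \<cdot> (f \<odot> \<one> U)) = g \<cdot> Tr U A B k \<cdot> f"
  using assms tr_natural[of A B U f "Dom C f" g "Cod C g" k] by (auto simp: in_Hom_iff)

lemma tr_nat_left:
  assumes "U \<in> Obj C" "A \<in> Obj C" "g \<in> Arr C" "k \<in> Arr C" "Dom C g = B"
    "Dom C k = A \<otimes> U" "Cod C k = B \<otimes> U"
  shows "Tr U A (Cod C g) ((g \<odot> \<one> U) \<cdot> k) = g \<cdot> Tr U A B k"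
  using assms tr_nat[of U "\<one> A" g k A B] by auto

lemma tr_nat_right:
  assumes "U \<in> Obj C" "B \<in> Obj C" "f \<in> Arr C" "k \<in> Arr C" "Cod C f = A"
    "Dom C k = A \<otimes> U" "Cod C k = B \<otimes> U"
  shows "Tr U (Dom C f) B (k \<cdot> (f \<odot> \<one> U)) = Tr U A B k \<cdot> f"
  using assms tr_nat[of U f "\<one> B" k A B] by auto

lemma tr_dinat:
  assumes "A \<in> Obj C" "B \<in> Obj C" "h \<in> Arr C" "k \<in> Arr C" "Dom C h = U" "Cod C h = V"
    "Dom C k = A \<otimes> V" "Cod C k = B \<otimes> U"
  shows "Tr V A B ((\<one> B \<odot> h) \<cdot> k) = Tr U A B (k \<cdot> (\<one> A \<odot> h))"
  using assms tr_dinatural[of A B h U V k] by (auto simp: in_Hom_iff)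

text \<open>Dinaturality lets \<open>h\<close> slide around the loop, where it meets its inverse.\<close>

lemma tr_conjugate:
  assumes "A \<in> Obj C" "B \<in> Obj C" "iso_arrow C h" "k \<in> Arr C" "Dom C h = U" "Cod C h = V"
    "Dom C k = A \<otimes> V" "Cod C k = B \<otimes> V"
  shows "Tr U A B ((\<one> B \<odot> inv h) \<cdot> k \<cdot> (\<one> A \<odot> h)) = Tr V A B k"
proof -
  have [simp]: "h \<in> Arr C" "U \<in> Obj C" "V \<in> Obj C" using assms iso_Arr by auto
  have "Tr U A B ((\<one> B \<odot> inv h) \<cdot> k \<cdot> (\<one> A \<odot> h)) = Tr V A B ((k \<cdot> (\<one> A \<odot> h)) \<cdot> (\<one> A \<odot> inv h))"
    using assms by (subst tr_dinat[of A B "inv h" _ V U]) simp_all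
  also have "\<dots> = Tr V A B k" using assms by (simp add: merge_tensor)
  finally show ?thesis .
qed

text \<open>
  Yanking in the presence of a bystander \<open>P\<close>: the two copies of \<open>M\<close> in \<open>(M \<otimes> P) \<otimes> M\<close> are
  exchanged and one of them is traced out.
\<close>

lemma tr_braid_context:
  assumes [simp]: "M \<in> Obj C" "P \<in> Obj C"
  shows "Tr M (M \<otimes> P) (M \<otimes> P) ((\<sigma> P M \<odot> \<one> M) \<cdot> (inv (\<alpha> P M M) \<cdot> (\<one> P \<odot> \<sigma> M M) \<cdot> \<alpha> P M M) \<cdot> (\<sigma> M P \<odot> \<one> M))
    = \<one> (M \<otimes> P)"
proof -
  have "Tr M (P \<otimes> M) (P \<otimes> M) (inv (\<alpha> P M M) \<cdot> (\<one> P \<odot> \<sigma> M M) \<cdot> \<alpha> P M M) = \<one> (P \<otimes> M)"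
    using tr_superpose[of M M M "\<one> P" P P "\<sigma> M M"] by (simp add: in_Hom_iff tr_yank)
  then show ?thesis
    using tr_nat[of M "\<sigma> M P" "\<sigma> P M" "inv (\<alpha> P M M) \<cdot> (\<one> P \<odot> \<sigma> M M) \<cdot> \<alpha> P M M" "P \<otimes> M" "P \<otimes> M"]
    by (simp add: braid_symmetric)
qed

text \<open>
  Feeding the output \<open>M\<close> of \<open>f\<close> back into \<open>g\<close> by a loop amounts to connecting the two
  directly.  The loop body factors as \<open>f\<close>, then an exchange of two copies of \<open>M\<close>, then \<open>g\<close>; naturality
  of the trace pulls \<open>f\<close> and \<open>g\<close> out of the loop, and the trace of the exchange is the identity.
\<close>

lemma tr_parallel_is_composite:
  assumes obj [simp]: "S \<in> Obj C" "P \<in> Obj C" "M \<in> Obj C" "Q \<in> Obj C" "T \<in> Obj C"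
    and f: "f \<in> Hom C S (Q \<otimes> M)" and g: "g \<in> Hom C (M \<otimes> P) T"
  shows "Tr M (S \<otimes> P) (Q \<otimes> T)
      (inv (\<alpha> Q T M) \<cdot> (\<one> Q \<odot> \<sigma> M T) \<cdot> \<alpha> Q M T \<cdot> (f \<odot> g) \<cdot> (\<one> S \<odot> \<sigma> P M) \<cdot> \<alpha> S P M)
    = (\<one> Q \<odot> g) \<cdot> \<alpha> Q M P \<cdot> (f \<odot> \<one> P)"
proof -
  note f[unfolded in_Hom_iff, simp] g[unfolded in_Hom_iff, simp]
  define k1 where "k1 = (\<sigma> P M \<odot> \<one> M) \<cdot> (inv (\<alpha> P M M) \<cdot> (\<one> P \<odot> \<sigma> M M) \<cdot> \<alpha> P M M) \<cdot> (\<sigma> M P \<odot> \<one> M)"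
  define k0 where "k0 = inv (\<alpha> Q (M \<otimes> P) M) \<cdot> (\<one> Q \<odot> k1) \<cdot> \<alpha> Q (M \<otimes> P) M"
  have [simp]: "k1 \<in> Arr C" "Dom C k1 = (M \<otimes> P) \<otimes> M" "Cod C k1 = (M \<otimes> P) \<otimes> M"
    by (simp_all add: k1_def)
  have [simp]: "k0 \<in> Arr C" "Dom C k0 = (Q \<otimes> (M \<otimes> P)) \<otimes> M" "Cod C k0 = (Q \<otimes> (M \<otimes> P)) \<otimes> M"
    by (simp_all add: k0_def)
  have "Tr M (Q \<otimes> (M \<otimes> P)) (Q \<otimes> (M \<otimes> P)) k0 = \<one> Q \<odot> Tr M (M \<otimes> P) (M \<otimes> P) k1"
    unfolding k0_def by (rule tr_superpose) (simp_all add: in_Hom_iff)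
  also have "\<dots> = \<one> (Q \<otimes> (M \<otimes> P))" by (simp add: k1_def tr_braid_context)
  finally have k0: "Tr M (Q \<otimes> (M \<otimes> P)) (Q \<otimes> (M \<otimes> P)) k0 = \<one> (Q \<otimes> (M \<otimes> P))" .

  \<comment> \<open>The two copies of \<open>M\<close> get the different names 2 and 5; the output of \<open>f\<close> is called 5.\<close>
  interpret W: wires C "valuation [S, P, M, Q, T, M]"
    by (rule wires_valuation) simp
  let ?s = "$0" and ?p = "$1" and ?m = "$2" and ?q = "$3" and ?t = "$4" and ?n = "$5"
  obtain F where F: "W.denotes ?s (?q ** ?n) f F"
    by (atomize_elim, rule W.denotes_exists) (simp_all add: in_Hom_iff)
  obtain G where G: "W.denotes (?m ** ?p) ?t g G"
    by (atomize_elim, rule W.denotes_exists) (simp_all add: in_Hom_iff)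
  note FG [simp] = W.denotesD(6-8)[OF F] W.denotesD(6-8)[OF G]
  have lhs: "W.denotes ((?s ** ?p) ** ?m) ((?q ** ?t) ** ?n)
      (inv (\<alpha> Q T M) \<cdot> (\<one> Q \<odot> \<sigma> M T) \<cdot> \<alpha> Q M T \<cdot> (f \<odot> g) \<cdot> (\<one> S \<odot> \<sigma> P M) \<cdot> \<alpha> S P M) (W.par F G)"
    apply (rule W.denotes_eqI)
     apply (rule F G W.denotes_intros | simp; fail)+
    apply (simp add: W.nid_par_nid insert_commute apart_def)
    done
  have "W.par (W.par (W.nid {3}) G) (W.nid {5}) = W.par (W.nid {5}) (W.par (W.nid {3}) G)"
    by (rule W.par_comm) (auto simp: apart_def)
  also have "\<dots> = W.par (W.nid (outs F)) G"
    by (subst W.par_assoc[symmetric]) (auto simp: apart_def W.nid_par_nid insert_commute)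
  finally have "W.ncomp (W.par (W.par (W.nid {3}) G) (W.nid {5})) (W.par (W.par F (W.nid {1})) (W.nid {2}))
     = W.ncomp (W.par (W.nid (outs F)) G) (W.par F (W.nid (ins G)))"
    by (subst W.par_assoc) (auto simp: apart_def W.nid_par_nid insert_commute)
  also have "\<dots> = W.par F G"
    by (rule W.par_sequential) (auto simp: apart_def)
  finally have seq: "W.ncomp (W.par (W.par (W.nid {3}) G) (W.nid {5})) (W.par (W.par F (W.nid {Suc 0})) (W.nid {2})) = W.par F G"
    by simp
  have rhs: "W.denotes ((?s ** ?p) ** ?m) ((?q ** ?t) ** ?n)
      (((\<one> Q \<odot> g) \<odot> \<one> M) \<cdot> k0 \<cdot> ((\<alpha> Q M P \<cdot> (f \<odot> \<one> P)) \<odot> \<one> M)) (W.par F G)"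
    unfolding k0_def k1_def
    apply (rule W.denotes_eqI)
     apply (rule F G W.denotes_intros | simp; fail)+
    apply (simp add: W.nid_par_nid insert_commute apart_def seq)
    done
  have "Tr M (S \<otimes> P) (Q \<otimes> T)
      (inv (\<alpha> Q T M) \<cdot> (\<one> Q \<odot> \<sigma> M T) \<cdot> \<alpha> Q M T \<cdot> (f \<odot> g) \<cdot> (\<one> S \<odot> \<sigma> P M) \<cdot> \<alpha> S P M)
    = Tr M (S \<otimes> P) (Q \<otimes> T) (((\<one> Q \<odot> g) \<odot> \<one> M) \<cdot> k0 \<cdot> ((\<alpha> Q M P \<cdot> (f \<odot> \<one> P)) \<odot> \<one> M))"
    using W.denotes_unique[OF lhs rhs] by simp
  also have "\<dots> = (\<one> Q \<odot> g) \<cdot> Tr M (Q \<otimes> (M \<otimes> P)) (Q \<otimes> (M \<otimes> P)) k0 \<cdot> (\<alpha> Q M P \<cdot> (f \<odot> \<one> P))"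
    using tr_nat[of M "\<alpha> Q M P \<cdot> (f \<odot> \<one> P)" "\<one> Q \<odot> g" k0 "Q \<otimes> (M \<otimes> P)" "Q \<otimes> (M \<otimes> P)"]
    by simp
  finally show ?thesis by (simp add: k0)
qed

end

locale traced_wires = traced_category C + wires C v
  for C :: "('o, 'm, 'x) traced_data_scheme" (structure) and v
begin

text \<open>
  Every name in \<open>X\<close> is both an input and an output, and contraction connects each such output to
  the input of the same name.
\<close>

definition contract :: "nat set \<Rightarrow> 'm net \<Rightarrow> 'm net" where
  "contract X F = (ins F - X, outs F - X,
     Tr (obj X) (obj (ins F - X)) (obj (outs F - X))
       (inv (join (outs F - X) X) \<cdot> arr F \<cdot> join (ins F - X) X))"

lemma contract_ins_outs [simp]: "ins (contract X F) = ins F - X" "outs (contract X F) = outs F - X"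
  by (simp_all add: contract_def)

lemma net_contract [simp]:
  assumes "net F" "X \<subseteq> ins F" "X \<subseteq> outs F"
  shows "net (contract X F)"
proof -
  note [simp] = net_typing[OF assms(1)]
  have [simp]: "finite X" "ins F \<union> X = ins F" "outs F \<union> X = outs F"
    "(ins F - X) \<inter> X = {}" "(outs F - X) \<inter> X = {}"
    using assms finite_subset[of X "ins F"] by auto
  show ?thesis
    unfolding net_def by (simp add: in_Hom_iff) (simp add: contract_def)
qed

lemma contract_eq:
  assumes "S \<inter> X = {}" "T \<inter> X = {}"
  shows "contract X (S \<union> X, T \<union> X, f) = (S, T, Tr (obj X) (obj S) (obj T) (inv (join T X) \<cdot> f \<cdot> join S X))"
proof -
  have "(S \<union> X) - X = S" "(T \<union> X) - X = T" using assms by auto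
  then show ?thesis by (simp add: contract_def)
qed

lemma net_split:
  assumes "net F" "X \<subseteq> ins F" "X \<subseteq> outs F"
  obtains S T f where "F = (S \<union> X, T \<union> X, f)" "S \<inter> X = {}" "T \<inter> X = {}"
    "finite S" "finite T" "finite X"
    "f \<in> Arr C" "Dom C f = obj (S \<union> X)" "Cod C f = obj (T \<union> X)"
proof
  show "F = ((ins F - X) \<union> X, (outs F - X) \<union> X, arr F)"
    using assms by (auto simp: prod_eq_iff)
qed (use assms net_typing[OF assms(1)] in \<open>auto simp: Un_absorb2 intro: finite_subset\<close>)

text \<open>
  The law for the trace along \<open>X \<otimes> Y\<close>; \<open>join X Y\<close> is conjugated away by \<open>tr_conjugate\<close>.
  As unions commute, contractions along disjoint sets may be exchanged.
\<close>

lemma contract_contract: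
  assumes "net F" "X \<inter> Y = {}" "X \<union> Y \<subseteq> ins F" "X \<union> Y \<subseteq> outs F"
  shows "contract X (contract Y F) = contract (X \<union> Y) F"
proof -
  obtain S T f where F: "F = (S \<union> (X \<union> Y), T \<union> (X \<union> Y), f)" and d: "S \<inter> (X \<union> Y) = {}" "T \<inter> (X \<union> Y) = {}"
    and fin: "finite S" "finite T" "finite (X \<union> Y)"
    and f: "f \<in> Arr C" "Dom C f = obj (S \<union> (X \<union> Y))" "Cod C f = obj (T \<union> (X \<union> Y))"
    using net_split[OF assms(1,3,4)] .
  have [simp]: "S \<inter> X = {}" "S \<inter> Y = {}" "T \<inter> X = {}" "T \<inter> Y = {}" "finite X" "finite Y"
     "(S \<union> X) \<inter> Y = {}" "(T \<union> X) \<inter> Y = {}"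
    using d fin assms(2) by auto
  have f' [simp]: "Dom C f = obj (S \<union> X \<union> Y)" "Cod C f = obj (T \<union> X \<union> Y)"
    using f by (simp_all add: Un_assoc)
  note [simp] = d fin f(1) assms(2)
  let ?k = "inv (join (T \<union> X) Y) \<cdot> f \<cdot> join (S \<union> X) Y"
  let ?K = "inv (join T (X \<union> Y)) \<cdot> f \<cdot> join S (X \<union> Y)"
  let ?j = "join X Y"
  have J: "(inv (join T X) \<odot> \<one> (obj Y)) \<cdot> ?k \<cdot> (join S X \<odot> \<one> (obj Y))
     = inv (\<alpha> (obj T) (obj X) (obj Y)) \<cdot> ((\<one> (obj T) \<odot> inv ?j) \<cdot> ?K \<cdot> (\<one> (obj S) \<odot> ?j)) \<cdot> \<alpha> (obj S) (obj X) (obj Y)"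
  proof -
    have "(inv (join T X) \<odot> \<one> (obj Y)) \<cdot> ?k \<cdot> (join S X \<odot> \<one> (obj Y))
       = ((inv (join T X) \<odot> \<one> (obj Y)) \<cdot> inv (join (T \<union> X) Y)) \<cdot> f \<cdot> (join (S \<union> X) Y \<cdot> (join S X \<odot> \<one> (obj Y)))"
      by (simp add: comp_assoc')
    also have "\<dots> = (inv (\<alpha> (obj T) (obj X) (obj Y)) \<cdot> (\<one> (obj T) \<odot> inv ?j) \<cdot> inv (join T (X \<union> Y)))
       \<cdot> f \<cdot> (join S (X \<union> Y) \<cdot> (\<one> (obj S) \<odot> ?j) \<cdot> \<alpha> (obj S) (obj X) (obj Y))"
      by (simp only: inv_join_assoc join_assoc \<open>finite S\<close> \<open>finite T\<close> \<open>finite X\<close> \<open>finite Y\<close>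
          \<open>S \<inter> X = {}\<close> \<open>S \<inter> Y = {}\<close> \<open>T \<inter> X = {}\<close> \<open>T \<inter> Y = {}\<close> assms(2))
    finally show ?thesis by (simp add: comp_assoc' f(2,3) del: f')
  qed
  have "arr (contract X (contract Y F)) = Tr (obj X) (obj S) (obj T)
     (inv (join T X) \<cdot> Tr (obj Y) (obj (S \<union> X)) (obj (T \<union> X)) ?k \<cdot> join S X)"
    unfolding F Un_assoc[symmetric] by (simp add: contract_eq)
  also have "\<dots> = Tr (obj X) (obj S) (obj T) (Tr (obj Y) (obj S \<otimes> obj X) (obj T \<otimes> obj X)
      ((inv (join T X) \<odot> \<one> (obj Y)) \<cdot> ?k \<cdot> (join S X \<odot> \<one> (obj Y))))"
    using tr_nat[of "obj Y" "join S X" "inv (join T X)" ?k "obj (S \<union> X)" "obj (T \<union> X)"] by simp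
  also have "\<dots> = Tr (obj X \<otimes> obj Y) (obj S) (obj T) ((\<one> (obj T) \<odot> inv ?j) \<cdot> ?K \<cdot> (\<one> (obj S) \<odot> ?j))"
    unfolding J by (rule tr_tensor[symmetric]) (simp_all add: in_Hom_iff f(2,3) del: f')
  also have "\<dots> = Tr (obj (X \<union> Y)) (obj S) (obj T) ?K"
    by (rule tr_conjugate) (simp_all add: f(2,3) del: f')
  also have "\<dots> = arr (contract (X \<union> Y) F)"
    unfolding F by (subst contract_eq) simp_all
  finally show ?thesis by (auto simp: prod_eq_iff)
qed

text \<open>Superposing, after \<open>join_assoc\<close> has moved the contracted wires next to \<open>G\<close>.\<close>

lemma contract_par:
  assumes "net F" "net G" "apart F G" "X \<subseteq> ins G" "X \<subseteq> outs G"
  shows "contract X (F \<parallel> G) = F \<parallel> contract X G"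
proof -
  obtain S' T' g where G: "G = (S' \<union> X, T' \<union> X, g)" and d: "S' \<inter> X = {}" "T' \<inter> X = {}"
    and fin: "finite S'" "finite T'" "finite X"
    and g: "g \<in> Arr C" "Dom C g = obj (S' \<union> X)" "Cod C g = obj (T' \<union> X)"
    using net_split[OF assms(2,4,5)] .
  obtain S T f where F: "F = (S, T, f)" by (cases F)
  have f: "finite S" "finite T" "f \<in> Arr C" "Dom C f = obj S" "Cod C f = obj T"
    using net_typing[OF assms(1)] by (auto simp: F)
  have ds: "S \<inter> S' = {}" "S \<inter> X = {}" "T \<inter> T' = {}" "T \<inter> X = {}"
    using assms(3) by (auto simp: F G apart_def)
  have ds': "S \<inter> (S' \<union> X) = {}" "(S \<union> S') \<inter> X = {}" "T \<inter> (T' \<union> X) = {}" "(T \<union> T') \<inter> X = {}"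
    using ds d by auto
  have diff: "(S \<union> (S' \<union> X)) - X = S \<union> S'" "(T \<union> (T' \<union> X)) - X = T \<union> T'" "(S' \<union> X) - X = S'" "(T' \<union> X) - X = T'"
    using ds d by auto
  note [simp] = d fin g f ds ds'
  let ?K = "inv (join T' X) \<cdot> g \<cdot> join S' X"
  let ?f = "join T (T' \<union> X) \<cdot> (f \<odot> g) \<cdot> inv (join S (S' \<union> X))"
  have S: "inv (join S (S' \<union> X)) \<cdot> join (S \<union> S') X
    = (\<one> (obj S) \<odot> join S' X) \<cdot> \<alpha> (obj S) (obj S') (obj X) \<cdot> (inv (join S S') \<odot> \<one> (obj X))"
  proof -
    have "inv (join S (S' \<union> X)) \<cdot> (join (S \<union> S') X \<cdot> (join S S' \<odot> \<one> (obj X))) \<cdot> (inv (join S S') \<odot> \<one> (obj X))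
       = inv (join S (S' \<union> X)) \<cdot> (join S (S' \<union> X) \<cdot> (\<one> (obj S) \<odot> join S' X) \<cdot> \<alpha> (obj S) (obj S') (obj X)) \<cdot> (inv (join S S') \<odot> \<one> (obj X))"
      by (subst join_assoc) simp_all
    then show ?thesis by (simp add: merge_tensor Un_assoc)
  qed
  have T: "inv (join (T \<union> T') X) \<cdot> join T (T' \<union> X)
    = (join T T' \<odot> \<one> (obj X)) \<cdot> inv (\<alpha> (obj T) (obj T') (obj X)) \<cdot> (\<one> (obj T) \<odot> inv (join T' X))"
  proof -
    have "(join T T' \<odot> \<one> (obj X)) \<cdot> ((inv (join T T') \<odot> \<one> (obj X)) \<cdot> inv (join (T \<union> T') X)) \<cdot> join T (T' \<union> X)
      = (join T T' \<odot> \<one> (obj X)) \<cdot> (inv (\<alpha> (obj T) (obj T') (obj X)) \<cdot> (\<one> (obj T) \<odot> inv (join T' X)) \<cdot> inv (join T (T' \<union> X))) \<cdot> join T (T' \<union> X)"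
      by (subst inv_join_assoc) simp_all
    then show ?thesis by (simp add: merge_tensor Un_assoc)
  qed
  have "arr (contract X (F \<parallel> G)) = Tr (obj X) (obj (S \<union> S')) (obj (T \<union> T'))
     (inv (join (T \<union> T') X) \<cdot> ?f \<cdot> join (S \<union> S') X)"
    unfolding F G by (simp add: par_def Un_assoc[symmetric] contract_eq)
  also have "inv (join (T \<union> T') X) \<cdot> ?f \<cdot> join (S \<union> S') X
     = (inv (join (T \<union> T') X) \<cdot> join T (T' \<union> X)) \<cdot> (f \<odot> g) \<cdot> (inv (join S (S' \<union> X)) \<cdot> join (S \<union> S') X)"
    by (simp add: comp_assoc' Un_assoc)
  also have "\<dots> = (join T T' \<odot> \<one> (obj X)) \<cdot> (inv (\<alpha> (obj T) (obj T') (obj X)) \<cdot> (f \<odot> ?K) \<cdot> \<alpha> (obj S) (obj S') (obj X)) \<cdot> (inv (join S S') \<odot> \<one> (obj X))"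
    unfolding S T by (simp add: merge_tensor)
  also have "Tr (obj X) (obj (S \<union> S')) (obj (T \<union> T')) \<dots>
     = join T T' \<cdot> Tr (obj X) (obj S \<otimes> obj S') (obj T \<otimes> obj T') (inv (\<alpha> (obj T) (obj T') (obj X)) \<cdot> (f \<odot> ?K) \<cdot> \<alpha> (obj S) (obj S') (obj X)) \<cdot> inv (join S S')"
    using tr_nat[of "obj X" "inv (join S S')" "join T T'" "inv (\<alpha> (obj T) (obj T') (obj X)) \<cdot> (f \<odot> ?K) \<cdot> \<alpha> (obj S) (obj S') (obj X)" "obj S \<otimes> obj S'" "obj T \<otimes> obj T'"]
    by simp
  also have "\<dots> = join T T' \<cdot> (f \<odot> Tr (obj X) (obj S') (obj T') ?K) \<cdot> inv (join S S')"
    by (subst tr_superpose) (simp_all add: in_Hom_iff)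
  also have "\<dots> = arr (F \<parallel> contract X G)"
    unfolding F G by (simp add: par_def contract_eq)
  finally show ?thesis by (simp add: prod_eq_iff F G diff)
qed

lemma denotes_trace:
  assumes "denotes (s ** u) (t ** u) f F" "A = tree_obj s" "B = tree_obj t" "U = tree_obj u"
  shows "denotes s t (Tr U A B f) (contract (leaves u) F)"
proof -
  note [simp] = denotesD(1-5)[OF assms(1)] assms(2-4)
  have [simp]: "linear s" "linear t" "linear u" "leaves s \<inter> leaves u = {}" "leaves t \<inter> leaves u = {}"
    using denotesD(1,2)[OF assms(1)] by auto
  let ?X = "leaves u" and ?n = "norm u"
  have eq: "inv (join (leaves t) ?X) \<cdot> arr F \<cdot> join (leaves s) ?X
    = (norm t \<odot> \<one> (obj ?X)) \<cdot> ((\<one> (tree_obj t) \<odot> norm u) \<cdot> f \<cdot> (\<one> (tree_obj s) \<odot> inv (norm u))) \<cdot> (inv (norm s) \<odot> \<one> (obj ?X))"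
    unfolding denotesD(9)[OF assms(1)] by (simp add: iso_comp iso_tensor merge_tensor)
  have "contract ?X F = (leaves s, leaves t, Tr (obj ?X) (obj (leaves s)) (obj (leaves t))
     (inv (join (leaves t) ?X) \<cdot> arr F \<cdot> join (leaves s) ?X))"
    using contract_eq[of "leaves s" ?X "leaves t" "arr F"] denotesD(7,8)[OF assms(1)]
    by (metis leaves.simps(4) prod.collapse \<open>leaves s \<inter> leaves u = {}\<close> \<open>leaves t \<inter> leaves u = {}\<close>)
  also have "Tr (obj ?X) (obj (leaves s)) (obj (leaves t)) (inv (join (leaves t) ?X) \<cdot> arr F \<cdot> join (leaves s) ?X)
     = norm t \<cdot> Tr (obj ?X) (tree_obj s) (tree_obj t) ((\<one> (tree_obj t) \<odot> norm u) \<cdot> f \<cdot> (\<one> (tree_obj s) \<odot> inv (norm u))) \<cdot> inv (norm s)"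
    unfolding eq
    using tr_nat[of "obj ?X" "inv (norm s)" "norm t" "(\<one> (tree_obj t) \<odot> norm u) \<cdot> f \<cdot> (\<one> (tree_obj s) \<odot> inv (norm u))" "tree_obj s" "tree_obj t"]
    by simp
  also have "Tr (obj ?X) (tree_obj s) (tree_obj t) ((\<one> (tree_obj t) \<odot> norm u) \<cdot> f \<cdot> (\<one> (tree_obj s) \<odot> inv (norm u)))
     = Tr (tree_obj u) (tree_obj s) (tree_obj t) f"
    using tr_conjugate[of "tree_obj s" "tree_obj t" "inv (norm u)" f "obj ?X" "tree_obj u"] by simp
  finally show ?thesis by (simp add: denotes_def in_Hom_iff)
qed

text \<open>
  \<open>tr_parallel_is_composite\<close> with the blocks \<open>S\<close>, \<open>P\<close>, \<open>M\<close>, \<open>Q\<close>, \<open>T\<close> as single wires.  Here \<open>P\<close>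
  are the inputs of \<open>G\<close> that bypass \<open>F\<close>, and \<open>Q\<close> the outputs of \<open>F\<close> that bypass \<open>G\<close>.
\<close>

lemma contract_parallel_is_composite:
  assumes [simp]: "net F" "net G" and ins: "ins F = S" "ins G = M \<union> P" and outs: "outs F = Q \<union> M" "outs G = T"
    and d: "S \<inter> P = {}" "S \<inter> M = {}" "M \<inter> P = {}" "Q \<inter> M = {}" "T \<inter> M = {}" "Q \<inter> T = {}" "P \<inter> Q = {}"
  shows "contract M (F \<parallel> G) = (nid Q \<parallel> G) \<circ>\<^sub>n (F \<parallel> nid P)"
proof -
  have fin [simp]: "finite S" "finite M" "finite P" "finite Q" "finite T"
    using net_typing(1,2)[OF assms(1)] net_typing(1,2)[OF assms(2)] ins outs by auto
  have d' [simp]: "Q \<inter> P = {}" "Q \<inter> (M \<union> P) = {}" "Q \<inter> (M \<union> T) = {}" "Q \<inter> (T \<union> M) = {}" "T \<inter> M = {}" "S \<inter> (P \<union> M) = {}" "(Q \<union> M) \<inter> P = {}" "(Q \<union> M) \<inter> T = {}" "S \<inter> (M \<union> P) = {}" "(Q \<union> T) \<inter> M = {}" "M \<inter> T = {}"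
     "(S \<union> P) \<inter> M = {}" "P \<inter> M = {}" "(Q \<union> T) \<inter> M = {}"
    using d by auto
  let ?s = "Block S" and ?p = "Block P" and ?m = "Block M" and ?q = "Block Q" and ?t = "Block T"
  let ?f = "inv (join Q M) \<cdot> arr F" and ?g = "arr G \<cdot> join M P"
  note [simp] = net_typing[OF assms(1), unfolded ins outs] net_typing[OF assms(2), unfolded ins outs] ins outs d
  have F: "denotes ?s (?q ** ?m) ?f F"
    by (rule denotesI) simp_all
  have G: "denotes (?m ** ?p) ?t ?g G"
    by (rule denotesI) (simp_all add: comp_assoc')
  have "denotes (?s ** ?p) (?q ** ?t) ((\<one> (obj Q) \<odot> ?g) \<cdot> \<alpha> (obj Q) (obj M) (obj P) \<cdot> (?f \<odot> \<one> (obj P)))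
     ((nid Q \<parallel> G) \<circ>\<^sub>n (F \<parallel> nid P))"
    apply (rule denotes_eqI)
     apply (rule F G denotes_intros | simp; fail)+
    apply (simp add: nid_par_nid apart_def Un_ac Int_Un_distrib2 Int_Un_distrib)
    done
  moreover have "denotes (?s ** ?p) (?q ** ?t) (Tr (obj M) (obj S \<otimes> obj P) (obj Q \<otimes> obj T)
      (inv (\<alpha> (obj Q) (obj T) (obj M)) \<cdot> (\<one> (obj Q) \<odot> \<sigma> (obj M) (obj T)) \<cdot> \<alpha> (obj Q) (obj M) (obj T) \<cdot> (?f \<odot> ?g)
      \<cdot> (\<one> (obj S) \<odot> \<sigma> (obj P) (obj M)) \<cdot> \<alpha> (obj S) (obj P) (obj M))) (contract M (F \<parallel> G))"
    apply (rule denotes_eqI)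
     apply (rule F G denotes_trace[where u = ?m] denotes_intros | simp; fail)+
    apply (simp add: nid_par_nid apart_def Un_ac Int_Un_distrib2 Int_Un_distrib)
    done
  ultimately show ?thesis
    using tr_parallel_is_composite[of "obj S" "obj P" "obj M" "obj Q" "obj T" ?f ?g] by (simp add: in_Hom_iff denotes_def)
qed

end

section \<open>The loose operations as nets\<close>

fun disjoint_list :: "'a set list \<Rightarrow> bool" where
  "disjoint_list [] \<longleftrightarrow> True"
| "disjoint_list (X # Xs) \<longleftrightarrow> (\<forall>Y \<in> set Xs. X \<inter> Y = {}) \<and> disjoint_list Xs"

context symmetric_monoidal_category
begin

text \<open>The rebracketing by which \<open>flat\<close> acts on domains and, inverted, on codomains.\<close>

definition rot :: "'o \<Rightarrow> 'o \<Rightarrow> 'o \<Rightarrow> 'm" where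
  "rot X Y Z = (\<one> Y \<odot> \<sigma> X Z) \<cdot> \<alpha> Y X Z \<cdot> (\<sigma> X Y \<odot> \<one> Z)"

lemma rot_typing [simp]:
  assumes [simp]: "X \<in> Obj C" "Y \<in> Obj C" "Z \<in> Obj C"
  shows "rot X Y Z \<in> Arr C" "Dom C (rot X Y Z) = (X \<otimes> Y) \<otimes> Z"
    "Cod C (rot X Y Z) = Y \<otimes> (Z \<otimes> X)" "iso_arrow C (rot X Y Z)"
  by (simp_all add: rot_def iso_comp iso_tensor)

lemma rot_nat:
  assumes "f \<in> Hom C X X'" "g \<in> Hom C Y Y'" "h \<in> Hom C Z Z'"
  shows "(g \<odot> (h \<odot> f)) \<cdot> rot X Y Z = rot X' Y' Z' \<cdot> ((f \<odot> g) \<odot> h)"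
proof -
  have [simp]: "X \<in> Obj C" "Y \<in> Obj C" "Z \<in> Obj C" "X' \<in> Obj C" "Y' \<in> Obj C" "Z' \<in> Obj C"
    using assms Hom_Obj by auto
  note [simp] = assms[unfolded in_Hom_iff]
  have "(g \<odot> (h \<odot> f)) \<cdot> rot X Y Z = (g \<odot> ((h \<odot> f) \<cdot> \<sigma> X Z)) \<cdot> \<alpha> Y X Z \<cdot> (\<sigma> X Y \<odot> \<one> Z)"
    by (simp add: rot_def interchange')
  also have "\<dots> = (\<one> Y' \<odot> \<sigma> X' Z') \<cdot> (g \<odot> (f \<odot> h)) \<cdot> \<alpha> Y X Z \<cdot> (\<sigma> X Y \<odot> \<one> Z)"
    by (simp add: interchange' braid_nat)
  also have "\<dots> = (\<one> Y' \<odot> \<sigma> X' Z') \<cdot> \<alpha> Y' X' Z' \<cdot> (((g \<odot> f) \<cdot> \<sigma> X Y) \<odot> h)"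
    by (simp add: assoc_nat' interchange)
  also have "\<dots> = rot X' Y' Z' \<cdot> ((f \<odot> g) \<odot> h)"
    by (simp add: rot_def interchange comp_assoc' flip: braid_nat[of f g X X' Y Y'])
  finally show ?thesis .
qed

lemma swap_right_nat:
  assumes "f \<in> Hom C X X'" "g \<in> Hom C Y Y'" "h \<in> Hom C Z Z'"
  shows "((f \<odot> h) \<odot> g) \<cdot> swap_right C X Y Z = swap_right C X' Y' Z' \<cdot> ((f \<odot> g) \<odot> h)"
proof -
  have [simp]: "X \<in> Obj C" "Y \<in> Obj C" "Z \<in> Obj C" "X' \<in> Obj C" "Y' \<in> Obj C" "Z' \<in> Obj C"
    using assms Hom_Obj by auto
  note [simp] = assms[unfolded in_Hom_iff]
  have "((f \<odot> h) \<odot> g) \<cdot> swap_right C X Y Z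
      = (((f \<odot> h) \<odot> g) \<cdot> inv (\<alpha> X Z Y)) \<cdot> (\<one> X \<odot> \<sigma> Y Z) \<cdot> \<alpha> X Y Z"
    by (simp add: swap_right_def comp_assoc')
  also have "\<dots> = inv (\<alpha> X' Z' Y') \<cdot> (f \<odot> ((h \<odot> g) \<cdot> \<sigma> Y Z)) \<cdot> \<alpha> X Y Z"
    by (simp add: assoc_inv_nat comp_assoc' interchange')
  also have "\<dots> = inv (\<alpha> X' Z' Y') \<cdot> (\<one> X' \<odot> \<sigma> Y' Z') \<cdot> (f \<odot> (g \<odot> h)) \<cdot> \<alpha> X Y Z"
    by (simp add: braid_nat interchange')
  also have "\<dots> = swap_right C X' Y' Z' \<cdot> ((f \<odot> g) \<odot> h)"
    by (simp add: swap_right_def assoc_nat comp_assoc')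
  finally show ?thesis .
qed

lemma mid_four_nat:
  assumes "e \<in> Hom C W W'" "f \<in> Hom C X X'" "g \<in> Hom C Y Y'" "h \<in> Hom C Z Z'"
  shows "((e \<odot> g) \<odot> (f \<odot> h)) \<cdot> mid_four C W X Y Z = mid_four C W' X' Y' Z' \<cdot> ((e \<odot> f) \<odot> (g \<odot> h))"
proof -
  have [simp]: "W \<in> Obj C" "X \<in> Obj C" "Y \<in> Obj C" "Z \<in> Obj C" "W' \<in> Obj C" "X' \<in> Obj C" "Y' \<in> Obj C" "Z' \<in> Obj C"
    using assms Hom_Obj by auto
  note [simp] = assms[unfolded in_Hom_iff]
  have "((e \<odot> g) \<odot> (f \<odot> h)) \<cdot> mid_four C W X Y Z
      = \<alpha> (W' \<otimes> Y') X' Z' \<cdot> ((((e \<odot> g) \<odot> f) \<cdot> swap_right C W X Y) \<odot> h) \<cdot> inv (\<alpha> (W \<otimes> X) Y Z)"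
    by (simp add: mid_four_def assoc_nat' interchange')
  also have "\<dots> = \<alpha> (W' \<otimes> Y') X' Z' \<cdot> (swap_right C W' X' Y' \<odot> \<one> Z') \<cdot> (((e \<odot> f) \<odot> g) \<odot> h) \<cdot> inv (\<alpha> (W \<otimes> X) Y Z)"
    using assms by (simp add: swap_right_nat interchange')
  also have "\<dots> = mid_four C W' X' Y' Z' \<cdot> ((e \<odot> f) \<odot> (g \<odot> h))"
    by (simp add: mid_four_def assoc_inv_nat comp_assoc')
  finally show ?thesis .
qed

end

context wires
begin

text \<open>The loose identity on the unit object denotes the empty net; this removes it from a tensor.\<close>

lemma nid_empty_par: "net F \<Longrightarrow> nid {} \<parallel> F = F"
proof -
  assume [simp]: "net F"
  have "lunit C (obj (outs F)) \<cdot> (\<one> \<I> \<odot> arr F) \<cdot> inv (lunit C (obj (ins F)))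
     = (lunit C (obj (outs F)) \<cdot> (\<one> \<I> \<odot> arr F)) \<cdot> inv (lunit C (obj (ins F)))"
    by (simp add: comp_assoc')
  also have "\<dots> = (arr F \<cdot> lunit C (obj (ins F))) \<cdot> inv (lunit C (obj (ins F)))"
    by (subst lunit_natural) (auto simp: in_Hom_iff)
  also have "\<dots> = arr F" by (simp add: comp_assoc')
  finally show "nid {} \<parallel> F = F"
    by (simp add: prod_eq_iff) (simp add: par_def join_empty obj_empty)
qed

lemma denotes_rot:
  assumes "linear ((x ** y) ** z)" "X = tree_obj x" "Y = tree_obj y" "Z = tree_obj z"
  shows "denotes ((x ** y) ** z) (y ** (z ** x)) (rot X Y Z) (nid (leaves x \<union> leaves y \<union> leaves z))"
  unfolding rot_def
  apply (rule denotes_eqI)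
   apply (rule denotes_intros | use assms in \<open>simp; fail\<close> | use assms in \<open>auto; fail\<close>)+
  using assms by (simp add: nid_par_nid Un_ac Int_Un_distrib Int_Un_distrib2 Int_commute)

lemma denotes_rot_inv:
  assumes "linear ((x ** y) ** z)" "X = tree_obj x" "Y = tree_obj y" "Z = tree_obj z"
  shows "denotes (y ** (z ** x)) ((x ** y) ** z) (inv (rot X Y Z)) (nid (leaves x \<union> leaves y \<union> leaves z))"
  by (rule denotes_nid_inv[OF denotes_rot]) (use assms in auto)

end

context traced_category
begin

text \<open>
  The arrow that the composite of two loose maps traces; it is named so that naturality and
  the trace can be treated separately.
\<close>

definition lcomp_body :: "'o \<times> 'o \<Rightarrow> 'o \<times> 'o \<Rightarrow> 'o \<times> 'o \<Rightarrow> 'm \<Rightarrow> 'm \<Rightarrow> 'm" where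
  "lcomp_body A B E g f =
      swap_right C (E\<^sup>+) (B\<^sup>-) (A\<^sup>-)
       \<cdot> (g \<odot> \<one> (A\<^sup>-))
       \<cdot> inv (\<alpha> (E\<^sup>-) (B\<^sup>+) (A\<^sup>-))
       \<cdot> (\<one> (E\<^sup>-) \<odot> f)
       \<cdot> \<alpha> (E\<^sup>-) (B\<^sup>-) (A\<^sup>+)
       \<cdot> swap_right C (E\<^sup>-) (A\<^sup>+) (B\<^sup>-)"

definition lcomp_arr :: "'o \<times> 'o \<Rightarrow> 'o \<times> 'o \<Rightarrow> 'o \<times> 'o \<Rightarrow> 'm \<Rightarrow> 'm \<Rightarrow> 'm" where
  "lcomp_arr A B E g f = Tr (B\<^sup>-) (E\<^sup>- \<otimes> A\<^sup>+) (E\<^sup>+ \<otimes> A\<^sup>-) (lcomp_body A B E g f)"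

definition ltensor_arr :: "'o \<times> 'o \<Rightarrow> 'o \<times> 'o \<Rightarrow> 'o \<times> 'o \<Rightarrow> 'o \<times> 'o \<Rightarrow> 'm \<Rightarrow> 'm \<Rightarrow> 'm" where
  "ltensor_arr A B A' B' f f' = mid_four C (B\<^sup>+) (A\<^sup>-) (B'\<^sup>+) (A'\<^sup>-)
       \<cdot> (f \<odot> f') \<cdot> mid_four C (B\<^sup>-) (B'\<^sup>-) (A\<^sup>+) (A'\<^sup>+)"

definition dual_arr :: "'o \<times> 'o \<Rightarrow> 'o \<times> 'o \<Rightarrow> 'm \<Rightarrow> 'm" where
  "dual_arr A B f = \<sigma> (B\<^sup>+) (A\<^sup>-) \<cdot> f \<cdot> \<sigma> (A\<^sup>+) (B\<^sup>-)"

definition flat_arr :: "'o \<times> 'o \<Rightarrow> 'o \<times> 'o \<Rightarrow> 'o \<times> 'o \<Rightarrow> 'm \<Rightarrow> 'm" where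
  "flat_arr A B K f = inv (rot (B\<^sup>-) (K\<^sup>+) (A\<^sup>-)) \<cdot> f \<cdot> rot (B\<^sup>+) (K\<^sup>-) (A\<^sup>+)"

lemma int_lcomp_eq: "int_lcomp C (B', E, g) (A, B, f) = (A, E, lcomp_arr A B E g f)"
  by (simp add: lcomp_arr_def lcomp_body_def)

lemma int_ltensor_eq: "int_ltensor C (A, B, f) (A', B', f') =
   ((A\<^sup>- \<otimes> A'\<^sup>-, A\<^sup>+ \<otimes> A'\<^sup>+), (B\<^sup>- \<otimes> B'\<^sup>-, B\<^sup>+ \<otimes> B'\<^sup>+), ltensor_arr A B A' B' f f')"
  by (simp add: ltensor_arr_def)

abbreviation IObj :: "('o \<times> 'o) set" where "IObj \<equiv> Obj C \<times> Obj C"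

text \<open>
  The arrows of \<open>U\<close> that are loose maps from \<open>A\<close> to \<open>B\<close>, without the boundary that a loose
  map carries along.
\<close>

definition LooseArr :: "'o \<times> 'o \<Rightarrow> 'o \<times> 'o \<Rightarrow> 'm set" where
  "LooseArr A B = (if A \<in> IObj \<and> B \<in> IObj then Hom C (B\<^sup>- \<otimes> A\<^sup>+) (B\<^sup>+ \<otimes> A\<^sup>-) else {})"

lemma LooseArrD:
  assumes "f \<in> LooseArr A B"
  shows "A\<^sup>- \<in> Obj C" "A\<^sup>+ \<in> Obj C" "B\<^sup>- \<in> Obj C" "B\<^sup>+ \<in> Obj C"
    "f \<in> Arr C" "Dom C f = B\<^sup>- \<otimes> A\<^sup>+" "Cod C f = B\<^sup>+ \<otimes> A\<^sup>-"
  using assms by (auto simp: LooseArr_def in_Hom_iff split: if_splits)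

lemma lcomp_body_typing:
  assumes "f \<in> LooseArr A B" "g \<in> LooseArr B E"
  shows "lcomp_body A B E g f \<in> Hom C ((E\<^sup>- \<otimes> A\<^sup>+) \<otimes> B\<^sup>-) ((E\<^sup>+ \<otimes> A\<^sup>-) \<otimes> B\<^sup>-)"
  using LooseArrD[OF assms(1)] LooseArrD[OF assms(2)] by (simp add: lcomp_body_def in_Hom_iff)

lemma LooseArrI:
  assumes "A\<^sup>- \<in> Obj C" "A\<^sup>+ \<in> Obj C" "B\<^sup>- \<in> Obj C" "B\<^sup>+ \<in> Obj C"
    "f \<in> Arr C" "Dom C f = B\<^sup>- \<otimes> A\<^sup>+" "Cod C f = B\<^sup>+ \<otimes> A\<^sup>-"
  shows "f \<in> LooseArr A B"
  using assms by (simp add: LooseArr_def in_Hom_iff mem_Times_iff)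

lemma lcomp_arr_LooseArr:
  assumes f: "f \<in> LooseArr A B" and g: "g \<in> LooseArr B E"
  shows "lcomp_arr A B E g f \<in> LooseArr A E"
proof -
  note [simp] = LooseArrD[OF f] LooseArrD[OF g] lcomp_body_typing[OF f g, unfolded in_Hom_iff]
  show ?thesis by (rule LooseArrI) (simp_all add: lcomp_arr_def)
qed

lemma ltensor_arr_LooseArr:
  assumes f: "f \<in> LooseArr A B" and f': "f' \<in> LooseArr A' B'"
  shows "ltensor_arr A B A' B' f f' \<in> LooseArr (A\<^sup>- \<otimes> A'\<^sup>-, A\<^sup>+ \<otimes> A'\<^sup>+) (B\<^sup>- \<otimes> B'\<^sup>-, B\<^sup>+ \<otimes> B'\<^sup>+)"
proof -
  note [simp] = LooseArrD[OF f] LooseArrD[OF f']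
  show ?thesis by (rule LooseArrI) (simp_all add: ltensor_arr_def)
qed

lemma dual_arr_LooseArr:
  assumes f: "f \<in> LooseArr A B"
  shows "dual_arr A B f \<in> LooseArr (B\<^sup>+, B\<^sup>-) (A\<^sup>+, A\<^sup>-)"
proof -
  note [simp] = LooseArrD[OF f]
  show ?thesis by (rule LooseArrI) (simp_all add: dual_arr_def)
qed

lemma flat_arr_LooseArr:
  assumes "A \<in> IObj" "B \<in> IObj" and f: "f \<in> LooseArr (A\<^sup>- \<otimes> B\<^sup>-, A\<^sup>+ \<otimes> B\<^sup>+) K"
  shows "flat_arr A B K f \<in> LooseArr A (B\<^sup>+ \<otimes> K\<^sup>-, B\<^sup>- \<otimes> K\<^sup>+)"
proof -
  note [simp] = LooseArrD[OF f, simplified] assms(1,2)[unfolded mem_Times_iff]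
  show ?thesis by (rule LooseArrI) (simp_all add: flat_arr_def)
qed

end

context traced_wires
begin

text \<open>
  By definition the composite connects \<open>B\<^sup>+\<close> by composition and \<open>B\<^sup>-\<close> by the trace.
  \<open>contract_parallel_is_composite\<close> turns the first connection into a contraction too, and the two
  contractions merge into one.  Objects are given by trees, so that the lemma also applies to loose
  maps between tensor products.
\<close>

lemma denotes_lcomp:
  assumes F: "denotes (bn ** ap) (bp ** an) f F" and G: "denotes (en ** bp) (ep ** bn) g G"
    and d: "disjoint_list [leaves an, leaves ap, leaves bn, leaves bp, leaves en, leaves ep]"
    and A: "A = (tree_obj an, tree_obj ap)" "B = (tree_obj bn, tree_obj bp)" "E = (tree_obj en, tree_obj ep)"
    and X: "X = leaves bn \<union> leaves bp"
  shows "denotes (en ** ap) (ep ** an) (lcomp_arr A B E g f) (contract X (F \<parallel> G))"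
proof -
  have lin [simp]: "linear an" "linear ap" "linear bn" "linear bp" "linear en" "linear ep"
    using denotesD(1,2)[OF F] denotesD(1,2)[OF G] by auto
  have d' [simp]:
    "leaves an \<inter> leaves ap = {}" "leaves an \<inter> leaves bn = {}" "leaves an \<inter> leaves bp = {}"
    "leaves an \<inter> leaves en = {}" "leaves an \<inter> leaves ep = {}" "leaves ap \<inter> leaves an = {}"
    "leaves ap \<inter> leaves bn = {}" "leaves ap \<inter> leaves bp = {}" "leaves ap \<inter> leaves en = {}"
    "leaves ap \<inter> leaves ep = {}" "leaves bn \<inter> leaves an = {}" "leaves bn \<inter> leaves ap = {}"
    "leaves bn \<inter> leaves bp = {}" "leaves bn \<inter> leaves en = {}" "leaves bn \<inter> leaves ep = {}"
    "leaves bp \<inter> leaves an = {}" "leaves bp \<inter> leaves ap = {}" "leaves bp \<inter> leaves bn = {}"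
    "leaves bp \<inter> leaves en = {}" "leaves bp \<inter> leaves ep = {}" "leaves en \<inter> leaves an = {}"
    "leaves en \<inter> leaves ap = {}" "leaves en \<inter> leaves bn = {}" "leaves en \<inter> leaves bp = {}"
    "leaves en \<inter> leaves ep = {}" "leaves ep \<inter> leaves an = {}" "leaves ep \<inter> leaves ap = {}"
    "leaves ep \<inter> leaves bn = {}" "leaves ep \<inter> leaves bp = {}" "leaves ep \<inter> leaves en = {}"
    using d by auto
  note [simp] = denotesD(6-8)[OF F] denotesD(6-8)[OF G] Int_Un_distrib Int_Un_distrib2
  have "denotes (en ** ap) (ep ** an) (lcomp_arr A B E g f)
     (contract (leaves bn) ((G \<parallel> nid (leaves an)) \<circ>\<^sub>n (nid (leaves en) \<parallel> F)))"
    unfolding lcomp_arr_def lcomp_body_def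
    apply (rule denotes_eqI)
     apply (rule F G denotes_trace[where u = bn] denotes_swap_right denotes_intros | simp add: A; fail)+
    apply (simp add: nid_par_nid apart_def Un_ac)
    done
  also have "G \<parallel> nid (leaves an) = nid (leaves an) \<parallel> G"
    by (rule par_comm) (auto simp: apart_def)
  also have "nid (leaves en) \<parallel> F = F \<parallel> nid (leaves en)"
    by (rule par_comm) (auto simp: apart_def)
  also have "(nid (leaves an) \<parallel> G) \<circ>\<^sub>n (F \<parallel> nid (leaves en)) = contract (leaves bp) (F \<parallel> G)"
    by (rule contract_parallel_is_composite[symmetric, where S = "leaves bn \<union> leaves ap" and T = "leaves ep \<union> leaves bn"]) auto
  also have "contract (leaves bn) (contract (leaves bp) (F \<parallel> G)) = contract X (F \<parallel> G)"
    unfolding X by (rule contract_contract) (auto simp: apart_def)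
  finally show ?thesis .
qed

lemma denotes_ltensor:
  assumes F: "denotes (bn ** ap) (bp ** an) f F" and F': "denotes (bn' ** ap') (bp' ** an') f' F'"
    and d: "apart F F'"
    and A: "A = (tree_obj an, tree_obj ap)" "B = (tree_obj bn, tree_obj bp)" "A' = (tree_obj an', tree_obj ap')" "B' = (tree_obj bn', tree_obj bp')"
  shows "denotes ((bn ** bn') ** (ap ** ap')) ((bp ** bp') ** (an ** an'))
     (ltensor_arr A B A' B' f f') (F \<parallel> F')"
proof -
  have lin: "linear (bn ** ap)" "linear (bp ** an)" "linear (bn' ** ap')" "linear (bp' ** an')"
    using denotesD(1,2)[OF F] denotesD(1,2)[OF F'] by auto
  have [simp]: "net F" "net F'" "apart F F'" "ins F = leaves bn \<union> leaves ap" "outs F = leaves bp \<union> leaves an"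
     "ins F' = leaves bn' \<union> leaves ap'" "outs F' = leaves bp' \<union> leaves an'"
    using denotesD(6-8)[OF F] denotesD(6-8)[OF F'] d by auto
  have d': "(leaves bn \<union> leaves ap) \<inter> (leaves bn' \<union> leaves ap') = {}" "(leaves bp \<union> leaves an) \<inter> (leaves bp' \<union> leaves an') = {}"
    using d by (auto simp: apart_def)
  show ?thesis
    unfolding ltensor_arr_def
    apply (rule denotes_eqI)
     apply (rule F F' denotes_mid_four denotes_intros | use lin d' A in \<open>simp; fail\<close> | use lin d' A in \<open>auto; fail\<close>)+
    apply (simp add: Un_ac)
    done
qed

lemma denotes_dual:
  assumes F: "denotes (bn ** ap) (bp ** an) f F" and A: "A = (tree_obj an, tree_obj ap)" "B = (tree_obj bn, tree_obj bp)"
  shows "denotes (ap ** bn) (an ** bp) (dual_arr A B f) F"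
proof -
  note [simp] = denotesD(6-8)[OF F]
  show ?thesis
  unfolding dual_arr_def
  apply (rule denotes_eqI)
   apply (rule F denotes_intros | use A denotesD(1,2)[OF F] in \<open>simp; fail\<close> | use denotesD(1,2)[OF F] in \<open>auto; fail\<close>)+
  apply (simp add: Un_commute)
  done
qed

lemma denotes_flat:
  assumes F: "denotes (kn ** (ap ** bp)) (kp ** (an ** bn)) f F"
    and A: "A = (tree_obj an, tree_obj ap)" "B = (tree_obj bn, tree_obj bp)" "K = (tree_obj kn, tree_obj kp)"
  shows "denotes ((bp ** kn) ** ap) ((bn ** kp) ** an) (flat_arr A B K f) F"
proof -
  note [simp] = denotesD(6-8)[OF F]
  show ?thesis
  unfolding flat_arr_def
  apply (rule denotes_eqI)
   apply (rule F denotes_rot denotes_rot_inv denotes_intros | use A denotesD(1,2)[OF F] in \<open>simp; fail\<close> | use denotesD(1,2)[OF F] in \<open>auto; fail\<close>)+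
  apply (simp add: Un_ac)
  done
qed

end

context traced_wires
begin

lemma contract_par_left:
  assumes [simp]: "net F" "net G" and d: "apart F G" "X \<subseteq> ins F" "X \<subseteq> outs F"
  shows "contract X F \<parallel> G = contract X (F \<parallel> G)"
proof -
  have [simp]: "apart G F" "apart G (contract X F)" using d by (auto simp: apart_def)
  have "contract X F \<parallel> G = G \<parallel> contract X F" by (rule par_comm) (use d in auto)
  also have "\<dots> = contract X (G \<parallel> F)" by (rule contract_par[symmetric]) (use d in auto)
  also have "G \<parallel> F = F \<parallel> G" by (rule par_comm) (use d in auto)
  finally show ?thesis .
qed

text \<open>Both sides contract \<open>F \<parallel> G \<parallel> H\<close> along \<open>X \<union> Y\<close>.\<close>

lemma contract_par_assoc:
  assumes [simp]: "net F" "net G" "net H" and d: "apart F G" "apart F H" "apart G H" "X \<inter> Y = {}"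
    and X: "X \<subseteq> ins (F \<parallel> G)" "X \<subseteq> outs (F \<parallel> G)" and Y: "Y \<subseteq> ins (G \<parallel> H)" "Y \<subseteq> outs (G \<parallel> H)"
  shows "contract Y (contract X (F \<parallel> G) \<parallel> H) = contract X (F \<parallel> contract Y (G \<parallel> H))"
proof -
  have ap [simp]: "apart (F \<parallel> G) H" "apart F (G \<parallel> H)"
    using d by (auto simp: apart_def)
  have "contract Y (contract X (F \<parallel> G) \<parallel> H) = contract Y (contract X ((F \<parallel> G) \<parallel> H))"
    by (subst contract_par_left) (use d X in auto)
  also have "\<dots> = contract (X \<union> Y) (F \<parallel> (G \<parallel> H))"
    by (subst contract_contract) (use d X Y in \<open>auto simp: par_assoc Un_commute\<close>)
  also have "\<dots> = contract X (contract Y (F \<parallel> (G \<parallel> H)))"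
    by (rule contract_contract[symmetric]) (use d X Y in auto)
  also have "contract Y (F \<parallel> (G \<parallel> H)) = F \<parallel> contract Y (G \<parallel> H)"
    by (rule contract_par) (use d X Y in auto)
  finally show ?thesis .
qed

end

context traced_category
begin

lemma traced_wires_valuation: "set Xs \<subseteq> Obj C \<Longrightarrow> traced_wires C (valuation Xs)"
  by unfold_locales (auto simp: valuation_def subset_iff)

abbreviation itens :: "'o \<times> 'o \<Rightarrow> 'o \<times> 'o \<Rightarrow> 'o \<times> 'o" (infixr "\<otimes>\<^sub>i" 70) where
  "A \<otimes>\<^sub>i B \<equiv> (A\<^sup>- \<otimes> B\<^sup>-, A\<^sup>+ \<otimes> B\<^sup>+)"

abbreviation idual :: "'o \<times> 'o \<Rightarrow> 'o \<times> 'o" where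
  "idual A \<equiv> (A\<^sup>+, A\<^sup>-)"

text \<open>
  Here and below the pattern is the same: each loose map is a box with named wires, both sides
  are computed as nets, and the nets agree by the laws for \<open>\<parallel>\<close> and contraction.  Even names stand
  for negative, odd names for positive components.
\<close>

lemma lcomp_arr_assoc:
  assumes f: "f \<in> LooseArr A B" and g: "g \<in> LooseArr B E" and h: "h \<in> LooseArr E G"
  shows "lcomp_arr A B G (lcomp_arr B E G h g) f = lcomp_arr A E G h (lcomp_arr A B E g f)"
proof -
  let ?v = "[A\<^sup>-, A\<^sup>+, B\<^sup>-, B\<^sup>+, E\<^sup>-, E\<^sup>+, G\<^sup>-, G\<^sup>+]"
  note [simp] = LooseArrD[OF f] LooseArrD[OF g] LooseArrD[OF h]
  interpret W: traced_wires C "valuation ?v"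
    by (rule traced_wires_valuation) simp
  obtain F where F: "W.denotes ($2 ** $1) ($3 ** $0) f F"
    by (atomize_elim, rule W.denotes_exists) (simp_all add: in_Hom_iff)
  obtain G' where G: "W.denotes ($4 ** $3) ($5 ** $2) g G'"
    by (atomize_elim, rule W.denotes_exists) (simp_all add: in_Hom_iff)
  obtain H where H: "W.denotes ($6 ** $5) ($7 ** $4) h H"
    by (atomize_elim, rule W.denotes_exists) (simp_all add: in_Hom_iff)
  note [simp] = W.denotesD(6-8)[OF F] W.denotesD(6-8)[OF G] W.denotesD(6-8)[OF H]
  have "W.denotes ($6 ** $1) ($7 ** $0) (lcomp_arr A B G (lcomp_arr B E G h g) f)
     (W.contract {2, 3} (W.par F (W.contract {4, 5} (W.par G' H))))"
    by (rule W.denotes_lcomp[OF F W.denotes_lcomp[OF G H]]) (auto simp: prod_eq_iff)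
  moreover have "W.denotes ($6 ** $1) ($7 ** $0) (lcomp_arr A E G h (lcomp_arr A B E g f))
     (W.contract {4, 5} (W.par (W.contract {2, 3} (W.par F G')) H))"
    by (rule W.denotes_lcomp[OF W.denotes_lcomp[OF F G] H]) (auto simp: prod_eq_iff)
  moreover have "W.contract {4, 5} (W.par (W.contract {2, 3} (W.par F G')) H) = W.contract {2, 3} (W.par F (W.contract {4, 5} (W.par G' H)))"
    by (rule W.contract_par_assoc) (auto simp: apart_def)
  ultimately show ?thesis using W.denotes_unique by metis
qed

lemma ltensor_arr_lcomp:
  assumes f: "f \<in> LooseArr A B" and g: "g \<in> LooseArr B E" and f': "f' \<in> LooseArr A' B'" and g': "g' \<in> LooseArr B' E'"
  shows "lcomp_arr (A \<otimes>\<^sub>i A') (B \<otimes>\<^sub>i B') (E \<otimes>\<^sub>i E') (ltensor_arr B E B' E' g g') (ltensor_arr A B A' B' f f')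
    = ltensor_arr A E A' E' (lcomp_arr A B E g f) (lcomp_arr A' B' E' g' f')"
proof -
  let ?v = "[A\<^sup>-, A\<^sup>+, B\<^sup>-, B\<^sup>+, E\<^sup>-, E\<^sup>+, A'\<^sup>-, A'\<^sup>+, B'\<^sup>-, B'\<^sup>+, E'\<^sup>-, E'\<^sup>+]"
  note [simp] = LooseArrD[OF f] LooseArrD[OF g] LooseArrD[OF f'] LooseArrD[OF g']
  interpret W: traced_wires C "valuation ?v"
    by (rule traced_wires_valuation) simp
  obtain F where F: "W.denotes ($2 ** $1) ($3 ** $0) f F"
    by (atomize_elim, rule W.denotes_exists) (simp_all add: in_Hom_iff)
  obtain G where G: "W.denotes ($4 ** $3) ($5 ** $2) g G"
    by (atomize_elim, rule W.denotes_exists) (simp_all add: in_Hom_iff)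
  obtain F' where F': "W.denotes ($8 ** $7) ($9 ** $6) f' F'"
    by (atomize_elim, rule W.denotes_exists) (simp_all add: in_Hom_iff)
  obtain G' where G': "W.denotes ($10 ** $9) ($11 ** $8) g' G'"
    by (atomize_elim, rule W.denotes_exists) (simp_all add: in_Hom_iff)
  note [simp] = W.denotesD(6-8)[OF F] W.denotesD(6-8)[OF G] W.denotesD(6-8)[OF F'] W.denotesD(6-8)[OF G']
  have "W.denotes (($4 ** $10) ** ($1 ** $7)) (($5 ** $11) ** ($0 ** $6))
     (lcomp_arr (A \<otimes>\<^sub>i A') (B \<otimes>\<^sub>i B') (E \<otimes>\<^sub>i E') (ltensor_arr B E B' E' g g') (ltensor_arr A B A' B' f f'))
     (W.contract {2, 8, 3, 9} (W.par (W.par F F') (W.par G G')))"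
    by (rule W.denotes_lcomp[OF W.denotes_ltensor[OF F F'] W.denotes_ltensor[OF G G']]) (auto simp: prod_eq_iff apart_def)
  moreover have "W.denotes (($4 ** $10) ** ($1 ** $7)) (($5 ** $11) ** ($0 ** $6))
     (ltensor_arr A E A' E' (lcomp_arr A B E g f) (lcomp_arr A' B' E' g' f'))
     (W.par (W.contract {2, 3} (W.par F G)) (W.contract {8, 9} (W.par F' G')))"
    by (rule W.denotes_ltensor[OF W.denotes_lcomp[OF F G] W.denotes_lcomp[OF F' G']]) (auto simp: prod_eq_iff apart_def)
  moreover have "W.contract {2, 8, 3, 9} (W.par (W.par F F') (W.par G G'))
     = W.par (W.contract {2, 3} (W.par F G)) (W.contract {8, 9} (W.par F' G'))"
  proof -
    have "W.par (W.par F F') (W.par G G') = W.par F (W.par F' (W.par G G'))"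
      by (rule W.par_assoc) (auto simp: apart_def)
    also have "W.par F' (W.par G G') = W.par G (W.par F' G')"
      by (rule W.par_left_comm) (auto simp: apart_def)
    also have "W.par F (W.par G (W.par F' G')) = W.par (W.par F G) (W.par F' G')"
      by (rule W.par_assoc[symmetric]) (auto simp: apart_def)
    finally have "W.contract {2, 8, 3, 9} (W.par (W.par F F') (W.par G G')) = W.contract ({2, 3} \<union> {8, 9}) (W.par (W.par F G) (W.par F' G'))"
      by (simp add: insert_commute)
    also have "\<dots> = W.contract {2, 3} (W.contract {8, 9} (W.par (W.par F G) (W.par F' G')))"
      by (rule W.contract_contract[symmetric]) (auto simp: apart_def)
    also have "W.contract {8, 9} (W.par (W.par F G) (W.par F' G')) = W.par (W.par F G) (W.contract {8, 9} (W.par F' G'))"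
      by (rule W.contract_par) (auto simp: apart_def)
    also have "W.contract {2, 3} (W.par (W.par F G) (W.contract {8, 9} (W.par F' G'))) = W.par (W.contract {2, 3} (W.par F G)) (W.contract {8, 9} (W.par F' G'))"
      by (rule W.contract_par_left[symmetric]) (auto simp: apart_def)
    finally show ?thesis .
  qed
  ultimately show ?thesis using W.denotes_unique by metis
qed

text \<open>
  Both sides contract the same two boxes along \<open>B\<^sup>-\<close> and \<open>B\<^sup>+\<close>, which have merely
  exchanged their roles.  In terms of traces this is the sliding of \<open>f\<close> around the loop.
\<close>

lemma dual_arr_lcomp:
  assumes f: "f \<in> LooseArr A B" and g: "g \<in> LooseArr B E"
  shows "dual_arr A E (lcomp_arr A B E g f)
    = lcomp_arr (idual E) (idual B) (idual A) (dual_arr A B f) (dual_arr B E g)"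
proof -
  let ?v = "[A\<^sup>-, A\<^sup>+, B\<^sup>-, B\<^sup>+, E\<^sup>-, E\<^sup>+]"
  note [simp] = LooseArrD[OF f] LooseArrD[OF g]
  interpret W: traced_wires C "valuation ?v"
    by (rule traced_wires_valuation) simp
  obtain F where F: "W.denotes ($2 ** $1) ($3 ** $0) f F"
    by (atomize_elim, rule W.denotes_exists) (simp_all add: in_Hom_iff)
  obtain G where G: "W.denotes ($4 ** $3) ($5 ** $2) g G"
    by (atomize_elim, rule W.denotes_exists) (simp_all add: in_Hom_iff)
  note [simp] = W.denotesD(6-8)[OF F] W.denotesD(6-8)[OF G]
  have "W.denotes ($1 ** $4) ($0 ** $5) (dual_arr A E (lcomp_arr A B E g f))
     (W.contract {2, 3} (W.par F G))"
    by (rule W.denotes_dual[OF W.denotes_lcomp[OF F G]]) (auto simp: prod_eq_iff)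
  moreover have "W.denotes ($1 ** $4) ($0 ** $5)
      (lcomp_arr (idual E) (idual B) (idual A) (dual_arr A B f) (dual_arr B E g)) (W.contract {2, 3} (W.par G F))"
    by (rule W.denotes_lcomp[OF W.denotes_dual[OF G] W.denotes_dual[OF F]]) (auto simp: prod_eq_iff)
  moreover have "W.par G F = W.par F G"
    by (rule W.par_comm) (auto simp: apart_def)
  ultimately show ?thesis using W.denotes_unique by metis
qed

text \<open>
  Both sides contract the boxes of \<open>a\<close>, \<open>b\<close>, \<open>c\<close>, \<open>f\<close> along all wires of \<open>A\<close>, \<open>B\<close> and \<open>K\<close>; they
  differ in the order in which the boxes are attached.
\<close>

lemma flat_arr_natural:
  assumes a: "a \<in> LooseArr A' A" and b: "b \<in> LooseArr B' B" and c: "c \<in> LooseArr K K'" and f: "f \<in> LooseArr (A \<otimes>\<^sub>i B) K"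
  shows "lcomp_arr A' (idual B \<otimes>\<^sub>i K) (idual B' \<otimes>\<^sub>i K')
       (ltensor_arr (idual B) (idual B') K K' (dual_arr B' B b) c)
       (lcomp_arr A' A (idual B \<otimes>\<^sub>i K) (flat_arr A B K f) a)
    = flat_arr A' B' K' (lcomp_arr (A' \<otimes>\<^sub>i B') K K' c
        (lcomp_arr (A' \<otimes>\<^sub>i B') (A \<otimes>\<^sub>i B) K f (ltensor_arr A' A B' B a b)))"
proof -
  let ?v = "[A\<^sup>-, A\<^sup>+, A'\<^sup>-, A'\<^sup>+, B\<^sup>-, B\<^sup>+, B'\<^sup>-, B'\<^sup>+, K\<^sup>-, K\<^sup>+, K'\<^sup>-, K'\<^sup>+]"
  note [simp] = LooseArrD[OF a] LooseArrD[OF b] LooseArrD[OF c] LooseArrD[OF f, simplified]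
  interpret W: traced_wires C "valuation ?v"
    by (rule traced_wires_valuation) simp
  obtain NA where NA: "W.denotes ($0 ** $3) ($1 ** $2) a NA"
    by (atomize_elim, rule W.denotes_exists) (simp_all add: in_Hom_iff)
  obtain NB where NB: "W.denotes ($4 ** $7) ($5 ** $6) b NB"
    by (atomize_elim, rule W.denotes_exists) (simp_all add: in_Hom_iff)
  obtain NC where NC: "W.denotes ($10 ** $9) ($11 ** $8) c NC"
    by (atomize_elim, rule W.denotes_exists) (simp_all add: in_Hom_iff)
  obtain F where F: "W.denotes ($8 ** ($1 ** $5)) ($9 ** ($0 ** $4)) f F"
    by (atomize_elim, rule W.denotes_exists) (simp_all add: in_Hom_iff)
  note [simp] = W.denotesD(6-8)[OF NA] W.denotesD(6-8)[OF NB] W.denotesD(6-8)[OF NC] W.denotesD(6-8)[OF F]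
  have "W.denotes (($7 ** $10) ** $3) (($6 ** $11) ** $2)
     (lcomp_arr A' (idual B \<otimes>\<^sub>i K) (idual B' \<otimes>\<^sub>i K')
       (ltensor_arr (idual B) (idual B') K K' (dual_arr B' B b) c)
       (lcomp_arr A' A (idual B \<otimes>\<^sub>i K) (flat_arr A B K f) a))
     (W.contract {5, 8, 4, 9} (W.par (W.contract {0, 1} (W.par NA F)) (W.par NB NC)))"
    by (rule W.denotes_lcomp[OF W.denotes_lcomp[OF NA W.denotes_flat[OF F]] W.denotes_ltensor[OF W.denotes_dual[OF NB] NC]])
      (auto simp: prod_eq_iff apart_def)
  moreover have "W.denotes (($7 ** $10) ** $3) (($6 ** $11) ** $2)
     (flat_arr A' B' K' (lcomp_arr (A' \<otimes>\<^sub>i B') K K' c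
        (lcomp_arr (A' \<otimes>\<^sub>i B') (A \<otimes>\<^sub>i B) K f (ltensor_arr A' A B' B a b))))
     (W.contract {8, 9} (W.par (W.contract {0, 4, 1, 5} (W.par (W.par NA NB) F)) NC))"
    by (rule W.denotes_flat[OF W.denotes_lcomp[OF W.denotes_lcomp[OF W.denotes_ltensor[OF NA NB] F] NC]])
      (auto simp: prod_eq_iff apart_def)
  moreover have "W.contract {5, 8, 4, 9} (W.par (W.contract {0, 1} (W.par NA F)) (W.par NB NC))
     = W.contract {8, 9} (W.par (W.contract {0, 4, 1, 5} (W.par (W.par NA NB) F)) NC)"
  proof -
    have "W.par (W.contract {0, 1} (W.par NA F)) (W.par NB NC) = W.contract {0, 1} (W.par (W.par NA F) (W.par NB NC))"
      by (rule W.contract_par_left) (auto simp: apart_def)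
    also have "W.par (W.par NA F) (W.par NB NC) = W.par NA (W.par F (W.par NB NC))"
      by (rule W.par_assoc) (auto simp: apart_def)
    also have "W.par F (W.par NB NC) = W.par NB (W.par F NC)"
      by (rule W.par_left_comm) (auto simp: apart_def)
    also have "W.par NA (W.par NB (W.par F NC)) = W.par (W.par NA NB) (W.par F NC)"
      by (rule W.par_assoc[symmetric]) (auto simp: apart_def)
    also have "\<dots> = W.par (W.par (W.par NA NB) F) NC"
      by (rule W.par_assoc[symmetric]) (auto simp: apart_def)
    finally have "W.contract {5, 8, 4, 9} (W.par (W.contract {0, 1} (W.par NA F)) (W.par NB NC))
      = W.contract {5, 8, 4, 9} (W.contract {0, 1} (W.par (W.par (W.par NA NB) F) NC))" by simp
    also have "\<dots> = W.contract ({5, 8, 4, 9} \<union> {0, 1}) (W.par (W.par (W.par NA NB) F) NC)"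
      by (rule W.contract_contract) (auto simp: apart_def)
    also have "{5, 8, 4, 9} \<union> {0, 1} = {8, 9} \<union> {0, 4, 1, 5 :: nat}" by auto
    also have "W.contract ({8, 9} \<union> {0, 4, 1, 5}) (W.par (W.par (W.par NA NB) F) NC)
       = W.contract {8, 9} (W.contract {0, 4, 1, 5} (W.par (W.par (W.par NA NB) F) NC))"
      by (rule W.contract_contract[symmetric]) (auto simp: apart_def)
    also have "W.contract {0, 4, 1, 5} (W.par (W.par (W.par NA NB) F) NC) = W.par (W.contract {0, 4, 1, 5} (W.par (W.par NA NB) F)) NC"
      by (rule W.contract_par_left[symmetric]) (auto simp: apart_def)
    finally show ?thesis .
  qed
  ultimately show ?thesis using W.denotes_unique by metis
qed

text \<open>
  The loose identity adds a crossing of two copies of \<open>B\<^sup>-\<close> to the loop, with \<open>A\<^sup>+\<close> as bystander;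
  \<open>tr_braid_context\<close> straightens it.
\<close>

lemma lcomp_arr_ident_left:
  assumes f: "f \<in> LooseArr A B"
  shows "lcomp_arr A B B (\<sigma> (B\<^sup>-) (B\<^sup>+)) f = f"
proof -
  \<comment> \<open>Name 2 is the copy of \<open>B\<^sup>-\<close> that enters \<open>f\<close> through the loop, name 4 the external one.\<close>
  let ?v = "[A\<^sup>-, A\<^sup>+, B\<^sup>-, B\<^sup>+, B\<^sup>-]"
  let ?M = "B\<^sup>-" and ?P = "A\<^sup>+"
  note [simp] = LooseArrD[OF f]
  interpret W: traced_wires C "valuation ?v"
    by (rule traced_wires_valuation) simp
  obtain F where F: "W.denotes ($2 ** $1) ($3 ** $0) f F"
    by (atomize_elim, rule W.denotes_exists) (simp_all add: in_Hom_iff)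
  note [simp] = W.denotesD(6-8)[OF F]
  let ?k = "(\<sigma> ?P ?M \<odot> \<one> ?M) \<cdot> (inv (\<alpha> ?P ?M ?M) \<cdot> (\<one> ?P \<odot> \<sigma> ?M ?M) \<cdot> \<alpha> ?P ?M ?M) \<cdot> (\<sigma> ?M ?P \<odot> \<one> ?M)"
  have comm: "W.par (W.nid {4}) F = W.par F (W.nid {4})"
    by (rule W.par_comm) (auto simp: apart_def)
  have 1: "W.denotes (($4 ** $1) ** $2) (($3 ** $0) ** $4)
     (lcomp_body A B B (\<sigma> (B\<^sup>-) (B\<^sup>+)) f) (W.par F (W.nid {4}))"
    unfolding lcomp_body_def
    apply (rule W.denotes_eqI)
     apply (rule F W.denotes_swap_right W.denotes_intros | simp; fail)+
    apply (simp add: W.nid_par_nid apart_def insert_commute comm)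
    done
  have 2: "W.denotes (($4 ** $1) ** $2) (($3 ** $0) ** $4)
     ((f \<odot> \<one> ?M) \<cdot> ?k) (W.par F (W.nid {4}))"
    apply (rule W.denotes_eqI)
     apply (rule F W.denotes_swap_right W.denotes_intros | simp; fail)+
    apply (simp add: W.nid_par_nid apart_def insert_commute)
    done
  have "lcomp_arr A B B (\<sigma> (B\<^sup>-) (B\<^sup>+)) f = Tr ?M (?M \<otimes> ?P) (B\<^sup>+ \<otimes> A\<^sup>-) ((f \<odot> \<one> ?M) \<cdot> ?k)"
    using W.denotes_unique[OF 1 2] by (simp add: lcomp_arr_def)
  also have "\<dots> = f \<cdot> Tr ?M (?M \<otimes> ?P) (?M \<otimes> ?P) ?k"
    using tr_nat_left[of ?M "?M \<otimes> ?P" f ?k "?M \<otimes> ?P"] by simp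
  also have "\<dots> = f" by (simp only: tr_braid_context LooseArrD[OF f]) simp
  finally show ?thesis .
qed

text \<open>
  The identity's braiding cancels against the one in the definition of composition, which leaves
  \<open>f\<close> followed by a crossing of two copies of \<open>A\<^sup>-\<close> with one of them traced out.
\<close>

lemma lcomp_arr_ident_right:
  assumes f: "f \<in> LooseArr A B"
  shows "lcomp_arr A A B f (\<sigma> (A\<^sup>-) (A\<^sup>+)) = f"
proof -
  note [simp] = LooseArrD[OF f]
  let ?M = "A\<^sup>-"
  have "inv (\<alpha> (B\<^sup>-) (A\<^sup>+) ?M) \<cdot> (\<one> (B\<^sup>-) \<odot> \<sigma> ?M (A\<^sup>+)) \<cdot> \<alpha> (B\<^sup>-) ?M (A\<^sup>+) \<cdot> swap_right C (B\<^sup>-) (A\<^sup>+) ?M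
     = \<one> ((B\<^sup>- \<otimes> A\<^sup>+) \<otimes> ?M)"
    by (simp add: swap_right_def interchange' braid_symmetric)
  then have "lcomp_body A A B f (\<sigma> ?M (A\<^sup>+)) = swap_right C (B\<^sup>+) ?M ?M \<cdot> (f \<odot> \<one> ?M)"
    by (simp add: lcomp_body_def)
  then have "lcomp_arr A A B f (\<sigma> ?M (A\<^sup>+)) = Tr ?M (B\<^sup>+ \<otimes> ?M) (B\<^sup>+ \<otimes> ?M) (swap_right C (B\<^sup>+) ?M ?M) \<cdot> f"
    using tr_nat_right[of ?M "B\<^sup>+ \<otimes> ?M" f "swap_right C (B\<^sup>+) ?M ?M" "B\<^sup>+ \<otimes> ?M"] by (simp add: lcomp_arr_def)
  also have "Tr ?M (B\<^sup>+ \<otimes> ?M) (B\<^sup>+ \<otimes> ?M) (swap_right C (B\<^sup>+) ?M ?M) = \<one> (B\<^sup>+ \<otimes> ?M)"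
    using tr_superpose[of ?M ?M ?M "\<one> (B\<^sup>+)" "B\<^sup>+" "B\<^sup>+" "\<sigma> ?M ?M"]
    by (simp add: in_Hom_iff tr_yank swap_right_def)
  finally show ?thesis by simp
qed

lemma dual_arr_ident: "A \<in> IObj \<Longrightarrow> dual_arr A A (\<sigma> (A\<^sup>-) (A\<^sup>+)) = \<sigma> (A\<^sup>+) (A\<^sup>-)"
  by (auto simp: dual_arr_def braid_symmetric)

lemma ltensor_arr_ident:
  assumes "A \<in> IObj" "B \<in> IObj"
  shows "ltensor_arr A A B B (\<sigma> (A\<^sup>-) (A\<^sup>+)) (\<sigma> (B\<^sup>-) (B\<^sup>+)) = \<sigma> (A\<^sup>- \<otimes> B\<^sup>-) (A\<^sup>+ \<otimes> B\<^sup>+)"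
proof -
  let ?v = "[A\<^sup>-, A\<^sup>+, B\<^sup>-, B\<^sup>+]"
  have [simp]: "A\<^sup>- \<in> Obj C" "A\<^sup>+ \<in> Obj C" "B\<^sup>- \<in> Obj C" "B\<^sup>+ \<in> Obj C" using assms by auto
  interpret W: traced_wires C "valuation ?v"
    by (rule traced_wires_valuation) simp
  have "W.denotes (($0 ** $2) ** ($1 ** $3)) (($1 ** $3) ** ($0 ** $2))
     (ltensor_arr A A B B (\<sigma> (A\<^sup>-) (A\<^sup>+)) (\<sigma> (B\<^sup>-) (B\<^sup>+))) (W.nid {0, 1, 2, 3})"
    unfolding ltensor_arr_def
    apply (rule W.denotes_eqI)
     apply (rule W.denotes_mid_four W.denotes_intros | simp; fail)+
    apply (simp add: W.nid_par_nid insert_commute)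
    done
  moreover have "W.denotes (($0 ** $2) ** ($1 ** $3)) (($1 ** $3) ** ($0 ** $2))
     (\<sigma> (A\<^sup>- \<otimes> B\<^sup>-) (A\<^sup>+ \<otimes> B\<^sup>+)) (W.nid {0, 1, 2, 3})"
    apply (rule W.denotes_eqI)
     apply (rule W.denotes_intros | simp; fail)+
    apply (simp add: W.nid_par_nid insert_commute)
    done
  ultimately show ?thesis using W.denotes_unique by metis
qed

lemma ltensor_arr_assoc:
  assumes f: "f \<in> LooseArr A A'" and g: "g \<in> LooseArr B B'" and h: "h \<in> LooseArr E E'"
  shows "(\<alpha> (A'\<^sup>+) (B'\<^sup>+) (E'\<^sup>+) \<odot> \<alpha> (A\<^sup>-) (B\<^sup>-) (E\<^sup>-))
       \<cdot> ltensor_arr (A \<otimes>\<^sub>i B) (A' \<otimes>\<^sub>i B') E E' (ltensor_arr A A' B B' f g) h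
     = ltensor_arr A A' (B \<otimes>\<^sub>i E) (B' \<otimes>\<^sub>i E') f (ltensor_arr B B' E E' g h)
       \<cdot> (\<alpha> (A'\<^sup>-) (B'\<^sup>-) (E'\<^sup>-) \<odot> \<alpha> (A\<^sup>+) (B\<^sup>+) (E\<^sup>+))"
proof -
  let ?v = "[A\<^sup>-, A\<^sup>+, A'\<^sup>-, A'\<^sup>+, B\<^sup>-, B\<^sup>+, B'\<^sup>-, B'\<^sup>+, E\<^sup>-, E\<^sup>+, E'\<^sup>-, E'\<^sup>+]"
  note [simp] = LooseArrD[OF f] LooseArrD[OF g] LooseArrD[OF h]
  interpret W: traced_wires C "valuation ?v"
    by (rule traced_wires_valuation) simp
  obtain F where F: "W.denotes ($2 ** $1) ($3 ** $0) f F"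
    by (atomize_elim, rule W.denotes_exists) (simp_all add: in_Hom_iff)
  obtain G where G: "W.denotes ($6 ** $5) ($7 ** $4) g G"
    by (atomize_elim, rule W.denotes_exists) (simp_all add: in_Hom_iff)
  obtain H where H: "W.denotes ($10 ** $9) ($11 ** $8) h H"
    by (atomize_elim, rule W.denotes_exists) (simp_all add: in_Hom_iff)
  note [simp] = W.denotesD(6-8)[OF F] W.denotesD(6-8)[OF G] W.denotesD(6-8)[OF H]
  have L: "W.denotes ((($2 ** $6) ** $10) ** (($1 ** $5) ** $9))
      ((($3 ** $7) ** $11) ** (($0 ** $4) ** $8))
      (ltensor_arr (A \<otimes>\<^sub>i B) (A' \<otimes>\<^sub>i B') E E' (ltensor_arr A A' B B' f g) h) (W.par (W.par F G) H)"
    by (rule W.denotes_ltensor[OF W.denotes_ltensor[OF F G] H]) (auto simp: prod_eq_iff apart_def)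
  have R: "W.denotes (($2 ** ($6 ** $10)) ** ($1 ** ($5 ** $9)))
      (($3 ** ($7 ** $11)) ** ($0 ** ($4 ** $8)))
      (ltensor_arr A A' (B \<otimes>\<^sub>i E) (B' \<otimes>\<^sub>i E') f (ltensor_arr B B' E E' g h)) (W.par F (W.par G H))"
    by (rule W.denotes_ltensor[OF F W.denotes_ltensor[OF G H]]) (auto simp: prod_eq_iff apart_def)
  have "W.par (W.par F G) H = W.par F (W.par G H)"
    by (rule W.par_assoc) (auto simp: apart_def)
  note L = L[unfolded this]
  have "W.denotes ((($2 ** $6) ** $10) ** (($1 ** $5) ** $9))
      (($3 ** ($7 ** $11)) ** ($0 ** ($4 ** $8)))
      ((\<alpha> (A'\<^sup>+) (B'\<^sup>+) (E'\<^sup>+) \<odot> \<alpha> (A\<^sup>-) (B\<^sup>-) (E\<^sup>-))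
       \<cdot> ltensor_arr (A \<otimes>\<^sub>i B) (A' \<otimes>\<^sub>i B') E E' (ltensor_arr A A' B B' f g) h) (W.par F (W.par G H))"
    apply (rule W.denotes_eqI)
     apply (rule L W.denotes_intros | simp; fail)+
    apply (simp add: W.nid_par_nid apart_def insert_commute)
    done
  moreover have "W.denotes ((($2 ** $6) ** $10) ** (($1 ** $5) ** $9))
      (($3 ** ($7 ** $11)) ** ($0 ** ($4 ** $8)))
      (ltensor_arr A A' (B \<otimes>\<^sub>i E) (B' \<otimes>\<^sub>i E') f (ltensor_arr B B' E E' g h)
       \<cdot> (\<alpha> (A'\<^sup>-) (B'\<^sup>-) (E'\<^sup>-) \<odot> \<alpha> (A\<^sup>+) (B\<^sup>+) (E\<^sup>+))) (W.par F (W.par G H))"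
    apply (rule W.denotes_eqI)
     apply (rule R W.denotes_intros | simp; fail)+
    apply (simp add: W.nid_par_nid apart_def insert_commute)
    done
  ultimately show ?thesis using W.denotes_unique by metis
qed

lemma ltensor_arr_lunit:
  assumes f: "f \<in> LooseArr A B"
  shows "(lunit C (B\<^sup>+) \<odot> lunit C (A\<^sup>-)) \<cdot> ltensor_arr (\<I>, \<I>) (\<I>, \<I>) A B (\<sigma> \<I> \<I>) f
     = f \<cdot> (lunit C (B\<^sup>-) \<odot> lunit C (A\<^sup>+))"
proof -
  let ?v = "[A\<^sup>-, A\<^sup>+, B\<^sup>-, B\<^sup>+]"
  note [simp] = LooseArrD[OF f]
  interpret W: traced_wires C "valuation ?v"
    by (rule traced_wires_valuation) simp
  obtain F where F: "W.denotes ($2 ** $1) ($3 ** $0) f F"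
    by (atomize_elim, rule W.denotes_exists) (simp_all add: in_Hom_iff)
  note [simp] = W.denotesD(6-8)[OF F]
  have I: "W.denotes (Unit ** Unit) (Unit ** Unit) (\<sigma> \<I> \<I>) (W.nid {})"
    using W.denotes_braid[of Unit Unit] by simp
  have L: "W.denotes ((Unit ** $2) ** (Unit ** $1)) ((Unit ** $3) ** (Unit ** $0))
     (ltensor_arr (\<I>, \<I>) (\<I>, \<I>) A B (\<sigma> \<I> \<I>) f) (W.par (W.nid {}) F)"
    by (rule W.denotes_ltensor[OF I F]) (auto simp: prod_eq_iff apart_def)
  have "W.par (W.nid {}) F = F" by (rule W.nid_empty_par) simp
  note L = L[unfolded this]
  have "W.denotes ((Unit ** $2) ** (Unit ** $1)) ($3 ** $0)
     ((lunit C (B\<^sup>+) \<odot> lunit C (A\<^sup>-)) \<cdot> ltensor_arr (\<I>, \<I>) (\<I>, \<I>) A B (\<sigma> \<I> \<I>) f) F"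
    apply (rule W.denotes_eqI)
     apply (rule L W.denotes_intros | simp; fail)+
    apply (simp add: W.nid_par_nid insert_commute)
    done
  moreover have "W.denotes ((Unit ** $2) ** (Unit ** $1)) ($3 ** $0)
     (f \<cdot> (lunit C (B\<^sup>-) \<odot> lunit C (A\<^sup>+))) F"
    apply (rule W.denotes_eqI)
     apply (rule F W.denotes_intros | simp; fail)+
    apply (simp add: W.nid_par_nid insert_commute)
    done
  ultimately show ?thesis using W.denotes_unique by metis
qed

lemma ltensor_arr_runit:
  assumes f: "f \<in> LooseArr A B"
  shows "(\<rho> (B\<^sup>+) \<odot> \<rho> (A\<^sup>-)) \<cdot> ltensor_arr A B (\<I>, \<I>) (\<I>, \<I>) f (\<sigma> \<I> \<I>)
     = f \<cdot> (\<rho> (B\<^sup>-) \<odot> \<rho> (A\<^sup>+))"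
proof -
  let ?v = "[A\<^sup>-, A\<^sup>+, B\<^sup>-, B\<^sup>+]"
  note [simp] = LooseArrD[OF f]
  interpret W: traced_wires C "valuation ?v"
    by (rule traced_wires_valuation) simp
  obtain F where F: "W.denotes ($2 ** $1) ($3 ** $0) f F"
    by (atomize_elim, rule W.denotes_exists) (simp_all add: in_Hom_iff)
  note [simp] = W.denotesD(6-8)[OF F]
  have I: "W.denotes (Unit ** Unit) (Unit ** Unit) (\<sigma> \<I> \<I>) (W.nid {})"
    using W.denotes_braid[of Unit Unit] by simp
  have L: "W.denotes (($2 ** Unit) ** ($1 ** Unit)) (($3 ** Unit) ** ($0 ** Unit))
     (ltensor_arr A B (\<I>, \<I>) (\<I>, \<I>) f (\<sigma> \<I> \<I>)) (W.par F (W.nid {}))"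
    by (rule W.denotes_ltensor[OF F I]) (auto simp: prod_eq_iff apart_def)
  have "W.par F (W.nid {}) = F"
    using W.par_comm[of "W.nid {}" F] by (simp add: apart_def W.nid_empty_par)
  note L = L[unfolded this]
  have "W.denotes (($2 ** Unit) ** ($1 ** Unit)) ($3 ** $0)
     ((\<rho> (B\<^sup>+) \<odot> \<rho> (A\<^sup>-)) \<cdot> ltensor_arr A B (\<I>, \<I>) (\<I>, \<I>) f (\<sigma> \<I> \<I>)) F"
    apply (rule W.denotes_eqI)
     apply (rule L W.denotes_intros | simp; fail)+
    apply (simp add: W.nid_par_nid insert_commute)
    done
  moreover have "W.denotes (($2 ** Unit) ** ($1 ** Unit)) ($3 ** $0)
     (f \<cdot> (\<rho> (B\<^sup>-) \<odot> \<rho> (A\<^sup>+))) F"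
    apply (rule W.denotes_eqI)
     apply (rule F W.denotes_intros | simp; fail)+
    apply (simp add: W.nid_par_nid insert_commute)
    done
  ultimately show ?thesis using W.denotes_unique by metis
qed

lemma ltensor_arr_braid:
  assumes f: "f \<in> LooseArr A A'" and g: "g \<in> LooseArr B B'"
  shows "(\<sigma> (A'\<^sup>+) (B'\<^sup>+) \<odot> \<sigma> (A\<^sup>-) (B\<^sup>-)) \<cdot> ltensor_arr A A' B B' f g
     = ltensor_arr B B' A A' g f \<cdot> (\<sigma> (A'\<^sup>-) (B'\<^sup>-) \<odot> \<sigma> (A\<^sup>+) (B\<^sup>+))"
proof -
  let ?v = "[A\<^sup>-, A\<^sup>+, A'\<^sup>-, A'\<^sup>+, B\<^sup>-, B\<^sup>+, B'\<^sup>-, B'\<^sup>+]"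
  note [simp] = LooseArrD[OF f] LooseArrD[OF g]
  interpret W: traced_wires C "valuation ?v"
    by (rule traced_wires_valuation) simp
  obtain F where F: "W.denotes ($2 ** $1) ($3 ** $0) f F"
    by (atomize_elim, rule W.denotes_exists) (simp_all add: in_Hom_iff)
  obtain G where G: "W.denotes ($6 ** $5) ($7 ** $4) g G"
    by (atomize_elim, rule W.denotes_exists) (simp_all add: in_Hom_iff)
  note [simp] = W.denotesD(6-8)[OF F] W.denotesD(6-8)[OF G]
  have L: "W.denotes (($2 ** $6) ** ($1 ** $5)) (($3 ** $7) ** ($0 ** $4))
      (ltensor_arr A A' B B' f g) (W.par F G)"
    by (rule W.denotes_ltensor[OF F G]) (auto simp: prod_eq_iff apart_def)
  have R: "W.denotes (($6 ** $2) ** ($5 ** $1)) (($7 ** $3) ** ($4 ** $0))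
      (ltensor_arr B B' A A' g f) (W.par G F)"
    by (rule W.denotes_ltensor[OF G F]) (auto simp: prod_eq_iff apart_def)
  have "W.par G F = W.par F G"
    by (rule W.par_comm) (auto simp: apart_def)
  note R = R[unfolded this]
  have "W.denotes (($2 ** $6) ** ($1 ** $5)) (($7 ** $3) ** ($4 ** $0))
     ((\<sigma> (A'\<^sup>+) (B'\<^sup>+) \<odot> \<sigma> (A\<^sup>-) (B\<^sup>-)) \<cdot> ltensor_arr A A' B B' f g) (W.par F G)"
    apply (rule W.denotes_eqI)
     apply (rule L W.denotes_intros | simp; fail)+
    apply (simp add: W.nid_par_nid apart_def insert_commute)
    done
  moreover have "W.denotes (($2 ** $6) ** ($1 ** $5)) (($7 ** $3) ** ($4 ** $0))
     (ltensor_arr B B' A A' g f \<cdot> (\<sigma> (A'\<^sup>-) (B'\<^sup>-) \<odot> \<sigma> (A\<^sup>+) (B\<^sup>+))) (W.par F G)"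
    apply (rule W.denotes_eqI)
     apply (rule R W.denotes_intros | simp; fail)+
    apply (simp add: W.nid_par_nid apart_def insert_commute)
    done
  ultimately show ?thesis using W.denotes_unique by metis
qed

end

section \<open>Pairs of objects and arrows\<close>

lemma prod_sm_simps [simp]:
  "Obj (prod_sm C D) = Obj C \<times> Obj D"
  "Arr (prod_sm C D) = Arr C \<times> Arr D"
  "Dom (prod_sm C D) = map_prod (Dom C) (Dom D)"
  "Cod (prod_sm C D) = map_prod (Cod C) (Cod D)"
  "ident (prod_sm C D) = map_prod (ident C) (ident D)"
  "comp (prod_sm C D) = (\<lambda>g f. (fst g \<cdot>\<^bsub>C\<^esub> fst f, snd g \<cdot>\<^bsub>D\<^esub> snd f))"
  "unit_obj (prod_sm C D) = (\<I>\<^bsub>C\<^esub>, \<I>\<^bsub>D\<^esub>)"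
  "tensor_obj (prod_sm C D) = (\<lambda>A B. (fst A \<otimes>\<^bsub>C\<^esub> fst B, snd A \<otimes>\<^bsub>D\<^esub> snd B))"
  "tensor_arr (prod_sm C D) = (\<lambda>f g. (fst f \<odot>\<^bsub>C\<^esub> fst g, snd f \<odot>\<^bsub>D\<^esub> snd g))"
  "assoc (prod_sm C D) = (\<lambda>A B E. (\<alpha>\<^bsub>C\<^esub> (fst A) (fst B) (fst E), \<alpha>\<^bsub>D\<^esub> (snd A) (snd B) (snd E)))"
  "lunit (prod_sm C D) = map_prod (lunit C) (lunit D)"
  "runit (prod_sm C D) = map_prod (runit C) (runit D)"
  "braid (prod_sm C D) = (\<lambda>A B. (\<sigma>\<^bsub>C\<^esub> (fst A) (fst B), \<sigma>\<^bsub>D\<^esub> (snd A) (snd B)))"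
  by (simp_all add: prod_sm_def)

lemma Hom_prod_sm:
  "f \<in> Hom (prod_sm C D) A B \<longleftrightarrow> fst f \<in> Hom C (fst A) (fst B) \<and> snd f \<in> Hom D (snd A) (snd B)"
  by (cases f; cases A; cases B) (auto simp: Hom_def)

lemma inverse_arrows_prod_sm:
  "inverse_arrows (prod_sm C D) f g \<longleftrightarrow> inverse_arrows C (fst f) (fst g) \<and> inverse_arrows D (snd f) (snd g)"
  by (cases f; cases g) (auto simp: inverse_arrows_def Hom_prod_sm)

lemma symmetric_monoidal_category_prod_sm:
  assumes "symmetric_monoidal_category C" "symmetric_monoidal_category D"
  shows "symmetric_monoidal_category (prod_sm C D)"
proof -
  interpret C: symmetric_monoidal_category C by fact
  interpret D: symmetric_monoidal_category D by fact
  have iso: "iso_arrow (prod_sm C D) f" if "iso_arrow C (fst f)" "iso_arrow D (snd f)" for f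
    using C.iso_inverse_arrows[OF that(1)] D.iso_inverse_arrows[OF that(2)]
    by (auto simp: iso_arrow_def[of "prod_sm C D"] inverse_arrows_prod_sm)
  show ?thesis
    by unfold_locales
      (auto simp: Hom_prod_sm prod_eq_iff
        intro!: iso C.ident_Hom D.ident_Hom C.tensor_Hom D.tensor_Hom C.assoc_Hom D.assoc_Hom
          C.lunit_Hom D.lunit_Hom C.runit_Hom D.runit_Hom C.braid_Hom D.braid_Hom
          C.tensor_comp D.tensor_comp C.assoc_natural D.assoc_natural
          C.lunit_natural D.lunit_natural C.runit_natural D.runit_natural
          C.pentagon D.pentagon C.triangle D.triangle C.braid_natural D.braid_natural
          C.braid_symmetric D.braid_symmetric C.hexagon D.hexagon
        intro: C.comp_Hom D.comp_Hom C.ident_left D.ident_left C.ident_right D.ident_right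
          C.comp_assoc D.comp_assoc)
qed

lemma inv_prod_sm:
  assumes "category C" "category D" "iso_arrow C (fst f)" "iso_arrow D (snd f)"
    and "category (prod_sm C D)"
  shows "inv\<^bsub>prod_sm C D\<^esub> f = (inv\<^bsub>C\<^esub> (fst f), inv\<^bsub>D\<^esub> (snd f))"
  by (rule category.inverse_arrows_inv[OF assms(5)])
    (use assms in \<open>auto simp: inverse_arrows_prod_sm category.iso_inverse_arrows\<close>)

section \<open>Cells\<close>

context traced_category
begin

definition icell where
  "icell A1 B1 f1 A2 B2 f2 s t \<longleftrightarrow> f1 \<in> LooseArr A1 B1 \<and> f2 \<in> LooseArr A2 B2
     \<and> s \<in> Hom (prod_sm C C) A1 A2 \<and> t \<in> Hom (prod_sm C C) B1 B2
     \<and> (t\<^sup>+ \<odot> s\<^sup>-) \<cdot> f1 = f2 \<cdot> (t\<^sup>- \<odot> s\<^sup>+)"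

lemma icellD:
  assumes "icell A1 B1 f1 A2 B2 f2 s t"
  shows "f1 \<in> LooseArr A1 B1" "f2 \<in> LooseArr A2 B2"
    "s\<^sup>- \<in> Hom C (A1\<^sup>-) (A2\<^sup>-)" "s\<^sup>+ \<in> Hom C (A1\<^sup>+) (A2\<^sup>+)" "t\<^sup>- \<in> Hom C (B1\<^sup>-) (B2\<^sup>-)" "t\<^sup>+ \<in> Hom C (B1\<^sup>+) (B2\<^sup>+)"
    "(t\<^sup>+ \<odot> s\<^sup>-) \<cdot> f1 = f2 \<cdot> (t\<^sup>- \<odot> s\<^sup>+)"
  using assms by (auto simp: icell_def Hom_prod_sm)

lemma icellI:
  assumes "f1 \<in> LooseArr A1 B1" "f2 \<in> LooseArr A2 B2"
    "s\<^sup>- \<in> Hom C (A1\<^sup>-) (A2\<^sup>-)" "s\<^sup>+ \<in> Hom C (A1\<^sup>+) (A2\<^sup>+)" "t\<^sup>- \<in> Hom C (B1\<^sup>-) (B2\<^sup>-)" "t\<^sup>+ \<in> Hom C (B1\<^sup>+) (B2\<^sup>+)"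
    "(t\<^sup>+ \<odot> s\<^sup>-) \<cdot> f1 = f2 \<cdot> (t\<^sup>- \<odot> s\<^sup>+)"
  shows "icell A1 B1 f1 A2 B2 f2 s t"
  using assms by (auto simp: icell_def Hom_prod_sm)

lemma icell_vcomp:
  assumes c: "icell A1 B1 f1 A2 B2 f2 s t" and d: "icell A2 B2 f2 A3 B3 f3 s' t'"
  shows "icell A1 B1 f1 A3 B3 f3 (s'\<^sup>- \<cdot> s\<^sup>-, s'\<^sup>+ \<cdot> s\<^sup>+) (t'\<^sup>- \<cdot> t\<^sup>-, t'\<^sup>+ \<cdot> t\<^sup>+)"
proof (rule icellI)
  note [simp] = icellD(3-6)[OF c, unfolded in_Hom_iff] icellD(3-6)[OF d, unfolded in_Hom_iff]
    LooseArrD[OF icellD(1)[OF c]] LooseArrD[OF icellD(2)[OF c]] LooseArrD[OF icellD(2)[OF d]]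
  have "((t'\<^sup>+ \<cdot> t\<^sup>+) \<odot> (s'\<^sup>- \<cdot> s\<^sup>-)) \<cdot> f1 = (t'\<^sup>+ \<odot> s'\<^sup>-) \<cdot> (t\<^sup>+ \<odot> s\<^sup>-) \<cdot> f1"
    by (simp add: interchange')
  also have "\<dots> = ((t'\<^sup>+ \<odot> s'\<^sup>-) \<cdot> f2) \<cdot> (t\<^sup>- \<odot> s\<^sup>+)"
    unfolding icellD(7)[OF c] by (simp add: comp_assoc')
  also have "\<dots> = f3 \<cdot> ((t'\<^sup>- \<cdot> t\<^sup>-) \<odot> (s'\<^sup>+ \<cdot> s\<^sup>+))"
    unfolding icellD(7)[OF d] by (simp add: comp_assoc' interchange)
  finally show "((t'\<^sup>- \<cdot> t\<^sup>-, t'\<^sup>+ \<cdot> t\<^sup>+)\<^sup>+ \<odot> (s'\<^sup>- \<cdot> s\<^sup>-, s'\<^sup>+ \<cdot> s\<^sup>+)\<^sup>-) \<cdot> f1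
      = f3 \<cdot> ((t'\<^sup>- \<cdot> t\<^sup>-, t'\<^sup>+ \<cdot> t\<^sup>+)\<^sup>- \<odot> (s'\<^sup>- \<cdot> s\<^sup>-, s'\<^sup>+ \<cdot> s\<^sup>+)\<^sup>+)"
    by simp
qed (use icellD[OF c] icellD[OF d] in \<open>auto intro: comp_Hom\<close>)

text \<open>Provides the inverses of all structural cells at once.\<close>

lemma icell_inv:
  assumes c: "icell A1 B1 f1 A2 B2 f2 s t"
    and i: "iso_arrow C (s\<^sup>-)" "iso_arrow C (s\<^sup>+)" "iso_arrow C (t\<^sup>-)" "iso_arrow C (t\<^sup>+)"
  shows "icell A2 B2 f2 A1 B1 f1 (inv (s\<^sup>-), inv (s\<^sup>+)) (inv (t\<^sup>-), inv (t\<^sup>+))"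
proof (rule icellI)
  note [simp] = icellD(3-6)[OF c, unfolded in_Hom_iff] i
    LooseArrD[OF icellD(1)[OF c]] LooseArrD[OF icellD(2)[OF c]]
  have "(inv (t\<^sup>+) \<odot> inv (s\<^sup>-)) \<cdot> f2
    = (inv (t\<^sup>+) \<odot> inv (s\<^sup>-)) \<cdot> (f2 \<cdot> (t\<^sup>- \<odot> s\<^sup>+)) \<cdot> (inv (t\<^sup>-) \<odot> inv (s\<^sup>+))"
    by (simp add: merge_tensor)
  also have "\<dots> = f1 \<cdot> (inv (t\<^sup>-) \<odot> inv (s\<^sup>+))"
    unfolding icellD(7)[OF c, symmetric] by (simp add: merge_tensor)
  finally show "((inv (t\<^sup>-), inv (t\<^sup>+))\<^sup>+ \<odot> (inv (s\<^sup>-), inv (s\<^sup>+))\<^sup>-) \<cdot> f2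
     = f1 \<cdot> ((inv (t\<^sup>-), inv (t\<^sup>+))\<^sup>- \<odot> (inv (s\<^sup>-), inv (s\<^sup>+))\<^sup>+)"
    by simp
qed (use icellD[OF c] i in \<open>auto simp: in_Hom_iff\<close>)

lemma icell_ltensor:
  assumes c: "icell A1 B1 f1 A2 B2 f2 s t" and d: "icell A1' B1' f1' A2' B2' f2' s' t'"
  shows "icell (A1 \<otimes>\<^sub>i A1') (B1 \<otimes>\<^sub>i B1') (ltensor_arr A1 B1 A1' B1' f1 f1')
     (A2 \<otimes>\<^sub>i A2') (B2 \<otimes>\<^sub>i B2') (ltensor_arr A2 B2 A2' B2' f2 f2')
     (s\<^sup>- \<odot> s'\<^sup>-, s\<^sup>+ \<odot> s'\<^sup>+) (t\<^sup>- \<odot> t'\<^sup>-, t\<^sup>+ \<odot> t'\<^sup>+)"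
proof (rule icellI)
  note h = icellD(3-6)[OF c] icellD(3-6)[OF d]
  note [simp] = h[unfolded in_Hom_iff]
    LooseArrD[OF icellD(1)[OF c]] LooseArrD[OF icellD(2)[OF c]] LooseArrD[OF icellD(1)[OF d]] LooseArrD[OF icellD(2)[OF d]]
  let ?m = "mid_four C"
  have "((t\<^sup>+ \<odot> t'\<^sup>+) \<odot> (s\<^sup>- \<odot> s'\<^sup>-)) \<cdot> ltensor_arr A1 B1 A1' B1' f1 f1'
     = (((t\<^sup>+ \<odot> t'\<^sup>+) \<odot> (s\<^sup>- \<odot> s'\<^sup>-)) \<cdot> ?m (B1\<^sup>+) (A1\<^sup>-) (B1'\<^sup>+) (A1'\<^sup>-)) \<cdot> (f1 \<odot> f1') \<cdot> ?m (B1\<^sup>-) (B1'\<^sup>-) (A1\<^sup>+) (A1'\<^sup>+)"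
    by (simp add: ltensor_arr_def comp_assoc')
  also have "\<dots> = ?m (B2\<^sup>+) (A2\<^sup>-) (B2'\<^sup>+) (A2'\<^sup>-) \<cdot> (((t\<^sup>+ \<odot> s\<^sup>-) \<cdot> f1) \<odot> ((t'\<^sup>+ \<odot> s'\<^sup>-) \<cdot> f1')) \<cdot> ?m (B1\<^sup>-) (B1'\<^sup>-) (A1\<^sup>+) (A1'\<^sup>+)"
    by (simp add: mid_four_nat[OF h(4) h(1) h(8) h(5)] comp_assoc' interchange')
  also have "\<dots> = ?m (B2\<^sup>+) (A2\<^sup>-) (B2'\<^sup>+) (A2'\<^sup>-) \<cdot> (f2 \<odot> f2') \<cdot> (((t\<^sup>- \<odot> s\<^sup>+) \<odot> (t'\<^sup>- \<odot> s'\<^sup>+)) \<cdot> ?m (B1\<^sup>-) (B1'\<^sup>-) (A1\<^sup>+) (A1'\<^sup>+))"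
    unfolding icellD(7)[OF c] icellD(7)[OF d] by (simp add: interchange')
  also have "\<dots> = ltensor_arr A2 B2 A2' B2' f2 f2' \<cdot> ((t\<^sup>- \<odot> t'\<^sup>-) \<odot> (s\<^sup>+ \<odot> s'\<^sup>+))"
    by (simp add: mid_four_nat[OF h(3) h(7) h(2) h(6)] ltensor_arr_def comp_assoc')
  finally show "((t\<^sup>- \<odot> t'\<^sup>-, t\<^sup>+ \<odot> t'\<^sup>+)\<^sup>+ \<odot> (s\<^sup>- \<odot> s'\<^sup>-, s\<^sup>+ \<odot> s'\<^sup>+)\<^sup>-) \<cdot> ltensor_arr A1 B1 A1' B1' f1 f1'
    = ltensor_arr A2 B2 A2' B2' f2 f2' \<cdot> ((t\<^sup>- \<odot> t'\<^sup>-, t\<^sup>+ \<odot> t'\<^sup>+)\<^sup>- \<odot> (s\<^sup>- \<odot> s'\<^sup>-, s\<^sup>+ \<odot> s'\<^sup>+)\<^sup>+)"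
    by simp
qed (use icellD[OF c] icellD[OF d] in \<open>auto intro: ltensor_arr_LooseArr tensor_Hom\<close>)

lemma icell_dual:
  assumes c: "icell A1 B1 f1 A2 B2 f2 s t"
  shows "icell (idual B1) (idual A1) (dual_arr A1 B1 f1) (idual B2) (idual A2) (dual_arr A2 B2 f2)
    (t\<^sup>+, t\<^sup>-) (s\<^sup>+, s\<^sup>-)"
proof (rule icellI)
  note h = icellD(3-6)[OF c]
  note [simp] = h[unfolded in_Hom_iff]
    LooseArrD[OF icellD(1)[OF c]] LooseArrD[OF icellD(2)[OF c]]
  have "(s\<^sup>- \<odot> t\<^sup>+) \<cdot> dual_arr A1 B1 f1 = ((s\<^sup>- \<odot> t\<^sup>+) \<cdot> \<sigma> (B1\<^sup>+) (A1\<^sup>-)) \<cdot> f1 \<cdot> \<sigma> (A1\<^sup>+) (B1\<^sup>-)"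
    by (simp add: dual_arr_def comp_assoc')
  also have "\<dots> = \<sigma> (B2\<^sup>+) (A2\<^sup>-) \<cdot> ((t\<^sup>+ \<odot> s\<^sup>-) \<cdot> f1) \<cdot> \<sigma> (A1\<^sup>+) (B1\<^sup>-)"
    by (simp add: comp_assoc' flip: braid_natural[OF h(4) h(1)])
  also have "\<dots> = \<sigma> (B2\<^sup>+) (A2\<^sup>-) \<cdot> f2 \<cdot> ((t\<^sup>- \<odot> s\<^sup>+) \<cdot> \<sigma> (A1\<^sup>+) (B1\<^sup>-))"
    unfolding icellD(7)[OF c] by (simp add: comp_assoc')
  also have "\<dots> = dual_arr A2 B2 f2 \<cdot> (s\<^sup>+ \<odot> t\<^sup>-)"
    by (simp add: dual_arr_def comp_assoc' flip: braid_natural[OF h(2) h(3)])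
  finally show "((s\<^sup>+, s\<^sup>-)\<^sup>+ \<odot> (t\<^sup>+, t\<^sup>-)\<^sup>-) \<cdot> dual_arr A1 B1 f1 = dual_arr A2 B2 f2 \<cdot> ((s\<^sup>+, s\<^sup>-)\<^sup>- \<odot> (t\<^sup>+, t\<^sup>-)\<^sup>+)"
    by simp
qed (use icellD[OF c] in \<open>auto intro: dual_arr_LooseArr\<close>)

text \<open>
  The defining equation of the second cell is that of the first one conjugated by
  \<open>rot\<close>, by naturality of \<open>rot\<close>.
\<close>

lemma icell_flat_iff:
  assumes s: "s \<in> Hom (prod_sm C C) A1 A2" and t: "t \<in> Hom (prod_sm C C) B1 B2" and u: "u \<in> Hom (prod_sm C C) K1 K2"
    and f1: "f1 \<in> LooseArr (A1 \<otimes>\<^sub>i B1) K1" and f2: "f2 \<in> LooseArr (A2 \<otimes>\<^sub>i B2) K2"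
  shows "icell (A1 \<otimes>\<^sub>i B1) K1 f1 (A2 \<otimes>\<^sub>i B2) K2 f2 (s\<^sup>- \<odot> t\<^sup>-, s\<^sup>+ \<odot> t\<^sup>+) u
    \<longleftrightarrow> icell A1 (idual B1 \<otimes>\<^sub>i K1) (flat_arr A1 B1 K1 f1) A2 (idual B2 \<otimes>\<^sub>i K2) (flat_arr A2 B2 K2 f2)
          s (t\<^sup>+ \<odot> u\<^sup>-, t\<^sup>- \<odot> u\<^sup>+)"
proof -
  note h = s[unfolded Hom_prod_sm, THEN conjunct1] s[unfolded Hom_prod_sm, THEN conjunct2]
    t[unfolded Hom_prod_sm, THEN conjunct1] t[unfolded Hom_prod_sm, THEN conjunct2]
    u[unfolded Hom_prod_sm, THEN conjunct1] u[unfolded Hom_prod_sm, THEN conjunct2]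
  note o [simp] = Hom_Obj[OF h(1)] Hom_Obj[OF h(2)] Hom_Obj[OF h(3)] Hom_Obj[OF h(4)] Hom_Obj[OF h(5)] Hom_Obj[OF h(6)]
  have O: "A1 \<in> IObj" "B1 \<in> IObj" "A2 \<in> IObj" "B2 \<in> IObj" "K1 \<in> IObj" "K2 \<in> IObj"
    by (auto simp: mem_Times_iff)
  note F [simp] = flat_arr_LooseArr[OF O(1,2) f1] flat_arr_LooseArr[OF O(3,4) f2]
  note [simp] = h[unfolded in_Hom_iff] LooseArrD[OF f1, simplified] LooseArrD[OF f2, simplified]
  let ?r1 = "rot (B1\<^sup>+) (K1\<^sup>-) (A1\<^sup>+)" and ?r2 = "rot (B2\<^sup>+) (K2\<^sup>-) (A2\<^sup>+)"
  let ?q1 = "rot (B1\<^sup>-) (K1\<^sup>+) (A1\<^sup>-)" and ?q2 = "rot (B2\<^sup>-) (K2\<^sup>+) (A2\<^sup>-)"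
  let ?x = "(u\<^sup>+ \<odot> (s\<^sup>- \<odot> t\<^sup>-)) \<cdot> f1" and ?y = "f2 \<cdot> (u\<^sup>- \<odot> (s\<^sup>+ \<odot> t\<^sup>+))"
  have q: "?q2 \<cdot> ((t\<^sup>- \<odot> u\<^sup>+) \<odot> s\<^sup>-) = (u\<^sup>+ \<odot> (s\<^sup>- \<odot> t\<^sup>-)) \<cdot> ?q1"
    by (rule rot_nat[symmetric]) (rule h)+
  have "((t\<^sup>- \<odot> u\<^sup>+) \<odot> s\<^sup>-) \<cdot> flat_arr A1 B1 K1 f1 = inv ?q2 \<cdot> (?q2 \<cdot> ((t\<^sup>- \<odot> u\<^sup>+) \<odot> s\<^sup>-)) \<cdot> inv ?q1 \<cdot> f1 \<cdot> ?r1"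
    by (simp add: flat_arr_def comp_assoc')
  also have "\<dots> = inv ?q2 \<cdot> ?x \<cdot> ?r1"
    unfolding q by (simp add: comp_assoc')
  finally have L: "((t\<^sup>- \<odot> u\<^sup>+) \<odot> s\<^sup>-) \<cdot> flat_arr A1 B1 K1 f1 = inv ?q2 \<cdot> ?x \<cdot> ?r1" .
  have "flat_arr A2 B2 K2 f2 \<cdot> ((t\<^sup>+ \<odot> u\<^sup>-) \<odot> s\<^sup>+) = inv ?q2 \<cdot> f2 \<cdot> (?r2 \<cdot> ((t\<^sup>+ \<odot> u\<^sup>-) \<odot> s\<^sup>+))"
    by (simp add: flat_arr_def comp_assoc')
  also have "\<dots> = inv ?q2 \<cdot> ?y \<cdot> ?r1"
    by (simp add: comp_assoc' flip: rot_nat[OF h(4) h(5) h(2)])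
  finally have R: "flat_arr A2 B2 K2 f2 \<cdot> ((t\<^sup>+ \<odot> u\<^sup>-) \<odot> s\<^sup>+) = inv ?q2 \<cdot> ?y \<cdot> ?r1" .
  have "?x = ?y \<longleftrightarrow> inv ?q2 \<cdot> ?x \<cdot> ?r1 = inv ?q2 \<cdot> ?y \<cdot> ?r1"
  proof
    assume "inv ?q2 \<cdot> ?x \<cdot> ?r1 = inv ?q2 \<cdot> ?y \<cdot> ?r1"
    then have "?x \<cdot> ?r1 = ?y \<cdot> ?r1" by (rule iso_cancel_left[rotated]) simp_all
    then show "?x = ?y" by (rule iso_cancel_right[rotated]) simp_all
  qed simp
  then show ?thesis
    using s t u f1 f2 F h unfolding icell_def fst_conv snd_conv L R Hom_prod_sm
    by (auto intro: tensor_Hom)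
qed

lemma flat_arr_bij:
  assumes "A \<in> IObj" "B \<in> IObj" "K \<in> IObj"
  shows "bij_betw (flat_arr A B K) (LooseArr (A \<otimes>\<^sub>i B) K) (LooseArr A (idual B \<otimes>\<^sub>i K))"
proof -
  let ?q = "rot (B\<^sup>-) (K\<^sup>+) (A\<^sup>-)" and ?r = "rot (B\<^sup>+) (K\<^sup>-) (A\<^sup>+)"
  have [simp]: "A\<^sup>- \<in> Obj C" "A\<^sup>+ \<in> Obj C" "B\<^sup>- \<in> Obj C" "B\<^sup>+ \<in> Obj C" "K\<^sup>- \<in> Obj C" "K\<^sup>+ \<in> Obj C"
    using assms by auto
  show ?thesis
  proof (rule bij_betw_byWitness[where f' = "\<lambda>g. ?q \<cdot> g \<cdot> inv ?r"])
    show "\<forall>f \<in> LooseArr (A \<otimes>\<^sub>i B) K. ?q \<cdot> flat_arr A B K f \<cdot> inv ?r = f"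
    proof
      fix f assume f: "f \<in> LooseArr (A \<otimes>\<^sub>i B) K"
      note [simp] = LooseArrD[OF f, simplified]
      show "?q \<cdot> flat_arr A B K f \<cdot> inv ?r = f" by (simp add: flat_arr_def comp_assoc')
    qed
    show "\<forall>g \<in> LooseArr A (idual B \<otimes>\<^sub>i K). flat_arr A B K (?q \<cdot> g \<cdot> inv ?r) = g"
    proof
      fix g assume g: "g \<in> LooseArr A (idual B \<otimes>\<^sub>i K)"
      note [simp] = LooseArrD[OF g, simplified]
      show "flat_arr A B K (?q \<cdot> g \<cdot> inv ?r) = g" by (simp add: flat_arr_def comp_assoc')
    qed
    show "flat_arr A B K ` LooseArr (A \<otimes>\<^sub>i B) K \<subseteq> LooseArr A (idual B \<otimes>\<^sub>i K)"
      by (rule image_subsetI) (simp add: flat_arr_LooseArr[OF assms(1,2)])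
    show "(\<lambda>g. ?q \<cdot> g \<cdot> inv ?r) ` LooseArr A (idual B \<otimes>\<^sub>i K) \<subseteq> LooseArr (A \<otimes>\<^sub>i B) K"
    proof (rule image_subsetI)
      fix g assume g: "g \<in> LooseArr A (idual B \<otimes>\<^sub>i K)"
      note [simp] = LooseArrD[OF g, simplified]
      show "?q \<cdot> g \<cdot> inv ?r \<in> LooseArr (A \<otimes>\<^sub>i B) K" by (rule LooseArrI) simp_all
    qed
  qed
qed

lemma lcomp_body_nat:
  assumes c: "icell A1 B1 f1 A2 B2 f2 s t" and d: "icell B1 E1 g1 B2 E2 g2 t u"
  shows "((u\<^sup>+ \<odot> s\<^sup>-) \<odot> t\<^sup>-) \<cdot> lcomp_body A1 B1 E1 g1 f1 = lcomp_body A2 B2 E2 g2 f2 \<cdot> ((u\<^sup>- \<odot> s\<^sup>+) \<odot> t\<^sup>-)"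
proof -
  note h = icellD(3-6)[OF c] icellD(5-6)[OF d]
  note [simp] = h[unfolded in_Hom_iff]
    LooseArrD[OF icellD(1)[OF c]] LooseArrD[OF icellD(2)[OF c]] LooseArrD[OF icellD(1)[OF d]] LooseArrD[OF icellD(2)[OF d]]
  let ?w = "swap_right C (E1\<^sup>-) (A1\<^sup>+) (B1\<^sup>-)"
    and ?z = "swap_right C (E2\<^sup>+) (B2\<^sup>-) (A2\<^sup>-)"
    and ?a1 = "inv (\<alpha> (E1\<^sup>-) (B1\<^sup>+) (A1\<^sup>-))"
    and ?a2 = "inv (\<alpha> (E2\<^sup>-) (B2\<^sup>+) (A2\<^sup>-))"
    and ?b = "\<alpha> (E1\<^sup>-) (B1\<^sup>-) (A1\<^sup>+)"
  have "((u\<^sup>+ \<odot> s\<^sup>-) \<odot> t\<^sup>-) \<cdot> lcomp_body A1 B1 E1 g1 f1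
    = (((u\<^sup>+ \<odot> s\<^sup>-) \<odot> t\<^sup>-) \<cdot> swap_right C (E1\<^sup>+) (B1\<^sup>-) (A1\<^sup>-)) \<cdot> (g1 \<odot> \<one> (A1\<^sup>-))
       \<cdot> ?a1 \<cdot> (\<one> (E1\<^sup>-) \<odot> f1) \<cdot> ?b \<cdot> ?w"
    by (simp add: lcomp_body_def comp_assoc')
  also have "\<dots> = ?z \<cdot> (((u\<^sup>+ \<odot> t\<^sup>-) \<cdot> g1) \<odot> s\<^sup>-)
       \<cdot> ?a1 \<cdot> (\<one> (E1\<^sup>-) \<odot> f1) \<cdot> ?b \<cdot> ?w"
    unfolding swap_right_nat[OF h(6) h(3) h(1)] by (simp add: comp_assoc' interchange')
  also have "\<dots> = ?z \<cdot> (g2 \<odot> \<one> (A2\<^sup>-))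
       \<cdot> (((u\<^sup>- \<odot> t\<^sup>+) \<odot> s\<^sup>-) \<cdot> ?a1) \<cdot> (\<one> (E1\<^sup>-) \<odot> f1) \<cdot> ?b \<cdot> ?w"
    unfolding icellD(7)[OF d] by (simp add: comp_assoc' interchange')
  also have "((u\<^sup>- \<odot> t\<^sup>+) \<odot> s\<^sup>-) \<cdot> ?a1 = ?a2 \<cdot> (u\<^sup>- \<odot> (t\<^sup>+ \<odot> s\<^sup>-))"
    by (rule assoc_inv_nat) simp_all
  also have "?z \<cdot> (g2 \<odot> \<one> (A2\<^sup>-))
       \<cdot> (?a2 \<cdot> (u\<^sup>- \<odot> (t\<^sup>+ \<odot> s\<^sup>-))) \<cdot> (\<one> (E1\<^sup>-) \<odot> f1) \<cdot> ?b \<cdot> ?w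
     = ?z \<cdot> (g2 \<odot> \<one> (A2\<^sup>-))
       \<cdot> ?a2 \<cdot> (u\<^sup>- \<odot> ((t\<^sup>+ \<odot> s\<^sup>-) \<cdot> f1)) \<cdot> ?b \<cdot> ?w"
    by (simp add: comp_assoc' interchange')
  also have "\<dots> = ?z \<cdot> (g2 \<odot> \<one> (A2\<^sup>-))
       \<cdot> ?a2 \<cdot> (\<one> (E2\<^sup>-) \<odot> f2) \<cdot> (u\<^sup>- \<odot> (t\<^sup>- \<odot> s\<^sup>+)) \<cdot> ?b \<cdot> ?w"
    unfolding icellD(7)[OF c] by (simp add: interchange')
  also have "\<dots> = ?z \<cdot> (g2 \<odot> \<one> (A2\<^sup>-))
       \<cdot> ?a2 \<cdot> (\<one> (E2\<^sup>-) \<odot> f2) \<cdot> \<alpha> (E2\<^sup>-) (B2\<^sup>-) (A2\<^sup>+)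
       \<cdot> (((u\<^sup>- \<odot> t\<^sup>-) \<odot> s\<^sup>+) \<cdot> ?w)"
    by (simp add: assoc_nat')
  also have "\<dots> = lcomp_body A2 B2 E2 g2 f2 \<cdot> ((u\<^sup>- \<odot> s\<^sup>+) \<odot> t\<^sup>-)"
    unfolding swap_right_nat[OF h(5) h(2) h(3)] by (simp add: lcomp_body_def comp_assoc')
  finally show ?thesis .
qed

end

context uniform_traced_category
begin

text \<open>
  The tight map \<open>t\<^sup>-\<close> intertwines the two traced arrows, up to \<open>u\<close> and \<open>s\<close> on the remaining wires
  (\<open>lcomp_body_nat\<close>).  Absorbing \<open>u\<^sup>+ \<odot> s\<^sup>-\<close> into the first and \<open>u\<^sup>- \<odot> s\<^sup>+\<close> into the second traced
  arrow makes strictness of \<open>t\<^sup>-\<close> applicable.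
\<close>

lemma icell_lcomp:
  assumes c: "icell A1 B1 f1 A2 B2 f2 s t" and d: "icell B1 E1 g1 B2 E2 g2 t u"
  shows "icell A1 E1 (lcomp_arr A1 B1 E1 g1 f1) A2 E2 (lcomp_arr A2 B2 E2 g2 f2) s u"
proof (rule icellI)
  note h = icellD(3-6)[OF c] icellD(5-6)[OF d]
  note k = lcomp_body_typing[OF icellD(1)[OF c] icellD(1)[OF d]] lcomp_body_typing[OF icellD(2)[OF c] icellD(2)[OF d]]
  note [simp] = h[unfolded in_Hom_iff] k[unfolded in_Hom_iff]
    LooseArrD[OF icellD(1)[OF c]] LooseArrD[OF icellD(2)[OF c]] LooseArrD[OF icellD(1)[OF d]] LooseArrD[OF icellD(2)[OF d]]
  let ?k1 = "lcomp_body A1 B1 E1 g1 f1" and ?k2 = "lcomp_body A2 B2 E2 g2 f2"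
  let ?x = "((u\<^sup>+ \<odot> s\<^sup>-) \<odot> \<one> (B1\<^sup>-)) \<cdot> ?k1" and ?y = "?k2 \<cdot> ((u\<^sup>- \<odot> s\<^sup>+) \<odot> \<one> (B2\<^sup>-))"
  have "(\<one> (E2\<^sup>+ \<otimes> A2\<^sup>-) \<odot> t\<^sup>-) \<cdot> ?x = ?y \<cdot> (\<one> (E1\<^sup>- \<otimes> A1\<^sup>+) \<odot> t\<^sup>-)"
    using lcomp_body_nat[OF c d] by (simp add: merge_tensor)
  moreover have "strict_arrow C (t\<^sup>-)" by (rule uniform) simp
  ultimately have "Tr (B1\<^sup>-) (E1\<^sup>- \<otimes> A1\<^sup>+) (E2\<^sup>+ \<otimes> A2\<^sup>-) ?x = Tr (B2\<^sup>-) (E1\<^sup>- \<otimes> A1\<^sup>+) (E2\<^sup>+ \<otimes> A2\<^sup>-) ?y"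
    unfolding strict_arrow_def by (simp add: in_Hom_iff)
  moreover have "Tr (B1\<^sup>-) (E1\<^sup>- \<otimes> A1\<^sup>+) (E2\<^sup>+ \<otimes> A2\<^sup>-) ?x = (u\<^sup>+ \<odot> s\<^sup>-) \<cdot> lcomp_arr A1 B1 E1 g1 f1"
    using tr_nat_left[of "B1\<^sup>-" "E1\<^sup>- \<otimes> A1\<^sup>+" "u\<^sup>+ \<odot> s\<^sup>-" ?k1 "E1\<^sup>+ \<otimes> A1\<^sup>-"] by (simp add: lcomp_arr_def)
  moreover have "Tr (B2\<^sup>-) (E1\<^sup>- \<otimes> A1\<^sup>+) (E2\<^sup>+ \<otimes> A2\<^sup>-) ?y = lcomp_arr A2 B2 E2 g2 f2 \<cdot> (u\<^sup>- \<odot> s\<^sup>+)"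
    using tr_nat_right[of "B2\<^sup>-" "E2\<^sup>+ \<otimes> A2\<^sup>-" "u\<^sup>- \<odot> s\<^sup>+" ?k2 "E2\<^sup>- \<otimes> A2\<^sup>+"] by (simp add: lcomp_arr_def)
  ultimately show "(u\<^sup>+ \<odot> s\<^sup>-) \<cdot> lcomp_arr A1 B1 E1 g1 f1 = lcomp_arr A2 B2 E2 g2 f2 \<cdot> (u\<^sup>- \<odot> s\<^sup>+)"
    by simp
qed (use icellD[OF c] icellD[OF d] in \<open>auto intro: lcomp_arr_LooseArr\<close>)

end

section \<open>The compact double category\<close>

lemma int_double_simps [simp]:
  "Tight (int_double U) = prod_sm U U"
  "Loose (int_double U) = int_Loose U"
  "lsrc (int_double U) = fst"
  "ltgt (int_double U) = fst \<circ> snd"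
  "lident (int_double U) = int_lident U"
  "lcomp (int_double U) = int_lcomp U"
  "ltensor (int_double U) = int_ltensor U"
  "Cell (int_double U) = int_Cell U"
  by (simp_all add: int_double_def)

context uniform_traced_category
begin

abbreviation Dbl where "Dbl \<equiv> int_double C"

lemma int_Loose_iff: "(A, B, f) \<in> int_Loose C \<longleftrightarrow> f \<in> LooseArr A B"
  by (auto simp: int_Loose_def LooseArr_def)

lemma LHomE:
  assumes "f \<in> LHom Dbl A B"
  obtains f' where "f = (A, B, f')" "f' \<in> LooseArr A B"
  using assms by (cases f) (auto simp: LHom_def int_Loose_iff)

lemma LHom_iff: "(A, B, f) \<in> LHom Dbl A' B' \<longleftrightarrow> A = A' \<and> B = B' \<and> f \<in> LooseArr A B"
  by (auto simp: LHom_def int_Loose_iff)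

lemma int_Cell_iff: "int_Cell C (A1, B1, f1) (A2, B2, f2) s t \<longleftrightarrow> icell A1 B1 f1 A2 B2 f2 s t"
  by (auto simp: int_Loose_iff icell_def)

lemma LooseArr_IObj: "f \<in> LooseArr A B \<Longrightarrow> A \<in> IObj" "f \<in> LooseArr A B \<Longrightarrow> B \<in> IObj"
  by (auto simp: LooseArr_def split: if_splits)

lemma int_CellE:
  assumes "int_Cell C f g s t"
  obtains A1 B1 f1 A2 B2 f2 where "f = (A1, B1, f1)" "g = (A2, B2, f2)" "icell A1 B1 f1 A2 B2 f2 s t"
  using assms by (cases f; cases g) (metis int_Cell_iff)

lemma icell_refl: "f \<in> LooseArr A B \<Longrightarrow> icell A B f A B f (\<one> (A\<^sup>-), \<one> (A\<^sup>+)) (\<one> (B\<^sup>-), \<one> (B\<^sup>+))"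
  by (rule icellI) (auto simp: in_Hom_iff LooseArrD)

text \<open>
  A globular cell between parallel loose maps forces them to be equal, so the isomorphisms
  required below are all reflexivity at an equation from the previous sections.
\<close>

lemma globular_iso_refl: "f \<in> LooseArr A B \<Longrightarrow> globular_iso Dbl (A, B, f) (A, B, f)"
  using icell_refl[of f A B] by (cases A; cases B) (simp add: globular_iso_def int_Cell_iff del: int_Cell.simps)

lemma braid_LooseArr: "A \<in> IObj \<Longrightarrow> \<sigma> (A\<^sup>-) (A\<^sup>+) \<in> LooseArr A A"
  by (rule LooseArrI) auto

lemma icell_lident:
  assumes "s \<in> Hom (prod_sm C C) A B"
  shows "icell A A (\<sigma> (A\<^sup>-) (A\<^sup>+)) B B (\<sigma> (B\<^sup>-) (B\<^sup>+)) s s"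
proof -
  have h: "s\<^sup>- \<in> Hom C (A\<^sup>-) (B\<^sup>-)" "s\<^sup>+ \<in> Hom C (A\<^sup>+) (B\<^sup>+)" using assms by (auto simp: Hom_prod_sm)
  have "A \<in> IObj" "B \<in> IObj" using Hom_Obj[OF h(1)] Hom_Obj[OF h(2)] by (auto simp: mem_Times_iff)
  then show ?thesis
    using h braid_natural[OF h] by (intro icellI braid_LooseArr) auto
qed

sublocale prod: symmetric_monoidal_category "prod_sm C C"
  by (rule symmetric_monoidal_category_prod_sm) unfold_locales

lemma inv_prod:
  "iso_arrow C (f\<^sup>-) \<Longrightarrow> iso_arrow C (f\<^sup>+) \<Longrightarrow> inv\<^bsub>prod_sm C C\<^esub> f = (inv (f\<^sup>-), inv (f\<^sup>+))"
  by (rule inv_prod_sm) unfold_locales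

lemma thin_double_category_int: "thin_double_category Dbl"
proof (rule thin_double_category.intro)
  show "category (Tight Dbl)" by (simp add: prod.category_axioms)
  show "lsrc Dbl f \<in> Obj (Tight Dbl)" if "f \<in> Loose Dbl" for f
    using that by (cases f) (auto simp: int_Loose_def)
  show "ltgt Dbl f \<in> Obj (Tight Dbl)" if "f \<in> Loose Dbl" for f
    using that by (cases f) (auto simp: int_Loose_def)
  show "lident Dbl A \<in> LHom Dbl A A" if "A \<in> Obj (Tight Dbl)" for A
    using that by (simp add: int_lident_def LHom_iff braid_LooseArr)
  show "lcomp Dbl g f \<in> LHom Dbl A E"
    if "f \<in> LHom Dbl A B" "g \<in> LHom Dbl B E" for f g A B E
    using that by (elim LHomE) (simp add: int_lcomp_eq LHom_iff lcomp_arr_LooseArr del: int_lcomp.simps)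
  show "f \<in> Loose Dbl \<and> g \<in> Loose Dbl" if "Cell Dbl f g s t" for f g s t
    using that by (cases f; cases g) simp
  show "s \<in> Hom (Tight Dbl) (lsrc Dbl f) (lsrc Dbl g)
      \<and> t \<in> Hom (Tight Dbl) (ltgt Dbl f) (ltgt Dbl g)"
    if "Cell Dbl f g s t" for f g s t
    using that by (cases f; cases g) simp
  show "Cell Dbl f f (\<one>\<^bsub>Tight Dbl\<^esub> A) (\<one>\<^bsub>Tight Dbl\<^esub> B)"
    if "f \<in> LHom Dbl A B" for f A B
    using that by (elim LHomE) (cases A; cases B; use icell_refl[of _ A B] in \<open>auto simp: int_Cell_iff simp del: int_Cell.simps\<close>)
  show "Cell Dbl f h (comp (Tight Dbl) s' s) (comp (Tight Dbl) t' t)"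
    if "Cell Dbl f g s t" "Cell Dbl g h s' t'" for f g h s t s' t'
    using that unfolding int_double_simps
    by (elim int_CellE) (auto simp: int_Cell_iff simp del: int_Cell.simps intro: icell_vcomp)
  show "Cell Dbl (lident Dbl A) (lident Dbl B) s s"
    if "s \<in> Hom (Tight Dbl) A B" for s A B
    using that by (simp add: int_lident_def int_Cell_iff icell_lident del: int_Cell.simps)
  show "Cell Dbl (lcomp Dbl f' f) (lcomp Dbl g' g) s u"
    if "Cell Dbl f g s t" "Cell Dbl f' g' t u"
      "f \<in> LHom Dbl A B" "f' \<in> LHom Dbl B E"
      "g \<in> LHom Dbl A' B'" "g' \<in> LHom Dbl B' E'"
    for f f' g g' s t u A B E A' B' E'
    using that unfolding int_double_simps
    by (elim LHomE) (auto simp: int_Cell_iff int_lcomp_eq simp del: int_Cell.simps int_lcomp.simps intro: icell_lcomp)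
  show "globular_iso Dbl (lcomp Dbl (lcomp Dbl h g) f)
      (lcomp Dbl h (lcomp Dbl g f))"
    if "f \<in> LHom Dbl A B" "g \<in> LHom Dbl B E" "h \<in> LHom Dbl E F"
    for f g h A B E F
    using that by (elim LHomE) (simp add: int_lcomp_eq lcomp_arr_assoc globular_iso_refl lcomp_arr_LooseArr del: int_lcomp.simps)
  show "globular_iso Dbl (lcomp Dbl (lident Dbl B) f) f"
    if "f \<in> LHom Dbl A B" for f A B
    using that by (elim LHomE) (simp add: int_lident_def int_lcomp_eq lcomp_arr_ident_left globular_iso_refl del: int_lcomp.simps)
  show "globular_iso Dbl (lcomp Dbl f (lident Dbl A)) f"
    if "f \<in> LHom Dbl A B" for f A B
    using that by (elim LHomE) (simp add: int_lident_def int_lcomp_eq lcomp_arr_ident_right globular_iso_refl del: int_lcomp.simps)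
qed

lemma icell_assoc:
  assumes h: "f \<in> LooseArr A A'" "g \<in> LooseArr B B'" "h \<in> LooseArr E E'"
  shows "icell ((A \<otimes>\<^sub>i B) \<otimes>\<^sub>i E) ((A' \<otimes>\<^sub>i B') \<otimes>\<^sub>i E') (ltensor_arr (A \<otimes>\<^sub>i B) (A' \<otimes>\<^sub>i B') E E' (ltensor_arr A A' B B' f g) h)
    (A \<otimes>\<^sub>i (B \<otimes>\<^sub>i E)) (A' \<otimes>\<^sub>i (B' \<otimes>\<^sub>i E')) (ltensor_arr A A' (B \<otimes>\<^sub>i E) (B' \<otimes>\<^sub>i E') f (ltensor_arr B B' E E' g h))
    (\<alpha> (A\<^sup>-) (B\<^sup>-) (E\<^sup>-), \<alpha> (A\<^sup>+) (B\<^sup>+) (E\<^sup>+)) (\<alpha> (A'\<^sup>-) (B'\<^sup>-) (E'\<^sup>-), \<alpha> (A'\<^sup>+) (B'\<^sup>+) (E'\<^sup>+))"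
  by (rule icellI)
    (use LooseArrD[OF h(1)] LooseArrD[OF h(2)] LooseArrD[OF h(3)] ltensor_arr_assoc[OF h] in
      \<open>simp_all add: in_Hom_iff ltensor_arr_LooseArr[OF ltensor_arr_LooseArr[OF h(1,2)] h(3), simplified]
         ltensor_arr_LooseArr[OF h(1) ltensor_arr_LooseArr[OF h(2,3)], simplified]\<close>)

lemma icell_lunit:
  assumes f: "f \<in> LooseArr A B"
  shows "icell ((\<I>, \<I>) \<otimes>\<^sub>i A) ((\<I>, \<I>) \<otimes>\<^sub>i B) (ltensor_arr (\<I>, \<I>) (\<I>, \<I>) A B (\<sigma> \<I> \<I>) f) A B f
    (lunit C (A\<^sup>-), lunit C (A\<^sup>+)) (lunit C (B\<^sup>-), lunit C (B\<^sup>+))"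
proof -
  have I: "\<sigma> \<I> \<I> \<in> LooseArr (\<I>, \<I>) (\<I>, \<I>)" by (rule LooseArrI) simp_all
  show ?thesis
    by (rule icellI)
      (use LooseArrD[OF f] ltensor_arr_lunit[OF f] f ltensor_arr_LooseArr[OF I f] in \<open>simp_all add: in_Hom_iff\<close>)
qed

lemma icell_runit:
  assumes f: "f \<in> LooseArr A B"
  shows "icell (A \<otimes>\<^sub>i (\<I>, \<I>)) (B \<otimes>\<^sub>i (\<I>, \<I>)) (ltensor_arr A B (\<I>, \<I>) (\<I>, \<I>) f (\<sigma> \<I> \<I>)) A B f
    (\<rho> (A\<^sup>-), \<rho> (A\<^sup>+)) (\<rho> (B\<^sup>-), \<rho> (B\<^sup>+))"
proof -
  have I: "\<sigma> \<I> \<I> \<in> LooseArr (\<I>, \<I>) (\<I>, \<I>)" by (rule LooseArrI) simp_all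
  show ?thesis
    by (rule icellI)
      (use LooseArrD[OF f] ltensor_arr_runit[OF f] f ltensor_arr_LooseArr[OF f I] in \<open>simp_all add: in_Hom_iff\<close>)
qed

lemma icell_braid:
  assumes f: "f \<in> LooseArr A A'" and g: "g \<in> LooseArr B B'"
  shows "icell (A \<otimes>\<^sub>i B) (A' \<otimes>\<^sub>i B') (ltensor_arr A A' B B' f g) (B \<otimes>\<^sub>i A) (B' \<otimes>\<^sub>i A') (ltensor_arr B B' A A' g f)
    (\<sigma> (A\<^sup>-) (B\<^sup>-), \<sigma> (A\<^sup>+) (B\<^sup>+)) (\<sigma> (A'\<^sup>-) (B'\<^sup>-), \<sigma> (A'\<^sup>+) (B'\<^sup>+))"
  by (rule icellI)
    (use LooseArrD[OF f] LooseArrD[OF g] ltensor_arr_braid[OF f g] ltensor_arr_LooseArr[OF f g] ltensor_arr_LooseArr[OF g f] in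
      \<open>simp_all add: in_Hom_iff\<close>)

lemma map_prod_eq: "map_prod f g p = (f (fst p), g (snd p))"
  by (cases p) simp

text \<open>
  The equations for triples replace the recursive definitions, so that rewriting stops at the arrows
  \<open>lcomp_arr\<close> and \<open>ltensor_arr\<close>.
\<close>

lemmas int_unfolds = int_lcomp.simps int_ltensor.simps int_Cell.simps
lemmas int_eqs = int_lcomp_eq int_ltensor_eq int_Cell_iff int_lident_def map_prod_eq

lemma thin_symmetric_monoidal_double_category_int:
  "thin_symmetric_monoidal_double_category Dbl"
proof (rule thin_symmetric_monoidal_double_category.intro[OF thin_double_category_int],
    rule thin_symmetric_monoidal_double_category_axioms.intro)
  note [simp del] = int_unfolds
  note [simp] = int_eqs inv_prod LHom_iff
  show "symmetric_monoidal_category (Tight Dbl)"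
    by (simp add: prod.symmetric_monoidal_category_axioms)
  fix f g h f' g' s t s' t' A A' B B' E E'
  show "ltensor Dbl f g \<in> LHom Dbl (tensor_obj (Tight Dbl) A A') (tensor_obj (Tight Dbl) B B')"
    if "f \<in> LHom Dbl A B" "g \<in> LHom Dbl A' B'"
    using that by (elim LHomE) (simp add: ltensor_arr_LooseArr)
  show "Cell Dbl (ltensor Dbl f f') (ltensor Dbl g g')
      (tensor_arr (Tight Dbl) s s') (tensor_arr (Tight Dbl) t t')"
    if "Cell Dbl f g s t" "Cell Dbl f' g' s' t'"
    using that unfolding int_double_simps by (elim int_CellE) (auto intro: icell_ltensor)
  show "globular_iso Dbl (lcomp Dbl (ltensor Dbl g g') (ltensor Dbl f f'))
      (ltensor Dbl (lcomp Dbl g f) (lcomp Dbl g' f'))"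
    if "f \<in> LHom Dbl A B" "g \<in> LHom Dbl B E" "f' \<in> LHom Dbl A' B'" "g' \<in> LHom Dbl B' E'"
    using that by (elim LHomE) (simp add: ltensor_arr_lcomp globular_iso_refl ltensor_arr_LooseArr lcomp_arr_LooseArr)
  show "globular_iso Dbl (lident Dbl (tensor_obj (Tight Dbl) A B))
      (ltensor Dbl (lident Dbl A) (lident Dbl B))"
    if "A \<in> Obj (Tight Dbl)" "B \<in> Obj (Tight Dbl)"
  proof -
    have AB: "A \<in> IObj" "B \<in> IObj" using that by auto
    have "\<sigma> (A\<^sup>- \<otimes> B\<^sup>-) (A\<^sup>+ \<otimes> B\<^sup>+) \<in> LooseArr (A \<otimes>\<^sub>i B) (A \<otimes>\<^sub>i B)"
      using braid_LooseArr[of "A \<otimes>\<^sub>i B"] AB by (auto simp: mem_Times_iff)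
    then show ?thesis using AB by (simp add: ltensor_arr_ident globular_iso_refl)
  qed
  show "Cell Dbl (ltensor Dbl (ltensor Dbl f g) h) (ltensor Dbl f (ltensor Dbl g h))
      (assoc (Tight Dbl) A B E) (assoc (Tight Dbl) A' B' E')" (is ?g0)
    and "Cell Dbl (ltensor Dbl f (ltensor Dbl g h)) (ltensor Dbl (ltensor Dbl f g) h)
      (inv\<^bsub>Tight Dbl\<^esub> (assoc (Tight Dbl) A B E)) (inv\<^bsub>Tight Dbl\<^esub> (assoc (Tight Dbl) A' B' E'))" (is ?g1)
    if "f \<in> LHom Dbl A A'" "g \<in> LHom Dbl B B'" "h \<in> LHom Dbl E E'"
  proof -
    obtain f' g' h' where eqs: "f = (A, A', f')" "g = (B, B', g')" "h = (E, E', h')"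
      and H: "f' \<in> LooseArr A A'" "g' \<in> LooseArr B B'" "h' \<in> LooseArr E E'"
      using \<open>f \<in> _\<close> \<open>g \<in> _\<close> \<open>h \<in> _\<close> by (elim LHomE) auto
    note [simp] = LooseArrD(1-4)[OF H(1)] LooseArrD(1-4)[OF H(2)] LooseArrD(1-4)[OF H(3)]
    show ?g0
      using icell_assoc[OF H] by (simp add: eqs)
    show ?g1
      using icell_inv[OF icell_assoc[OF H]] by (simp add: eqs)
  qed
  show "Cell Dbl (ltensor Dbl (lident Dbl (unit_obj (Tight Dbl))) f) f
      (lunit (Tight Dbl) A) (lunit (Tight Dbl) A')" (is ?g2)
    and "Cell Dbl f (ltensor Dbl (lident Dbl (unit_obj (Tight Dbl))) f)
      (inv\<^bsub>Tight Dbl\<^esub> (lunit (Tight Dbl) A)) (inv\<^bsub>Tight Dbl\<^esub> (lunit (Tight Dbl) A'))" (is ?g3)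
    and "Cell Dbl (ltensor Dbl f (lident Dbl (unit_obj (Tight Dbl)))) f
      (runit (Tight Dbl) A) (runit (Tight Dbl) A')" (is ?g4)
    and "Cell Dbl f (ltensor Dbl f (lident Dbl (unit_obj (Tight Dbl))))
      (inv\<^bsub>Tight Dbl\<^esub> (runit (Tight Dbl) A)) (inv\<^bsub>Tight Dbl\<^esub> (runit (Tight Dbl) A'))" (is ?g5)
    if "f \<in> LHom Dbl A A'"
  proof -
    obtain f' where eqs: "f = (A, A', f')" and H: "f' \<in> LooseArr A A'"
      using \<open>f \<in> _\<close> by (elim LHomE) auto
    note [simp] = LooseArrD(1-4)[OF H]
    show ?g2
      using icell_lunit[OF H] by (simp add: eqs)
    show ?g3
      using icell_inv[OF icell_lunit[OF H]] by (simp add: eqs)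
    show ?g4
      using icell_runit[OF H] by (simp add: eqs)
    show ?g5
      using icell_inv[OF icell_runit[OF H]] by (simp add: eqs)
  qed
  show "Cell Dbl (ltensor Dbl f g) (ltensor Dbl g f)
      (braid (Tight Dbl) A B) (braid (Tight Dbl) A' B')"
    if "f \<in> LHom Dbl A A'" "g \<in> LHom Dbl B B'"
    using that by (elim LHomE) (simp add: icell_braid)
qed

definition int_dual :: "('o, 'm) int_loose \<Rightarrow> ('o, 'm) int_loose" where
  "int_dual = (\<lambda>(A, B, f). (idual B, idual A, dual_arr A B f))"

definition int_flat :: "'o \<times> 'o \<Rightarrow> 'o \<times> 'o \<Rightarrow> 'o \<times> 'o \<Rightarrow> ('o, 'm) int_loose \<Rightarrow> ('o, 'm) int_loose" where
  "int_flat A B K = (\<lambda>(_, _, f). (A, idual B \<otimes>\<^sub>i K, flat_arr A B K f))"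

lemma int_dual_eq: "int_dual (A, B, f) = (idual B, idual A, dual_arr A B f)"
  by (simp add: int_dual_def)

lemma int_flat_eq: "int_flat A B K (X, Y, f) = (A, idual B \<otimes>\<^sub>i K, flat_arr A B K f)"
  by (simp add: int_flat_def)

lemma loose_op_simps:
  "Tight (loose_op D) = Tight D" "Loose (loose_op D) = Loose D" "lsrc (loose_op D) = ltgt D" "ltgt (loose_op D) = lsrc D"
  "lident (loose_op D) = lident D" "lcomp (loose_op D) = (\<lambda>g f. lcomp D f g)" "Cell (loose_op D) = (\<lambda>f g s t. Cell D f g t s)"
  by (simp_all add: loose_op_def)

lemma LHom_loose_op: "LHom (loose_op D) A B = LHom D B A"
  by (auto simp: LHom_def loose_op_simps)

lemma double_functor_dual: "double_functor (loose_op Dbl) Dbl (\<lambda>A. idual A) (\<lambda>s. (s\<^sup>+, s\<^sup>-)) int_dual"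
proof (rule double_functor.intro)
  note [simp del] = int_unfolds
  note [simp] = int_eqs LHom_iff loose_op_simps LHom_loose_op Hom_prod_sm int_dual_eq
  fix A B G f g s t
  show "globular_iso Dbl (int_dual (lident (loose_op Dbl) A)) (lident Dbl (idual A))"
    if "A \<in> Obj (Tight (loose_op Dbl))"
  proof -
    have A: "A \<in> IObj" using that by simp
    have "\<sigma> (A\<^sup>+) (A\<^sup>-) \<in> LooseArr (idual A) (idual A)"
      using braid_LooseArr[of "idual A"] A by (auto simp: mem_Times_iff)
    then show ?thesis using A by (simp add: dual_arr_ident globular_iso_refl)
  qed
  show "globular_iso Dbl (int_dual (lcomp (loose_op Dbl) g f)) (lcomp Dbl (int_dual g) (int_dual f))"
    if "f \<in> LHom (loose_op Dbl) A B" "g \<in> LHom (loose_op Dbl) B G"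
    using that unfolding LHom_loose_op by (elim LHomE) (simp add: dual_arr_lcomp globular_iso_refl lcomp_arr_LooseArr dual_arr_LooseArr)
  show "int_dual f \<in> LHom Dbl (idual A) (idual B)" if "f \<in> LHom (loose_op Dbl) A B"
    using that unfolding LHom_loose_op by (elim LHomE) (simp add: dual_arr_LooseArr)
  show "Cell Dbl (int_dual f) (int_dual g) (s\<^sup>+, s\<^sup>-) (t\<^sup>+, t\<^sup>-)" if "Cell (loose_op Dbl) f g s t"
    using that unfolding loose_op_simps int_double_simps by (elim int_CellE) (auto intro: icell_dual)
qed (auto simp: loose_op_simps Hom_prod_sm)

lemma compact_structure_int:
  "compact_structure Dbl (\<lambda>A. idual A) (\<lambda>s. (s\<^sup>+, s\<^sup>-)) int_dual int_flat"
proof (rule compact_structure.intro[OF thin_symmetric_monoidal_double_category_int double_functor_dual],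
    rule compact_structure_axioms.intro)
  note [simp del] = int_unfolds
  note [simp] = int_eqs LHom_iff int_dual_eq int_flat_eq
  fix A B K
  assume "A \<in> Obj (Tight Dbl)" "B \<in> Obj (Tight Dbl)" "K \<in> Obj (Tight Dbl)"
  then have O: "A \<in> IObj" "B \<in> IObj" "K \<in> IObj" by simp_all
  have L: "LHom Dbl X Y = Pair X ` Pair Y ` LooseArr X Y" for X Y
    by (auto simp: LHom_def int_Loose_iff image_iff)
  have "bij_betw (\<lambda>f. (A, idual B \<otimes>\<^sub>i K, flat_arr A B K (snd (snd f))))
     (Pair (A \<otimes>\<^sub>i B) ` Pair K ` LooseArr (A \<otimes>\<^sub>i B) K) (Pair A ` Pair (idual B \<otimes>\<^sub>i K) ` LooseArr A (idual B \<otimes>\<^sub>i K))"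
    using flat_arr_bij[OF O] by (auto simp only: bij_betw_def inj_on_def image_image fst_conv snd_conv prod.inject image_iff ball_simps)
  then show "bij_betw (int_flat A B K) (LHom Dbl (tensor_obj (Tight Dbl) A B) K)
      (LHom Dbl A (tensor_obj (Tight Dbl) (idual B) K))"
    unfolding L int_flat_def case_prod_unfold by simp
next
  note [simp del] = int_unfolds
  note [simp] = int_eqs LHom_iff int_dual_eq int_flat_eq
  fix s t u A1 A2 B1 B2 K1 K2 f1 f2
  assume "s \<in> Hom (Tight Dbl) A1 A2" "t \<in> Hom (Tight Dbl) B1 B2" "u \<in> Hom (Tight Dbl) K1 K2"
    "f1 \<in> LHom Dbl (tensor_obj (Tight Dbl) A1 B1) K1"
    "f2 \<in> LHom Dbl (tensor_obj (Tight Dbl) A2 B2) K2"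
  then show "Cell Dbl f1 f2 (tensor_arr (Tight Dbl) s t) u
    \<longleftrightarrow> Cell Dbl (int_flat A1 B1 K1 f1) (int_flat A2 B2 K2 f2) s (tensor_arr (Tight Dbl) (t\<^sup>+, t\<^sup>-) u)"
    by (elim LHomE) (simp add: icell_flat_iff[simplified])
next
  note [simp del] = int_unfolds
  note [simp] = int_eqs LHom_iff int_dual_eq int_flat_eq
  fix a b c f A A' B B' K K'
  assume "a \<in> LHom Dbl A' A" "b \<in> LHom Dbl B' B" "c \<in> LHom Dbl K K'"
    "f \<in> LHom Dbl (tensor_obj (Tight Dbl) A B) K"
  then obtain a' b' c' f' where eqs: "a = (A', A, a')" "b = (B', B, b')" "c = (K, K', c')" "f = (A \<otimes>\<^sub>i B, K, f')"
    and H: "a' \<in> LooseArr A' A" "b' \<in> LooseArr B' B" "c' \<in> LooseArr K K'" "f' \<in> LooseArr (A \<otimes>\<^sub>i B) K"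
    by (elim LHomE) auto
  have *: "flat_arr A' B' K' (lcomp_arr (A' \<otimes>\<^sub>i B') K K' c'
        (lcomp_arr (A' \<otimes>\<^sub>i B') (A \<otimes>\<^sub>i B) K f' (ltensor_arr A' A B' B a' b'))) \<in> LooseArr A' (idual B' \<otimes>\<^sub>i K')"
    using flat_arr_LooseArr[OF LooseArr_IObj(1)[OF H(1)] LooseArr_IObj(1)[OF H(2)] lcomp_arr_LooseArr[OF lcomp_arr_LooseArr[OF ltensor_arr_LooseArr[OF H(1,2)] H(4)] H(3)]]
    by simp
  show "globular_iso Dbl (lcomp Dbl (ltensor Dbl (int_dual b) c) (lcomp Dbl (int_flat A B K f) a))
    (int_flat A' B' K' (lcomp Dbl c (lcomp Dbl f (ltensor Dbl a b))))"
    using globular_iso_refl[OF *] flat_arr_natural[OF H] by (simp add: eqs)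
qed

end

theorem theorem4p2:
  fixes U :: "('o, 'm) traced_data"
  assumes "uniform_traced_category U"
  shows "compact_double_category (int_double U)"
  using uniform_traced_category.compact_structure_int[OF assms] unfolding compact_double_category_def by blast

end
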